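(* Let $d\ge1$ be an integer, let $t\in(0,\infty)$, and let $(\lambda_n)$ be a sequence of nonnegative integers such that $\lambda_n/n$ converges to $\rho(d)t/2$. Let $\mathcal G(n,\lambda_n)$ be the random geometric graph in which nodes $X_1,\dots,X_n$ are chosen at random uniformly and independently from $[0,1]^d$ and $\lambda_n$ edges are inserted at random among the nodes. Then, as $n\to\infty$, the degree distribution $D_X$ of $\mathcal G(n,\lambda_n)$ satisfies a large deviation principle with speed $n$ on the space $\mathcal P(\mathcal Z)$ with good rate function $$\eta(\delta)=\begin{cases}H(\delta\,\|\,q_{\langle\delta\rangle}) & \text{if }\langle\delta\rangle=\rho(d)t,\\ \infty & \text{otherwise.}\end{cases}$$
   Context: $\mathcal Z=\{0,1,2,\dots\}$; $\mathcal P(\mathcal Z)$ is the set of probability vectors on $\mathcal Z$ with the weak topology. $\rho(d)=\pi^{d/2}/\Gamma\big(\frac{d+2}{2}\big)$, where $\Gamma$ is the gamma function. $D_X(r)$ is the proportion of the $n$ nodes having degree $r$, for $r\in\mathcal Z$. For $\delta\in\mathcal P(\mathcal Z)$, $\langle\delta\rangle=\sum_{r=0}^\infty r\,\delta(r)$; $q_c$ denotes the Poisson distribution with mean $c$; $H(\cdot\|\cdot)$ is relative entropy. "$\lambda_n$ edges are inserted at random among the nodes" means that the edge set is a uniformly chosen set of $\lambda_n$ distinct unordered pairs of distinct nodes (the classical Erdős–Rényi graph with $\lambda_n$ edges, on nodes in $[0,1]^d$), defined for all $n$ large enough that $\lambda_n\le\binom n2$. *)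

theory Defs
  imports "HOL-Probability.Probability"
begin

section \<open>Large deviation principles\<close>

text \<open>The logarithm of a probability, with \<open>log 0 = -\<infinity>\<close> (whereas \<open>ln 0 = 0\<close> for type \<open>real\<close>).\<close>

definition log_prob :: "real \<Rightarrow> ereal" where
  "log_prob p = (if p = 0 then -\<infinity> else ereal (ln p))"

definition borel_of_topology :: "'a topology \<Rightarrow> 'a measure" where
  "borel_of_topology T = sigma (topspace T) {U. openin T U}"

definition rate_function :: "'a topology \<Rightarrow> ('a \<Rightarrow> ereal) \<Rightarrow> bool" where
  "rate_function T I \<longleftrightarrow>
     (\<forall>x\<in>topspace T. 0 \<le> I x) \<and>
     (\<forall>\<alpha>::real. closedin T {x \<in> topspace T. I x \<le> ereal \<alpha>})"

definition good_rate_function :: "'a topology \<Rightarrow> ('a \<Rightarrow> ereal) \<Rightarrow> bool" where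
  "good_rate_function T I \<longleftrightarrow>
     rate_function T I \<and>
     (\<forall>\<alpha>::real. compactin T {x \<in> topspace T. I x \<le> ereal \<alpha>})"

text \<open>
  The random elements \<open>Y n\<close> of the space \<open>T\<close>, defined on probability spaces \<open>M n\<close>
  that may vary with \<open>n\<close>, satisfy a large deviation principle with speed \<open>a\<close> and rate
  function \<open>I\<close>.  As the principle is asymptotic, \<open>Y n\<close> need only be defined
  for all sufficiently large \<open>n\<close>.
\<close>

definition large_deviation_principle ::
    "'a topology \<Rightarrow> (nat \<Rightarrow> 'w measure) \<Rightarrow> (nat \<Rightarrow> 'w \<Rightarrow> 'a) \<Rightarrow> (nat \<Rightarrow> real) \<Rightarrow> ('a \<Rightarrow> ereal) \<Rightarrow> bool"
  where
  "large_deviation_principle T M Y a I \<longleftrightarrow>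
     rate_function T I \<and>
     filterlim a at_top sequentially \<and>
     (\<forall>\<^sub>F n in sequentially. prob_space (M n) \<and> Y n \<in> M n \<rightarrow>\<^sub>M borel_of_topology T) \<and>
     (\<forall>F. closedin T F \<longrightarrow>
        limsup (\<lambda>n. log_prob (measure (M n) {\<omega> \<in> space (M n). Y n \<omega> \<in> F}) / ereal (a n))
          \<le> - (INF x\<in>F. I x)) \<and>
     (\<forall>G. openin T G \<longrightarrow>
        - (INF x\<in>G. I x)
          \<le> liminf (\<lambda>n. log_prob (measure (M n) {\<omega> \<in> space (M n). Y n \<omega> \<in> G}) / ereal (a n)))"

section \<open>Probability vectors on the nonnegative integers\<close>

text \<open>
  The coarsest topology for which \<open>\<delta> \<mapsto> \<integral> f d\<delta>\<close> is continuous for every bounded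
  continuous \<open>f\<close>.  As the space of nonnegative integers is discrete, every \<open>f\<close> is continuous.
\<close>

definition weak_topology :: "nat pmf topology" where
  "weak_topology = topology_generated_by
     {{\<delta>. measure_pmf.expectation \<delta> f \<in> U} | (f :: nat \<Rightarrow> real) U. bounded (range f) \<and> open U}"

definition pmf_mean :: "nat pmf \<Rightarrow> ennreal" where
  "pmf_mean \<delta> = (\<Sum>r. ennreal (real r * pmf \<delta> r))"

text \<open>
  Relative entropy \<open>H(\<mu> || \<nu>)\<close> of \<open>\<mu>\<close> with respect to \<open>\<nu>\<close>, with natural logarithms.
  In \<^const>\<open>KL_divergence\<close> the reference measure comes first, and divergent integrals are
  replaced by \<open>0\<close>.  For probability measures the negative part of \<open>ln (d\<mu>/d\<nu>)\<close> is always
  \<open>\<mu>\<close>-integrable, so failure of integrability means that the integral is \<open>\<infinity>\<close>.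
\<close>

definition relative_entropy :: "'a measure \<Rightarrow> 'a measure \<Rightarrow> ereal" where
  "relative_entropy \<mu> \<nu> =
     (if absolutely_continuous \<nu> \<mu> \<and> integrable \<mu> (entropy_density (exp 1) \<nu> \<mu>)
      then ereal (KL_divergence (exp 1) \<nu> \<mu>) else \<infinity>)"

section \<open>Random geometric graphs and their degree distribution\<close>

text \<open>
  A geometric graph on \<open>n\<close> nodes is a pair \<open>(X, E)\<close>: the node labelled \<open>i \<in> {1..n}\<close> is located
  at \<open>X i\<close>, and the edges in \<open>E\<close> are two-element sets of labels.
\<close>

type_synonym 'd geometric_graph = "(nat \<Rightarrow> real ^ 'd) \<times> nat set set"

definition node_pairs :: "nat \<Rightarrow> nat set set" where
  "node_pairs n = {e. e \<subseteq> {1..n} \<and> card e = 2}"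

text \<open>
  The node positions are independent and uniform on the unit cube and, independently of them,
  the edge set is uniform among all sets of \<open>m\<close> node pairs.
  This is a probability space only if \<open>m \<le> n choose 2\<close>.
\<close>

definition random_geometric_graph ::
    "nat \<Rightarrow> nat \<Rightarrow> 'd::finite geometric_graph measure" where
  "random_geometric_graph n m =
     (\<Pi>\<^sub>M i\<in>{1..n}. uniform_measure lborel (cbox (0 :: real ^ 'd) 1)) \<Otimes>\<^sub>M
     uniform_count_measure {E. E \<subseteq> node_pairs n \<and> card E = m}"

lemma prob_space_random_geometric_graph:
  assumes "m \<le> n choose 2"
  shows "prob_space (random_geometric_graph n m :: 'd::finite geometric_graph measure)"
proof -
  have inner_Basis: "(1 :: real ^ 'd) \<bullet> b = 1" if "b \<in> Basis" for b
    using that by (auto simp: Basis_vec_def inner_axis)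
  have vol: "emeasure lborel (cbox (0 :: real ^ 'd) 1) = 1"
    by (subst emeasure_lborel_cbox_eq) (simp add: inner_Basis)
  interpret U: prob_space "uniform_measure lborel (cbox (0 :: real ^ 'd) 1)"
    by (rule prob_space_uniform_measure) (use vol in auto)
  interpret X: prob_space "\<Pi>\<^sub>M i\<in>{1..n}. uniform_measure lborel (cbox (0 :: real ^ 'd) 1)"
    by (rule prob_space_PiM) (rule U.prob_space_axioms)
  have fin: "finite (node_pairs n)"
    by (rule finite_subset[of _ "Pow {1..n}"]) (auto simp: node_pairs_def)
  have "card (node_pairs n) = n choose 2"
    unfolding node_pairs_def by (subst n_subsets) auto
  then obtain E where "E \<subseteq> node_pairs n" "card E = m"
    using assms by (metis obtain_subset_with_card_n)
  then have "prob_space (uniform_count_measure {E. E \<subseteq> node_pairs n \<and> card E = m})"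
    by (intro prob_space_uniform_count_measure) (use fin in auto)
  then interpret E: prob_space "uniform_count_measure {E. E \<subseteq> node_pairs n \<and> card E = m}" .
  interpret XE: pair_prob_space
    "\<Pi>\<^sub>M i\<in>{1..n}. uniform_measure lborel (cbox (0 :: real ^ 'd) 1)"
    "uniform_count_measure {E. E \<subseteq> node_pairs n \<and> card E = m}" ..
  show ?thesis
    unfolding random_geometric_graph_def by (rule XE.prob_space_axioms)
qed

definition node_degree :: "'d geometric_graph \<Rightarrow> nat \<Rightarrow> nat" where
  "node_degree G i = card {e \<in> snd G. i \<in> e}"

definition degree_distribution :: "nat \<Rightarrow> 'd geometric_graph \<Rightarrow> nat pmf" where
  "degree_distribution n G = map_pmf (node_degree G) (pmf_of_set {1..n})"

lemma pmf_degree_distribution: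
  assumes "n \<ge> 1"
  shows "pmf (degree_distribution n G) r = card {i \<in> {1..n}. node_degree G i = r} / n"
proof -
  have "{1..n} \<inter> node_degree G -` {r} = {i \<in> {1..n}. node_degree G i = r}" by auto
  with assms show ?thesis
    by (simp add: degree_distribution_def pmf_map measure_pmf_of_set)
qed

section \<open>The rate function\<close>

definition rho :: "nat \<Rightarrow> real" where
  "rho d = pi powr (real d / 2) / Gamma ((real d + 2) / 2)"

definition eta :: "nat \<Rightarrow> real \<Rightarrow> nat pmf \<Rightarrow> ereal" where
  "eta d t \<delta> =
     (if pmf_mean \<delta> = ennreal (rho d * t)
      then relative_entropy (measure_pmf \<delta>) (measure_pmf (poisson_pmf (enn2real (pmf_mean \<delta>))))
      else \<infinity>)"

end

theory Submission
  imports Defs "HOL-Combinatorics.Multiset_Permutations" "HOL-Real_Asymp.Real_Asymp"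
begin

text \<open>
  The positions of the nodes play no role: only the uniform edge set matters.  Every graph with
  \<open>m\<close> edges comes from exactly \<open>2 ^ m * fact m\<close> lists of \<open>m\<close> ordered pairs of nodes without
  loops and repetitions, and for a uniformly random list of pairs the degrees are multinomial
  occupancy numbers.  Counting lists with a given empirical degree distribution gives
  probability \<open>exp (- n * H)\<close> up to subexponential factors, where \<open>H\<close> is the entropy relative
  to the Poisson distribution with mean \<open>2 * m / n\<close>.

  For the upper bound, there are only subexponentially many empirical distributions (they are
  partitions of \<open>2 * m\<close>), and bounded relative entropy makes means converge along weakly convergent
  subsequences, which also gives compactness of the level sets of the rate function.

  For the lower bound, a random list of pairs has more than \<open>\<kappa> * n\<close> loops and repetitions only with
  superexponentially small probability, and repairing the others changes few degrees and
  identifies only \<open>exp (o n)\<close> times \<open>2 ^ m * fact m\<close> lists with the same graph.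
\<close>

text \<open>The mean of a distribution is not weakly continuous, and at finite \<open>n\<close> the
  mean degree \<open>2 * m / n\<close> only tends to its limit. Hence entropies are taken relative
  to Poisson distributions with a moving mean, and limits must be shown to lose no first moment.

  The two bounds compare graphs with lists differently. For the upper bound, the lists without loops
  and repetitions form a fraction of all lists that stays away from 0, because
  \<open>m * (n + 2 * m) / n ^ 2\<close> is bounded; dividing by it is free. For the lower bound one
  would need that fraction among the lists of one prescribed type, and since such a type has
  exponentially small probability itself, the unconditional estimate says nothing about it. Only
  events rarer than every exponential rate can be discarded there, which is why lists with few
  defects have to be kept and repaired.\<close>

section \<open>Relative entropy of probability vectors\<close>

text \<open>The correction \<open>q - x\<close> sums to zero over two probability vectors and makes each term nonnegative.\<close>

definition entropy_term :: "real \<Rightarrow> real \<Rightarrow> real" where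
  "entropy_term x q = x * ln (x / q) - x + q"

lemma entropy_term_nonneg:
  assumes "0 \<le> x" "0 < q"
  shows "0 \<le> entropy_term x q"
proof (cases "x = 0")
  case False
  with assms have "x > 0" by simp
  have "ln (q / x) \<le> q / x - 1" using assms \<open>x > 0\<close> by (intro ln_le_minus_one) auto
  then have "x * ln (q / x) \<le> x * (q / x - 1)" using \<open>x > 0\<close> by (intro mult_left_mono) auto
  also have "\<dots> = q - x" using \<open>x > 0\<close> by (simp add: field_simps)
  finally show ?thesis using assms \<open>x > 0\<close>
    by (simp add: entropy_term_def ln_div algebra_simps)
qed (use assms in \<open>simp add: entropy_term_def\<close>)

lemma entropy_term_zero [simp]: "entropy_term 0 q = q"
  by (simp add: entropy_term_def)

text \<open>This is nonnegativity of the entropy term against the tilted mass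
  \<open>q * exp y\<close>; the function \<open>q * (exp y - 1)\<close> of \<open>y\<close> is the
  convex conjugate of the entropy term.\<close>

lemma entropy_term_young:
  assumes "0 \<le> x" "0 < q"
  shows "x * y \<le> entropy_term x q + q * (exp y - 1)"
proof (cases "x = 0")
  case False
  with assms have "x > 0" by simp
  have "0 \<le> entropy_term x (q * exp y)" using assms by (intro entropy_term_nonneg) auto
  then show ?thesis using assms \<open>x > 0\<close>
    by (simp add: entropy_term_def ln_div ln_mult algebra_simps)
qed (use assms in \<open>simp add: algebra_simps\<close>)

text \<open>The value \<open>0 * ln 0 = 0\<close> is the limit from the right, so
  \<open>x * ln x\<close> is continuous within the nonnegative half-line, where all
  \<open>f n\<close> lie.\<close>

lemma tendsto_xlnx:
  fixes x :: real
  assumes "(f \<longlongrightarrow> x) F" "\<And>n. 0 \<le> f n" "0 \<le> x"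
  shows "((\<lambda>n. f n * ln (f n)) \<longlongrightarrow> x * ln x) F"
proof -
  have cont: "continuous (at x within {0..}) (\<lambda>x::real. x * ln x)"
  proof (cases "x = 0")
    case True
    have "((\<lambda>x::real. x * ln x) \<longlongrightarrow> 0) (at_right 0)" by real_asymp
    moreover have "at (0::real) within {0..} = at_right 0"
    proof -
      have "{0..} - {0::real} = {0<..} - {0}" by auto
      then show ?thesis by (simp add: at_within_def)
    qed
    ultimately show ?thesis using True by (simp add: continuous_within)
  next
    case False
    then show ?thesis using assms by (intro continuous_intros) auto
  qed
  show ?thesis
    using continuous_within_tendsto_compose[OF cont _ assms(1)] assms by auto
qed

lemma entropy_term_alt:
  assumes "0 \<le> x" "0 < q"
  shows "entropy_term x q = x * ln x - x * ln q - x + q"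
  using assms by (cases "x = 0") (auto simp: entropy_term_def ln_div algebra_simps)

lemma tendsto_entropy_term:
  assumes "(f \<longlongrightarrow> x) F" "\<And>n. 0 \<le> f n" "0 \<le> x" "(g \<longlongrightarrow> q) F" "\<And>n. 0 < g n" "0 < q"
  shows "((\<lambda>n. entropy_term (f n) (g n)) \<longlongrightarrow> entropy_term x q) F"
proof -
  have "((\<lambda>n. f n * ln (f n) - f n * ln (g n) - f n + g n)
      \<longlongrightarrow> x * ln x - x * ln q - x + q) F"
    by (intro tendsto_intros tendsto_xlnx assms) (use assms in auto)
  then show ?thesis using assms by (simp add: entropy_term_alt)
qed

section \<open>Relative entropy as a series of nonnegative terms\<close>

lemma sum_pmf_lessThan_le_1: "(\<Sum>r<K. pmf \<delta> r) \<le> (1::real)" for \<delta> :: "nat pmf"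
  by (metis finite_lessThan measure_measure_pmf_finite measure_pmf.prob_le_1)

lemma sums_pmf_nat: "(pmf \<delta> sums 1)" for \<delta> :: "nat pmf"
proof -
  have i: "integrable (count_space UNIV) (pmf \<delta>)" by (rule integrable_pmf)
  have "integral\<^sup>L (count_space UNIV) (pmf \<delta>) = 1"
    using integral_pmf[of UNIV \<delta>] by simp
  then show ?thesis
    using sums_integral_count_space_nat[OF i] by simp
qed

lemma measure_pmf_eq_density_pmf:
  fixes \<delta> q :: "nat pmf"
  assumes "\<And>r. 0 < pmf q r"
  shows "measure_pmf \<delta> = density (measure_pmf q) (\<lambda>r. ennreal (pmf \<delta> r / pmf q r))"
proof -
  have "density (measure_pmf q) (\<lambda>r. ennreal (pmf \<delta> r / pmf q r)) =
      density (count_space UNIV) (\<lambda>r. ennreal (pmf q r) * ennreal (pmf \<delta> r / pmf q r))"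
    by (subst measure_pmf_eq_density, subst density_density_eq) auto
  also have "(\<lambda>r. ennreal (pmf q r) * ennreal (pmf \<delta> r / pmf q r)) = (\<lambda>r. ennreal (pmf \<delta> r))"
    using assms by (auto simp flip: ennreal_mult simp: less_imp_neq[symmetric])
  finally show ?thesis by (simp add: measure_pmf_eq_density)
qed

lemma entropy_density_pmf:
  fixes \<delta> q :: "nat pmf"
  assumes "\<And>r. 0 < pmf q r"
  shows "entropy_density (exp 1) (measure_pmf q) (measure_pmf \<delta>) r = ln (pmf \<delta> r / pmf q r)"
proof -
  have "AE r in measure_pmf q. ennreal (pmf \<delta> r / pmf q r) =
      RN_deriv (measure_pmf q) (measure_pmf \<delta>) r"
    by (intro measure_pmf.RN_deriv_unique)
       (auto simp: measure_pmf_eq_density_pmf[OF assms, of \<delta>, symmetric])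
  \<comment> \<open>As \<open>q\<close> charges every integer, almost everywhere means
    everywhere.\<close>
  moreover have "set_pmf q = UNIV" using assms by (auto simp: set_pmf_iff less_imp_neq[symmetric])
  ultimately have "RN_deriv (measure_pmf q) (measure_pmf \<delta>) r = ennreal (pmf \<delta> r / pmf q r)"
    by (simp add: AE_measure_pmf_iff)
  then show ?thesis by (simp add: entropy_density_def log_def)
qed

text \<open>Bounds on all partial sums are the form in which relative entropy is used below: they
  involve no integrability and pass to pointwise limits. The corrections
  \<open>pmf \<delta> r - pmf q r\<close> are absolutely summable with sum 0, so the log density is
  integrable exactly when the nonnegative terms are summable, and the two sums agree.\<close>

lemma relative_entropy_le_iff:
  fixes \<delta> q :: "nat pmf"
  assumes q: "\<And>r. 0 < pmf q r"
  shows "relative_entropy (measure_pmf \<delta>) (measure_pmf q) \<le> ereal a \<longleftrightarrow>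
    (\<forall>K. (\<Sum>r<K. entropy_term (pmf \<delta> r) (pmf q r)) \<le> a)"
proof -
  let ?h = "\<lambda>r. entropy_term (pmf \<delta> r) (pmf q r)"
  let ?g = "\<lambda>r. pmf \<delta> r * ln (pmf \<delta> r / pmf q r)"
  have h0: "0 \<le> ?h r" for r using q by (intro entropy_term_nonneg) auto
  have d: "(\<lambda>r. pmf \<delta> r - pmf q r) sums 0"
    using sums_diff[OF sums_pmf_nat[of \<delta>] sums_pmf_nat[of q]] by simp
  have ad: "summable (\<lambda>r. \<bar>pmf \<delta> r - pmf q r\<bar>)"
  proof (rule summable_comparison_test)
    show "summable (\<lambda>r. pmf \<delta> r + pmf q r)"
      using sums_pmf_nat by (intro summable_add) (auto simp: sums_iff)
  qed (auto intro!: exI[of _ 0] abs_leI simp: add_increasing add_increasing2 pmf_nonneg) 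
  have gh: "?g r = ?h r + (pmf \<delta> r - pmf q r)" for r by (simp add: entropy_term_def)
  have ac: "absolutely_continuous (measure_pmf q) (measure_pmf \<delta>)"
    unfolding measure_pmf_eq_density_pmf[OF q, of \<delta>]
    by (rule absolutely_continuousI_density) auto
  have int_iff: "integrable (measure_pmf \<delta>) f \<longleftrightarrow> summable (\<lambda>r. \<bar>pmf \<delta> r * f r\<bar>)" for f :: "nat \<Rightarrow> real"
    by (subst measure_pmf_eq_density, subst integrable_density)
       (auto simp: integrable_count_space_nat_iff)
  have ed: "entropy_density (exp 1) (measure_pmf q) (measure_pmf \<delta>) = (\<lambda>r. ln (pmf \<delta> r / pmf q r))"
    using entropy_density_pmf[OF q] by auto
  have sg: "summable (\<lambda>r. \<bar>?g r\<bar>) \<longleftrightarrow> summable ?h"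
  proof
    assume "summable (\<lambda>r. \<bar>?g r\<bar>)"
    then have "summable ?g" by (rule summable_rabs_cancel)
    moreover have "?h = (\<lambda>r. ?g r - (pmf \<delta> r - pmf q r))" by (auto simp: gh)
    ultimately show "summable ?h" using d by (auto intro!: summable_diff simp: sums_iff)
  next
    assume "summable ?h"
    then have "summable (\<lambda>r. ?h r + \<bar>pmf \<delta> r - pmf q r\<bar>)" using ad by (intro summable_add)
    then show "summable (\<lambda>r. \<bar>?g r\<bar>)"
    proof (rule summable_comparison_test[rotated], intro exI[of _ 0] allI impI)
      fix r show "norm \<bar>?g r\<bar> \<le> ?h r + \<bar>pmf \<delta> r - pmf q r\<bar>"
        unfolding gh using h0[of r] by auto
    qed
  qed
  show ?thesis
  proof (cases "summable ?h")
    case True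
    then have i: "integrable (measure_pmf \<delta>) (\<lambda>r. ln (pmf \<delta> r / pmf q r))"
      using sg int_iff by simp
    have "KL_divergence (exp 1) (measure_pmf q) (measure_pmf \<delta>) = (\<integral>r. ln (pmf \<delta> r / pmf q r) \<partial>measure_pmf \<delta>)"
      by (simp add: KL_divergence_def ed)
    also have "\<dots> = (\<integral>r. ?g r \<partial>count_space UNIV)"
      by (subst measure_pmf_eq_density, subst integral_density) auto
    also have "\<dots> = suminf ?g"
      using True sg by (intro integral_count_space_nat) (auto simp: integrable_count_space_nat_iff)
    also have "\<dots> = suminf ?h"
    proof -
      have "(\<lambda>r. ?h r + (pmf \<delta> r - pmf q r)) sums (suminf ?h + 0)"
        using d True by (intro sums_add) auto
      then show ?thesis unfolding gh by (simp add: sums_iff)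
    qed
    finally have "relative_entropy (measure_pmf \<delta>) (measure_pmf q) = ereal (suminf ?h)"
      using ac i by (simp add: relative_entropy_def ed)
    then have "relative_entropy (measure_pmf \<delta>) (measure_pmf q) \<le> ereal a \<longleftrightarrow> suminf ?h \<le> a" by simp
    also have "\<dots> \<longleftrightarrow> (\<forall>K. (\<Sum>r<K. ?h r) \<le> a)"
      using True h0 suminf_le_const[OF True, of a] sum_le_suminf[OF True]
      by (metis finite_lessThan order_trans)
    finally show ?thesis .
  next
    case False
    then have "relative_entropy (measure_pmf \<delta>) (measure_pmf q) = \<infinity>"
      using sg int_iff ed by (simp add: relative_entropy_def)
    moreover have "\<not> (\<forall>K. (\<Sum>r<K. ?h r) \<le> a)"
    proof
      assume "\<forall>K. (\<Sum>r<K. ?h r) \<le> a"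
      then have "summable ?h" using h0 by (intro summableI_nonneg_bounded[of _ a]) auto
      with False show False ..
    qed
    ultimately show ?thesis by simp
  qed
qed

section \<open>The weak topology and the l1 metric\<close>

definition pmf_dist :: "nat pmf \<Rightarrow> nat pmf \<Rightarrow> real" where
  "pmf_dist \<mu> \<nu> = (\<Sum>r. \<bar>pmf \<mu> r - pmf \<nu> r\<bar>)"

lemma summable_pmf_nat: "summable (pmf \<mu>)" for \<mu> :: "nat pmf"
  using sums_pmf_nat by (auto simp: sums_iff)

lemma summable_pmf_dist: "summable (\<lambda>r. \<bar>pmf \<mu> r - pmf \<nu> r\<bar>)" for \<mu> \<nu> :: "nat pmf"
proof (rule summable_comparison_test)
  show "summable (\<lambda>r. pmf \<mu> r + pmf \<nu> r)"
    by (intro summable_add summable_pmf_nat)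
qed (auto intro!: exI[of _ 0] abs_leI simp: add_increasing add_increasing2)

lemma Metric_space_pmf_dist: "Metric_space UNIV pmf_dist"
proof
  fix \<mu> \<nu> \<xi> :: "nat pmf"
  show "0 \<le> pmf_dist \<mu> \<nu>"
    unfolding pmf_dist_def by (intro suminf_nonneg summable_pmf_dist) auto
  show "pmf_dist \<mu> \<nu> = pmf_dist \<nu> \<mu>"
    unfolding pmf_dist_def by (simp add: abs_minus_commute)
  show "pmf_dist \<mu> \<nu> = 0 \<longleftrightarrow> \<mu> = \<nu>"
  proof
    assume "pmf_dist \<mu> \<nu> = 0"
    then have "\<forall>r. \<bar>pmf \<mu> r - pmf \<nu> r\<bar> = 0"
      unfolding pmf_dist_def by (subst (asm) suminf_eq_zero_iff[OF summable_pmf_dist]) auto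
    then show "\<mu> = \<nu>" by (intro pmf_eqI) auto
  qed (simp add: pmf_dist_def)
  have "pmf_dist \<mu> \<xi> \<le> (\<Sum>r. \<bar>pmf \<mu> r - pmf \<nu> r\<bar> + \<bar>pmf \<nu> r - pmf \<xi> r\<bar>)"
    unfolding pmf_dist_def
    by (intro suminf_le summable_add summable_pmf_dist) auto
  also have "\<dots> = pmf_dist \<mu> \<nu> + pmf_dist \<nu> \<xi>"
    unfolding pmf_dist_def by (intro suminf_add[symmetric] summable_pmf_dist)
  finally show "pmf_dist \<mu> \<xi> \<le> pmf_dist \<mu> \<nu> + pmf_dist \<nu> \<xi>" .
qed

interpretation pmf_l1: Metric_space UNIV pmf_dist
  by (rule Metric_space_pmf_dist)

text \<open>Scheffe's argument: the tail of \<open>\<nu>\<close> beyond \<open>K\<close> exceeds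
  that of \<open>\<mu>\<close> by at most the discrepancy on the head, so closeness on a finite head
  together with a small tail of \<open>\<mu>\<close> alone gives l1 closeness.\<close>

lemma pmf_dist_le:
  "pmf_dist \<mu> \<nu> \<le> 2 * (\<Sum>r<K. \<bar>pmf \<mu> r - pmf \<nu> r\<bar>) + 2 - 2 * (\<Sum>r<K. pmf \<mu> r)"
proof -
  have "pmf_dist \<mu> \<nu> = (\<Sum>r. \<bar>pmf \<mu> (r + K) - pmf \<nu> (r + K)\<bar>) + (\<Sum>r<K. \<bar>pmf \<mu> r - pmf \<nu> r\<bar>)"
    unfolding pmf_dist_def by (rule suminf_split_initial_segment[OF summable_pmf_dist])
  moreover have "(\<Sum>r. \<bar>pmf \<mu> (r + K) - pmf \<nu> (r + K)\<bar>) \<le> (\<Sum>r. pmf \<mu> (r + K) + pmf \<nu> (r + K))"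
    using summable_pmf_dist[of \<mu> \<nu>] summable_pmf_nat[of \<mu>] summable_pmf_nat[of \<nu>]
    by (intro suminf_le summable_add)
       (auto simp: summable_iff_shift[where f = "pmf \<mu>"] summable_iff_shift[where f = "pmf \<nu>"]
         summable_iff_shift[where f = "\<lambda>r. \<bar>pmf \<mu> r - pmf \<nu> r\<bar>"] abs_leI add_increasing add_increasing2)
  moreover have "(\<Sum>r. pmf \<mu> (r + K) + pmf \<nu> (r + K)) = (1 - (\<Sum>r<K. pmf \<mu> r)) + (1 - (\<Sum>r<K. pmf \<nu> r))"
  proof (rule sums_unique[symmetric], rule sums_add)
    show "(\<lambda>r. pmf \<mu> (r + K)) sums (1 - (\<Sum>r<K. pmf \<mu> r))"
      using sums_pmf_nat[of \<mu>] by (subst sums_iff_shift) auto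
    show "(\<lambda>r. pmf \<nu> (r + K)) sums (1 - (\<Sum>r<K. pmf \<nu> r))"
      using sums_pmf_nat[of \<nu>] by (subst sums_iff_shift) auto
  qed
  moreover have "(\<Sum>r<K. pmf \<mu> r) - (\<Sum>r<K. pmf \<nu> r) \<le> (\<Sum>r<K. \<bar>pmf \<mu> r - pmf \<nu> r\<bar>)"
    unfolding sum_subtractf[symmetric] by (intro sum_mono) auto
  ultimately show ?thesis by linarith
qed

lemma expectation_pmf_diff_le:
  fixes f :: "nat \<Rightarrow> real"
  assumes "\<And>r. \<bar>f r\<bar> \<le> B"
  shows "\<bar>measure_pmf.expectation \<mu> f - measure_pmf.expectation \<nu> f\<bar> \<le> B * pmf_dist \<mu> \<nu>"
proof -
  have *: "(\<lambda>r. pmf \<mu> r * f r) sums measure_pmf.expectation \<mu> f" for \<mu> :: "nat pmf"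
  proof -
    have "integrable (measure_pmf \<mu>) f"
      using assms by (intro measure_pmf.integrable_const_bound[of _ B]) auto
    then have "integrable (count_space UNIV) (\<lambda>r. pmf \<mu> r * f r)"
      by (subst (asm) measure_pmf_eq_density, subst (asm) integrable_density) auto
    moreover have "measure_pmf.expectation \<mu> f = (\<integral>r. pmf \<mu> r * f r \<partial>count_space UNIV)"
      by (subst measure_pmf_eq_density, subst integral_density) auto
    ultimately show ?thesis using sums_integral_count_space_nat by metis
  qed
  have d: "(\<lambda>r. (pmf \<mu> r - pmf \<nu> r) * f r) sums
      (measure_pmf.expectation \<mu> f - measure_pmf.expectation \<nu> f)"
    using sums_diff[OF *[of \<mu>] *[of \<nu>]] by (simp add: algebra_simps)
  have s: "summable (\<lambda>r. B * \<bar>pmf \<mu> r - pmf \<nu> r\<bar>)"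
    by (intro summable_mult summable_pmf_dist)
  have le: "\<bar>(pmf \<mu> r - pmf \<nu> r) * f r\<bar> \<le> B * \<bar>pmf \<mu> r - pmf \<nu> r\<bar>" for r
    unfolding abs_mult using mult_right_mono[OF assms[of r], of "\<bar>pmf \<mu> r - pmf \<nu> r\<bar>"]
    by (simp add: mult.commute)
  then have sa: "summable (\<lambda>r. \<bar>(pmf \<mu> r - pmf \<nu> r) * f r\<bar>)"
    by (intro summable_comparison_test[OF _ s] exI[of _ 0]) auto
  have "\<bar>measure_pmf.expectation \<mu> f - measure_pmf.expectation \<nu> f\<bar> = \<bar>\<Sum>r. (pmf \<mu> r - pmf \<nu> r) * f r\<bar>"
    using d by (simp add: sums_iff)
  also have "\<dots> \<le> (\<Sum>r. \<bar>(pmf \<mu> r - pmf \<nu> r) * f r\<bar>)" by (rule summable_rabs[OF sa])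
  also have "\<dots> \<le> (\<Sum>r. B * \<bar>pmf \<mu> r - pmf \<nu> r\<bar>)" by (intro suminf_le le sa s)
  also have "\<dots> = B * pmf_dist \<mu> \<nu>"
    unfolding pmf_dist_def by (intro suminf_mult summable_pmf_dist)
  finally show ?thesis .
qed

lemma openin_weak_topology_imp_l1:
  assumes "openin weak_topology U" "\<mu> \<in> U"
  shows "\<exists>e>0. \<forall>\<nu>. pmf_dist \<mu> \<nu> < e \<longrightarrow> \<nu> \<in> U"
  using assms unfolding weak_topology_def openin_topology_generated_by_iff
proof (induction arbitrary: \<mu> rule: generate_topology_on.induct)
  case (Int a b)
  then obtain e1 e2 where "e1 > 0" "\<forall>\<nu>. pmf_dist \<mu> \<nu> < e1 \<longrightarrow> \<nu> \<in> a"
    "e2 > 0" "\<forall>\<nu>. pmf_dist \<mu> \<nu> < e2 \<longrightarrow> \<nu> \<in> b" by blast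
  then show ?case by (intro exI[of _ "min e1 e2"]) auto
next
  case (UN K)
  then obtain k where k: "k \<in> K" "\<mu> \<in> k" by auto
  then obtain e where "e > 0" "\<forall>\<nu>. pmf_dist \<mu> \<nu> < e \<longrightarrow> \<nu> \<in> k" using UN.IH by blast
  with k show ?case by (intro exI[of _ e]) auto
next
  case (Basis s)
  then obtain f :: "nat \<Rightarrow> real" and V where s: "s = {\<delta>. measure_pmf.expectation \<delta> f \<in> V}"
    "bounded (range f)" "open V" by blast
  from s obtain B where B: "\<And>r. \<bar>f r\<bar> \<le> B" by (auto simp: bounded_iff)
  from Basis s obtain e where e: "e > 0"
    "\<And>y. dist y (measure_pmf.expectation \<mu> f) < e \<Longrightarrow> y \<in> V" by (auto simp: open_dist)
  \<comment> \<open>A strictly positive bound, by which \<open>e\<close> can be divided.\<close>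
  have B1: "\<And>r. \<bar>f r\<bar> \<le> \<bar>B\<bar> + 1"
    by (rule order_trans[OF B]) simp
  show ?case
  proof (intro exI[of _ "e / (\<bar>B\<bar> + 1)"] conjI allI impI)
    fix \<nu> assume \<nu>: "pmf_dist \<mu> \<nu> < e / (\<bar>B\<bar> + 1)"
    have "\<bar>measure_pmf.expectation \<mu> f - measure_pmf.expectation \<nu> f\<bar> \<le> (\<bar>B\<bar> + 1) * pmf_dist \<mu> \<nu>"
      by (rule expectation_pmf_diff_le) (rule B1)
    also have "\<dots> < e" using \<nu> by (simp add: field_simps)
    finally have "measure_pmf.expectation \<nu> f \<in> V"
      by (intro e) (simp add: dist_real_def abs_minus_commute)
    then show "\<nu> \<in> s" by (simp add: s)
  qed (use e in auto)
qed auto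

lemma topspace_weak_topology [simp]: "topspace weak_topology = UNIV"
proof -
  have "openin weak_topology UNIV"
    unfolding weak_topology_def
    by (intro topology_generated_by_Basis CollectI exI[of _ "\<lambda>_. 0"] exI[of _ UNIV]) auto
  then show ?thesis using openin_subset by blast
qed

text \<open>By \<open>pmf_dist_le\<close>, finitely many point masses already control the l1
  distance to a fixed \<open>\<mu>\<close>. Metrizability allows compactness to be checked with
  sequences.\<close>

lemma weak_topology_eq_mtopology: "weak_topology = pmf_l1.mtopology"
proof (subst topology_eq, intro allI iffI)
  fix U assume "openin weak_topology U"
  then show "openin pmf_l1.mtopology U"
    using openin_weak_topology_imp_l1
    by (auto simp: pmf_l1.openin_mtopology subset_iff)
next
  fix U assume U: "openin pmf_l1.mtopology U"
  show "openin weak_topology U"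
  proof (subst openin_subopen, intro ballI)
    fix \<mu> assume "\<mu> \<in> U"
    then obtain e where "e > 0" "pmf_l1.mball \<mu> e \<subseteq> U"
      using U unfolding pmf_l1.openin_mtopology by blast
    then have e: "e > 0" "\<And>\<nu>. pmf_dist \<mu> \<nu> < e \<Longrightarrow> \<nu> \<in> U" by auto
    have "(\<lambda>K. \<Sum>r<K. pmf \<mu> r) \<longlonglongrightarrow> 1" using sums_pmf_nat by (simp add: sums_def)
    then have "\<forall>\<^sub>F K in sequentially. (\<Sum>r<K. pmf \<mu> r) > 1 - e / 4"
      using e by (intro order_tendstoD) auto
    then obtain K where K: "(\<Sum>r<K. pmf \<mu> r) > 1 - e / 4"
      by (auto simp: eventually_sequentially)
    \<comment> \<open>The head then contributes less than \<open>2 * (e / 4)\<close> and the tail of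
      \<open>\<mu>\<close> less than \<open>2 * (e / 4)\<close>; \<open>real K + 1\<close> avoids
      division by 0.\<close>
    define \<eta> where "\<eta> = e / (4 * (real K + 1))"
    have \<eta>: "\<eta> > 0" using e by (simp add: \<eta>_def)
    let ?W = "\<lambda>r. {\<delta>. measure_pmf.expectation \<delta> (indicat_real {r}) \<in> ball (pmf \<mu> r) \<eta>}"
    \<comment> \<open>\<open>UNIV\<close> keeps the family nonempty when
      \<open>K = 0\<close>.\<close>
    let ?V = "\<Inter> (insert UNIV (?W ` {..<K}))"
    have open_W: "openin weak_topology (?W r)" for r
      unfolding weak_topology_def
    proof (intro topology_generated_by_Basis CollectI exI[of _ "indicat_real {r}"]
          exI[of _ "ball (pmf \<mu> r) \<eta>"] conjI)
      show "bounded (range (indicat_real {r}))"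
        by (rule boundedI[of _ 1]) (auto simp: indicator_def)
    qed auto
    show "\<exists>T. openin weak_topology T \<and> \<mu> \<in> T \<and> T \<subseteq> U"
    proof (intro exI[of _ ?V] conjI)
      show "openin weak_topology ?V"
      proof (rule openin_Inter)
        fix X assume "X \<in> insert UNIV (?W ` {..<K})"
        then show "openin weak_topology X"
          using open_W openin_topspace[of weak_topology] by auto
      qed auto
      show "\<mu> \<in> ?V" using \<eta> by (auto simp: pmf.rep_eq)
      show "?V \<subseteq> U"
      proof
        fix \<nu> assume "\<nu> \<in> ?V"
        then have "\<bar>pmf \<mu> r - pmf \<nu> r\<bar> \<le> \<eta>" if "r < K" for r
          using that by (auto simp: pmf.rep_eq dist_real_def less_imp_le)
        then have "(\<Sum>r<K. \<bar>pmf \<mu> r - pmf \<nu> r\<bar>) \<le> K * \<eta>"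
          using sum_bounded_above[of "{..<K}" "\<lambda>r. \<bar>pmf \<mu> r - pmf \<nu> r\<bar>" \<eta>] by simp
        also have "\<dots> < e / 4" using e by (simp add: \<eta>_def field_simps)
        finally show "\<nu> \<in> U" using pmf_dist_le[of \<mu> \<nu> K] K by (intro e) linarith
      qed
    qed
  qed
qed

section \<open>Compactness from bounded relative entropy\<close>

text \<open>Pointwise limits can only lose mass, which gives one inequality; the uniform tails
  prevent the loss. It is applied to total masses and to first moments.\<close>

lemma sums_limit_of_uniform_tails:
  fixes f :: "nat \<Rightarrow> nat \<Rightarrow> real"
  assumes nn: "\<And>n r. 0 \<le> f n r" and lim: "\<And>r. (\<lambda>n. f n r) \<longlonglongrightarrow> g r"
    and sums: "\<And>n. f n sums a n" and a: "a \<longlonglongrightarrow> b"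
    and tails: "\<And>e. e > 0 \<Longrightarrow> \<exists>R. \<forall>n. a n - e \<le> (\<Sum>r<R. f n r)"
  shows "g sums b"
proof -
  have g0: "0 \<le> g r" for r using lim by (rule LIMSEQ_le_const) (use nn in auto)
  have plim: "(\<lambda>n. \<Sum>r<R. f n r) \<longlonglongrightarrow> (\<Sum>r<R. g r)" for R by (intro tendsto_sum lim)
  have le: "(\<Sum>r<R. g r) \<le> b" for R
    using plim a by (rule LIMSEQ_le) (auto intro!: exI[of _ 0] sum_le_suminf simp: sums_unique[OF sums] sums_summable[OF sums] nn)
  then have sg: "summable g" using g0 by (intro summableI_nonneg_bounded[of _ b]) auto
  have "suminf g \<le> b" by (intro suminf_le_const sg le)
  moreover have "b \<le> suminf g + e" if e: "e > 0" for e
  proof -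
    obtain R where R: "\<And>n. a n - e \<le> (\<Sum>r<R. f n r)" using tails[OF e] by blast
    have "b - e \<le> (\<Sum>r<R. g r)"
      by (rule LIMSEQ_le[OF tendsto_diff[OF a tendsto_const] plim]) (use R in auto)
    also have "\<dots> \<le> suminf g" using g0 by (intro sum_le_suminf sg) auto
    finally show ?thesis by simp
  qed
  then have "b \<le> suminf g" by (rule field_le_epsilon)
  ultimately show ?thesis using sg by (simp add: sums_iff)
qed

text \<open>Cantor's diagonal argument in the compact unit interval. The limit \<open>l\<close> may
  have lost mass to infinity, so it is only a function here.\<close>

lemma pmf_pointwise_convergent_subsequence:
  fixes D :: "nat \<Rightarrow> nat pmf"
  obtains s l where "strict_mono (s :: nat \<Rightarrow> nat)" "\<And>r. (\<lambda>n. pmf (D (s n)) r) \<longlonglongrightarrow> l r"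
proof -
  interpret S: subseqs "\<lambda>r s. convergent (\<lambda>n. pmf (D (s n)) r)"
  proof
    fix r and s :: "nat \<Rightarrow> nat"
    have "seq_compact {0..1::real}" by (rule compact_imp_seq_compact[OF compact_Icc])
    then obtain l s' where "strict_mono s'" "((\<lambda>n. pmf (D (s n)) r) \<circ> s') \<longlonglongrightarrow> l"
      by (rule seq_compactE[where f = "\<lambda>n. pmf (D (s n)) r"]) (auto simp: pmf_le_1)
    then show "\<exists>r'. strict_mono r' \<and> convergent (\<lambda>n. pmf (D ((s \<circ> r') n)) r)"
      by (auto simp: convergent_def o_def)
  qed
  have "convergent (\<lambda>n. pmf (D (S.diagseq n)) r)" for r
  proof -
    have "convergent (\<lambda>n. pmf (D ((S.diagseq \<circ> (+) (Suc r)) n)) r)"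
    proof (rule S.diagseq_holds)
      fix s s' :: "nat \<Rightarrow> nat" and k
      assume "strict_mono s" "convergent (\<lambda>n. pmf (D (s' n)) k)"
      then show "convergent (\<lambda>n. pmf (D ((s' \<circ> s) n)) k)"
        using convergent_subseq_convergent[of "\<lambda>n. pmf (D (s' n)) k" s] by (simp add: o_def)
    qed
    then have "convergent (\<lambda>n. pmf (D (S.diagseq (n + Suc r))) r)" by (simp add: o_def add.commute)
    then show ?thesis using convergent_ignore_initial_segment[of "\<lambda>n. pmf (D (S.diagseq n)) r" "Suc r"] by simp
  qed
  then have "(\<lambda>n. pmf (D (S.diagseq n)) r) \<longlonglongrightarrow> lim (\<lambda>n. pmf (D (S.diagseq n)) r)" for r
    by (simp add: convergent_LIMSEQ_iff)
  with S.subseq_diagseq show ?thesis by (rule that)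
qed

lemma pmf_of_sums:
  fixes l :: "nat \<Rightarrow> real"
  assumes "\<And>r. 0 \<le> l r" "l sums 1"
  obtains \<delta> where "\<And>r. pmf \<delta> r = l r"
proof
  fix r show "pmf (embed_pmf l) r = l r"
  proof (rule pmf_embed_pmf)
    have "(\<integral>\<^sup>+ r. ennreal (l r) \<partial>count_space UNIV) = (\<Sum>r. ennreal (l r))"
      by (rule nn_integral_count_space_nat)
    also have "\<dots> = ennreal (suminf l)" using assms by (intro suminf_ennreal2) (auto simp: sums_iff)
    finally show "(\<integral>\<^sup>+ r. ennreal (l r) \<partial>count_space UNIV) = 1" using assms by (simp add: sums_iff)
  qed (rule assms)
qed

text \<open>Young's inequality against all exponential moments of the Poisson distribution makes
  the first moments uniformly integrable.\<close>

lemma entropy_mean_tail: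
  fixes D :: "nat \<Rightarrow> nat pmf"
  assumes c: "\<And>n. 0 < c n" "\<And>n. c n \<le> C" and e: "e > 0"
    and bound: "\<And>n K. (\<Sum>r<K. entropy_term (pmf (D n) r) (pmf (poisson_pmf (c n)) r)) \<le> a"
  shows "\<exists>R. \<forall>n K. (\<Sum>r=R..<K. real r * pmf (D n) r) \<le> e"
proof -
  have C: "C > 0" using c[of 0] by linarith
  have a: "0 \<le> a" using bound[of 0 0] by simp
  \<comment> \<open>Young's inequality bounds \<open>\<theta>\<close> times the tail by
    \<open>a\<close> plus an exponential tail of at most \<open>\<theta> * e / 2\<close>; this is at
    most \<open>\<theta> * e\<close> since \<open>\<theta> * e / 2 = a + 1\<close>. The summand 1
    keeps \<open>\<theta>\<close> positive when \<open>a = 0\<close>.\<close>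
  define \<theta> where "\<theta> = 2 * (a + 1) / e"
  have \<theta>: "\<theta> > 0" using a e by (simp add: \<theta>_def)
  have sm: "summable (\<lambda>r. (C * exp \<theta>) ^ r / fact r)" using summable_exp[of "C * exp \<theta>"] by (simp add: field_simps)
  have "\<exists>R. \<forall>m\<ge>R. \<forall>n. norm (\<Sum>r=m..<n. (C * exp \<theta>) ^ r / fact r) < \<theta> * e / 2"
    using sm \<theta> e unfolding summable_Cauchy by (meson half_gt_zero mult_pos_pos)
  then obtain R where R: "\<And>n. (\<Sum>r=R..<n. (C * exp \<theta>) ^ r / fact r) < \<theta> * e / 2"
    by (metis abs_ge_self dual_order.refl le_less_trans real_norm_def)
  show ?thesis
  proof (intro exI allI)
    fix n K
    let ?q = "pmf (poisson_pmf (c n))" and ?x = "pmf (D n)"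
    have q: "?q r > 0" for r using c[of n] by (simp add: pmf_poisson)
    \<comment> \<open>A bound free of \<open>n\<close>, so that one \<open>R\<close> serves all
      \<open>n\<close>.\<close>
    have qC: "?q r * exp (\<theta> * r) \<le> (C * exp \<theta>) ^ r / fact r" for r
    proof -
      have "?q r * exp (\<theta> * r) = c n ^ r * exp (- c n) * exp \<theta> ^ r / fact r"
        using c[of n] by (simp add: exp_of_nat2_mult)
      also have "\<dots> \<le> C ^ r * 1 * exp \<theta> ^ r / fact r"
        using c[of n] C by (intro divide_right_mono mult_right_mono mult_mono power_mono) auto
      finally show ?thesis by (simp add: power_mult_distrib)
    qed
    have "\<theta> * (\<Sum>r=R..<K. real r * ?x r) = (\<Sum>r=R..<K. ?x r * (\<theta> * r))"
      by (simp add: sum_distrib_left mult_ac)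
    also have "\<dots> \<le> (\<Sum>r=R..<K. entropy_term (?x r) (?q r) + ?q r * (exp (\<theta> * r) - 1))"
      by (intro sum_mono entropy_term_young q) auto
    also have "\<dots> \<le> (\<Sum>r=R..<K. entropy_term (?x r) (?q r) + (C * exp \<theta>) ^ r / fact r)"
    proof (intro sum_mono add_left_mono)
      fix r show "?q r * (exp (\<theta> * r) - 1) \<le> (C * exp \<theta>) ^ r / fact r"
        using qC[of r] q[of r] unfolding right_diff_distrib by linarith
    qed
    also have "\<dots> = (\<Sum>r=R..<K. entropy_term (?x r) (?q r)) + (\<Sum>r=R..<K. (C * exp \<theta>) ^ r / fact r)"
      by (rule sum.distrib)
    also have "(\<Sum>r=R..<K. entropy_term (?x r) (?q r)) \<le> (\<Sum>r<K. entropy_term (?x r) (?q r))"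
      by (intro sum_mono2) (auto intro: entropy_term_nonneg q)
    also have "\<dots> \<le> a" by (rule bound)
    also have "(\<Sum>r=R..<K. (C * exp \<theta>) ^ r / fact r) \<le> \<theta> * e / 2" using R[of K] by simp
    also have "a + \<theta> * e / 2 \<le> \<theta> * e" using e by (simp add: \<theta>_def)
    finally show "(\<Sum>r=R..<K. real r * ?x r) \<le> e" using \<theta> by simp
  qed
qed

text \<open>Constant \<open>c\<close> gives compact level sets of the rate function; moving
  \<open>c n\<close> is needed for degree distributions, whose mean only converges. Neither mass nor
  mean escapes by \<open>entropy_mean_tail\<close>, and the entropy bound survives because each
  partial sum is continuous.\<close>

lemma entropy_compactness:
  fixes D :: "nat \<Rightarrow> nat pmf"
  assumes c: "\<And>n. 0 < c n" "c \<longlonglongrightarrow> c0" "0 < c0"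
    and mean: "\<And>n. (\<lambda>r. real r * pmf (D n) r) sums c n"
    and bound: "\<And>n K. (\<Sum>r<K. entropy_term (pmf (D n) r) (pmf (poisson_pmf (c n)) r)) \<le> a"
  obtains s \<delta> where "strict_mono (s :: nat \<Rightarrow> nat)" "(\<lambda>n. pmf_dist \<delta> (D (s n))) \<longlonglongrightarrow> 0"
    "(\<lambda>r. real r * pmf \<delta> r) sums c0"
    "\<And>K. (\<Sum>r<K. entropy_term (pmf \<delta> r) (pmf (poisson_pmf c0) r)) \<le> a"
proof -
  obtain s l where s: "strict_mono (s :: nat \<Rightarrow> nat)" and l: "\<And>r. (\<lambda>n. pmf (D (s n)) r) \<longlonglongrightarrow> l r"
    using pmf_pointwise_convergent_subsequence by blast
  have cs: "(\<lambda>n. c (s n)) \<longlonglongrightarrow> c0"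
    using LIMSEQ_subseq_LIMSEQ[OF c(2) s] by (simp add: o_def)
  obtain C where C: "\<And>n. c n \<le> C"
    using convergent_imp_Bseq[OF convergentI[OF c(2)]] by (auto simp: Bseq_def abs_le_iff)
  have tail: "\<exists>R. \<forall>n. c (s n) - e \<le> (\<Sum>r<R. real r * pmf (D (s n)) r) \<and> 1 - e \<le> (\<Sum>r<R. pmf (D (s n)) r)"
    if e: "e > 0" for e
  proof -
    obtain R0 where R0: "\<And>n K. (\<Sum>r=R0..<K. real r * pmf (D n) r) \<le> e"
      using entropy_mean_tail[of c C e D a, OF c(1) C e bound] by blast
    \<comment> \<open>Beyond \<open>Suc R0\<close> every index is at least 1, so the tail of the
      mass is dominated by the tail of the mean.\<close>
    define R where "R = Suc R0"
    have R: "(\<Sum>r=R..<K. real r * pmf (D n) r) \<le> e" for n K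
      by (rule order_trans[OF sum_mono2 R0[of _ K]]) (auto simp: R_def)
    have R': "(\<Sum>r=R..<K. pmf (D n) r) \<le> e" for n K
    proof (rule order_trans[OF sum_mono R[of n K]])
      fix r assume "r \<in> {R..<K}"
      then have "1 \<le> real r" by (auto simp: R_def)
      then show "pmf (D n) r \<le> real r * pmf (D n) r"
        using mult_right_mono[of 1 "real r" "pmf (D n) r"] by simp
    qed
    have gen: "x - e \<le> (\<Sum>r<R. f r)" if "f sums x" "\<And>r. 0 \<le> f r" "\<And>K. (\<Sum>r=R..<K. f r) \<le> e"
      for f :: "nat \<Rightarrow> real" and x
    proof -
      have "x \<le> (\<Sum>r<R. f r) + e"
      proof (rule LIMSEQ_le_const2)
        show "(\<lambda>K. \<Sum>r<K. f r) \<longlonglongrightarrow> x" using that by (simp add: sums_def)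
        show "\<exists>N. \<forall>K\<ge>N. (\<Sum>r<K. f r) \<le> (\<Sum>r<R. f r) + e"
        proof (intro exI allI impI)
          fix K assume "K \<ge> R"
          then have "(\<Sum>r<K. f r) = (\<Sum>r<R. f r) + (\<Sum>r=R..<K. f r)"
            by (metis lessThan_atLeast0 sum.atLeastLessThan_concat zero_le)
          then show "(\<Sum>r<K. f r) \<le> (\<Sum>r<R. f r) + e" using that(3)[of K] by simp
        qed
      qed
      then show ?thesis by simp
    qed
    show ?thesis using gen[OF mean _ R] gen[OF sums_pmf_nat _ R'] by (intro exI[of _ R]) auto
  qed
  have tail1: "\<exists>R. \<forall>n. 1 - e \<le> (\<Sum>r<R. pmf (D (s n)) r)" if "e > 0" for e
    using tail[OF that] by blast
  have tail2: "\<exists>R. \<forall>n. c (s n) - e \<le> (\<Sum>r<R. real r * pmf (D (s n)) r)" if "e > 0" for e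
    using tail[OF that] by blast
  have l0: "0 \<le> l r" for r using l by (rule LIMSEQ_le_const) auto
  have "l sums 1"
    by (rule sums_limit_of_uniform_tails[where f = "\<lambda>n. pmf (D (s n))" and a = "\<lambda>_. 1"])
       (use l tail1 in \<open>auto intro: sums_pmf_nat\<close>)
  then obtain \<delta> where \<delta>: "\<And>r. pmf \<delta> r = l r" using pmf_of_sums l0 by metis
  show ?thesis
  proof
    show "strict_mono s" by fact
    show "(\<lambda>r. real r * pmf \<delta> r) sums c0" unfolding \<delta>
      by (rule sums_limit_of_uniform_tails[where f = "\<lambda>n r. real r * pmf (D (s n)) r" and a = "\<lambda>n. c (s n)"])
         (use l tail2 cs mean in \<open>auto intro: tendsto_mult_left\<close>)
    have q: "(\<lambda>n. pmf (poisson_pmf (c (s n))) r) \<longlonglongrightarrow> pmf (poisson_pmf c0) r" for r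
    proof -
      have "(\<lambda>n. c (s n) ^ r / fact r * exp (- c (s n))) \<longlonglongrightarrow> c0 ^ r / fact r * exp (- c0)"
        by (intro tendsto_intros cs) auto
      then show ?thesis using c less_imp_le[OF c(1)] by (simp add: less_imp_le)
    qed
    have qpos: "0 < pmf (poisson_pmf x) r" if "x > 0" for x r using that by simp
    show "(\<Sum>r<K. entropy_term (pmf \<delta> r) (pmf (poisson_pmf c0) r)) \<le> a" for K
    proof (rule LIMSEQ_le_const2)
      show "(\<lambda>n. \<Sum>r<K. entropy_term (pmf (D (s n)) r) (pmf (poisson_pmf (c (s n))) r))
         \<longlonglongrightarrow> (\<Sum>r<K. entropy_term (pmf \<delta> r) (pmf (poisson_pmf c0) r))"
        unfolding \<delta> by (intro tendsto_sum tendsto_entropy_term q l l0 qpos c pmf_nonneg)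
    qed (use bound in auto)
    show "(\<lambda>n. pmf_dist \<delta> (D (s n))) \<longlonglongrightarrow> 0"
    proof (rule LIMSEQ_I)
      fix e :: real assume e: "e > 0"
      have "(\<lambda>K. \<Sum>r<K. pmf \<delta> r) \<longlonglongrightarrow> 1" using sums_pmf_nat by (simp add: sums_def)
      then have "\<forall>\<^sub>F K in sequentially. (\<Sum>r<K. pmf \<delta> r) > 1 - e / 4"
        using e by (intro order_tendstoD) auto
      then obtain K where K: "(\<Sum>r<K. pmf \<delta> r) > 1 - e / 4"
        by (auto simp: eventually_sequentially)
      have "(\<lambda>n. \<Sum>r<K. \<bar>pmf \<delta> r - pmf (D (s n)) r\<bar>) \<longlonglongrightarrow> (\<Sum>r<K. \<bar>pmf \<delta> r - l r\<bar>)"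
        by (intro tendsto_intros l)
      then have "\<forall>\<^sub>F n in sequentially. (\<Sum>r<K. \<bar>pmf \<delta> r - pmf (D (s n)) r\<bar>) < e / 4"
        using e by (intro order_tendstoD) (auto simp: \<delta>)
      then obtain N where N: "\<And>n. n \<ge> N \<Longrightarrow> (\<Sum>r<K. \<bar>pmf \<delta> r - pmf (D (s n)) r\<bar>) < e / 4"
        by (auto simp: eventually_sequentially)
      have "norm (pmf_dist \<delta> (D (s n)) - 0) < e" if "n \<ge> N" for n
        using pmf_dist_le[of \<delta> "D (s n)" K] K N[OF that] pmf_l1.nonneg[of \<delta> "D (s n)"]
        unfolding real_norm_def by linarith
      then show "\<exists>N. \<forall>n\<ge>N. norm (pmf_dist \<delta> (D (s n)) - 0) < e" by blast
    qed
  qed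
qed

section \<open>Lists of node pairs\<close>

definition pair_lists :: "nat \<Rightarrow> nat \<Rightarrow> (nat \<times> nat) list set" where
  "pair_lists n m = {w. set w \<subseteq> {1..n} \<times> {1..n} \<and> length w = m}"

definition endpoints :: "(nat \<times> nat) list \<Rightarrow> nat list" where
  "endpoints w = concat (map (\<lambda>(u, v). [u, v]) w)"

definition simple_edges :: "(nat \<times> nat) list \<Rightarrow> nat set set" where
  "simple_edges w = {{u, v} |u v. (u, v) \<in> set w \<and> u \<noteq> v}"

definition degree_mset :: "nat \<Rightarrow> nat set set \<Rightarrow> nat multiset" where
  "degree_mset n E = image_mset (\<lambda>i. card {e \<in> E. i \<in> e}) (mset_set {1..n})"

definition occupancy_mset :: "nat \<Rightarrow> nat list \<Rightarrow> nat multiset" where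
  "occupancy_mset n xs = image_mset (count_list xs) (mset_set {1..n})"

lemma endpoints_simps [simp]:
  "endpoints [] = []" "endpoints ((u, v) # w) = u # v # endpoints w"
  by (simp_all add: endpoints_def)

lemma length_endpoints [simp]: "length (endpoints w) = 2 * length w"
  by (induction w) auto

lemma set_endpoints_subset: "set (endpoints w) \<subseteq> V \<longleftrightarrow> set w \<subseteq> V \<times> V"
  by (induction w) auto

lemma finite_pair_lists [simp]: "finite (pair_lists n m)"
  unfolding pair_lists_def by (rule finite_lists_length_eq) auto

lemma pair_lists_0 [simp]: "pair_lists n 0 = {[]}"
  by (auto simp: pair_lists_def)

lemma pair_lists_Suc: "pair_lists n (Suc k) = (\<lambda>(p, w). p # w) ` (({1..n} \<times> {1..n}) \<times> pair_lists n k)"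
  by (auto simp: pair_lists_def length_Suc_conv image_iff)

lemma sum_pair_lists_Suc:
  "(\<Sum>w\<in>pair_lists n (Suc k). f w) = (\<Sum>w\<in>pair_lists n k. \<Sum>p\<in>{1..n} \<times> {1..n}. f (p # w))"
proof -
  have "(\<Sum>w\<in>pair_lists n (Suc k). f w) = (\<Sum>(p, w)\<in>({1..n} \<times> {1..n}) \<times> pair_lists n k. f (p # w))"
    unfolding pair_lists_Suc by (subst sum.reindex) (auto intro: inj_onI simp: case_prod_unfold)
  also have "\<dots> = (\<Sum>p\<in>{1..n} \<times> {1..n}. \<Sum>w\<in>pair_lists n k. f (p # w))"
    by (rule sum.cartesian_product[symmetric])
  finally show ?thesis using sum.swap[of "\<lambda>p w. f (p # w)" "pair_lists n k" "{1..n} \<times> {1..n}"] by simp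
qed

lemma simple_edges_Nil [simp]: "simple_edges [] = {}"
  by (simp add: simple_edges_def)

lemma simple_edges_Cons:
  "simple_edges ((u, v) # w) = (if u = v then simple_edges w else insert {u, v} (simple_edges w))"
  by (auto simp: simple_edges_def)

lemma finite_simple_edges [simp]: "finite (simple_edges w)"
  by (induction w) (auto simp: simple_edges_Cons)

lemma card_simple_edges_le: "card (simple_edges w) \<le> length w"
  by (induction w) (auto simp: simple_edges_Cons card_insert_if)

lemma finite_node_pairs [simp]: "finite (node_pairs n)"
  by (rule finite_subset[of _ "Pow {1..n}"]) (auto simp: node_pairs_def)

lemma card_node_pairs: "card (node_pairs n) = n choose 2"
  unfolding node_pairs_def by (subst n_subsets) auto

lemma simple_edges_subset_node_pairs:
  "w \<in> pair_lists n m \<Longrightarrow> simple_edges w \<subseteq> node_pairs n"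
  by (auto simp: simple_edges_def node_pairs_def pair_lists_def)

section \<open>Counting ordered pairs and lists by their defects\<close>

lemma card_orientations_edge:
  assumes "card e = 2"
  shows "finite {(u, v). u \<noteq> v \<and> {u, v} = e}" "card {(u, v). u \<noteq> v \<and> {u, v} = e} = 2"
proof -
  obtain a b where ab: "e = {a, b}" "a \<noteq> b" using assms by (auto simp: card_2_iff)
  then have "{(u, v). u \<noteq> v \<and> {u, v} = e} = {(a, b), (b, a)}" by (auto simp: doubleton_eq_iff)
  then show "finite {(u, v). u \<noteq> v \<and> {u, v} = e}" "card {(u, v). u \<noteq> v \<and> {u, v} = e} = 2"
    using ab by auto
qed

lemma card_orientations:
  assumes "E \<subseteq> node_pairs n"
  shows "card {(u, v) \<in> {1..n} \<times> {1..n}. u \<noteq> v \<and> {u, v} \<in> E} = 2 * card E"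
proof -
  have fE: "finite E" using assms finite_node_pairs by (rule finite_subset)
  have c2: "card e = 2" if "e \<in> E" for e using that assms by (auto simp: node_pairs_def)
  have "{(u, v) \<in> {1..n} \<times> {1..n}. u \<noteq> v \<and> {u, v} \<in> E} = (\<Union>e\<in>E. {(u, v). u \<noteq> v \<and> {u, v} = e})"
    using assms by (auto simp: node_pairs_def)
  also have "card \<dots> = (\<Sum>e\<in>E. card {(u, v). u \<noteq> v \<and> {u, v} = e})"
    using c2 by (intro card_UN_disjoint fE ballI card_orientations_edge) auto
  also have "\<dots> = 2 * card E" using c2 by (simp add: card_orientations_edge)
  finally show ?thesis .
qed

text \<open>Loops and repetitions of pairs (in either orientation), the first occurrence not counted.\<close>

definition defects :: "(nat \<times> nat) list \<Rightarrow> nat" where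
  "defects w = length w - card (simple_edges w)"

text \<open>Lists grow at the head: \<open>w\<close> is the past and \<open>p\<close> the newly
  drawn pair.\<close>

definition defective :: "(nat \<times> nat) \<Rightarrow> (nat \<times> nat) list \<Rightarrow> bool" where
  "defective p w \<longleftrightarrow> fst p = snd p \<or> {fst p, snd p} \<in> simple_edges w"

lemma simple_edges_Cons_defective:
  "defective p w \<Longrightarrow> simple_edges (p # w) = simple_edges w"
  "\<not> defective p w \<Longrightarrow> simple_edges (p # w) = insert {fst p, snd p} (simple_edges w)"
  by (cases p; force simp: defective_def simple_edges_Cons)+

lemma card_insert_not_defective:
  "\<not> defective p w \<Longrightarrow> card (insert {fst p, snd p} (simple_edges w)) = Suc (card (simple_edges w))"
  "\<not> defective (u, v) w \<Longrightarrow> card (insert {u, v} (simple_edges w)) = Suc (card (simple_edges w))"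
  by (auto simp: defective_def)

lemma defects_Cons: "defects (p # w) = (if defective p w then Suc (defects w) else defects w)"
  using card_simple_edges_le[of w]
  by (auto simp: defects_def simple_edges_Cons_defective card_insert_not_defective)

lemma card_simple_edges_plus_defects: "card (simple_edges w) + defects w = length w"
  using card_simple_edges_le[of w] by (simp add: defects_def)

text \<open>The summands are the loops and the two orientations of each edge already drawn.\<close>

lemma card_defective:
  assumes "w \<in> pair_lists n k"
  shows "card {p \<in> {1..n} \<times> {1..n}. defective p w} = n + 2 * card (simple_edges w)"
proof -
  let ?O = "{(u, v) \<in> {1..n} \<times> {1..n}. u \<noteq> v \<and> {u, v} \<in> simple_edges w}"
  have "{p \<in> {1..n} \<times> {1..n}. defective p w} = (\<lambda>u. (u, u)) ` {1..n} \<union> ?O"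
    by (auto simp: defective_def)
  also have "card \<dots> = card ((\<lambda>u. (u, u)) ` {1..n}) + card ?O"
    by (intro card_Un_disjoint finite_subset[of ?O "{1..n} \<times> {1..n}"]) auto
  also have "card ((\<lambda>u. (u, u)) ` {1..n}) = n" by (simp add: card_image inj_on_def)
  also have "card ?O = 2 * card (simple_edges w)"
    using assms by (intro card_orientations simple_edges_subset_node_pairs)
  finally show ?thesis .
qed

text \<open>Whatever the past, at most \<open>n + 2 * m\<close> of the \<open>n ^ 2\<close> possible
  next pairs are defective, so the unnormalised generating function of the number of defects grows
  by at most the stated factor in each step.\<close>

lemma sum_defects_power_le:
  fixes x :: real
  assumes "0 \<le> x" "k \<le> m"
  shows "(\<Sum>w\<in>pair_lists n k. x ^ defects w) \<le> (real n ^ 2 + x * (n + 2 * m)) ^ k"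
  using assms(2)
proof (induction k)
  case 0 then show ?case by (simp add: defects_def)
next
  case (Suc k)
  let ?P = "{1..n} \<times> {1..n}"
  have inner: "(\<Sum>p\<in>?P. x ^ defects (p # w)) \<le> (real n ^ 2 + x * (n + 2 * m)) * x ^ defects w"
    if w: "w \<in> pair_lists n k" for w
  proof -
    have "(\<Sum>p\<in>?P. x ^ defects (p # w)) \<le> (\<Sum>p\<in>?P. x ^ defects w + (if defective p w then x * x ^ defects w else 0))"
      using assms by (intro sum_mono) (auto simp: defects_Cons)
    also have "\<dots> = (real n ^ 2 + x * card {p \<in> ?P. defective p w}) * x ^ defects w"
      by (simp add: sum.distrib sum.If_cases power2_eq_square algebra_simps Int_def)
    also have "\<dots> \<le> (real n ^ 2 + x * (n + 2 * m)) * x ^ defects w"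
    proof -
      have "length w = k" using w by (simp add: pair_lists_def)
      then have "card (simple_edges w) \<le> m" using card_simple_edges_le[of w] Suc.prems by simp
      then have "real (n + 2 * card (simple_edges w)) \<le> real (n + 2 * m)" by (simp only: of_nat_le_iff)
      then show ?thesis unfolding card_defective[OF w] using assms
        by (intro mult_right_mono add_left_mono mult_left_mono) auto
    qed
    finally show ?thesis .
  qed
  have "(\<Sum>w\<in>pair_lists n (Suc k). x ^ defects w) \<le> (\<Sum>w\<in>pair_lists n k. (real n ^ 2 + x * (n + 2 * m)) * x ^ defects w)"
    unfolding sum_pair_lists_Suc by (intro sum_mono inner)
  also have "\<dots> = (real n ^ 2 + x * (n + 2 * m)) * (\<Sum>w\<in>pair_lists n k. x ^ defects w)"
    by (simp add: sum_distrib_left)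
  also have "\<dots> \<le> (real n ^ 2 + x * (n + 2 * m)) * (real n ^ 2 + x * (n + 2 * m)) ^ k"
    using Suc assms by (intro mult_left_mono) auto
  finally show ?case by simp
qed

lemma card_extending_pairs:
  assumes "E \<subseteq> node_pairs n" "simple_edges w \<subseteq> E"
  shows "card {p \<in> {1..n} \<times> {1..n}. \<not> defective p w \<and> {fst p, snd p} \<in> E} =
    2 * (card E - card (simple_edges w))"
proof -
  have "{p \<in> {1..n} \<times> {1..n}. \<not> defective p w \<and> {fst p, snd p} \<in> E} =
      {(u, v) \<in> {1..n} \<times> {1..n}. u \<noteq> v \<and> {u, v} \<in> E - simple_edges w}"
    by (auto simp: defective_def)
  then show ?thesis using assms
    by (simp only: card_orientations[of "E - simple_edges w" n])
       (subst card_orientations, auto simp: card_Diff_subset)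
qed

text \<open>The weight \<open>2 ^ (m - g) * fact (m - g)\<close>, where \<open>g\<close> is the number of edges of \<open>E\<close> already in
  the list, is preserved on average by a step without defect: there are \<open>2 * (m - g)\<close> such steps.\<close>

lemma sum_defects_power_within_le:
  fixes z :: real
  assumes E: "E \<subseteq> node_pairs n" "card E = m" and z: "0 \<le> z" "k \<le> m"
  shows "(\<Sum>w | w \<in> pair_lists n k \<and> simple_edges w \<subseteq> E.
      2 ^ (m - card (simple_edges w)) * fact (m - card (simple_edges w)) * z ^ defects w)
    \<le> (1 + z * (n + 2 * m)) ^ k * (2 ^ m * fact m)"
proof -
  \<comment> \<open>Once a list has left \<open>E\<close>, so have all its extensions; the value 0
    makes the one-step inequality hold there too.\<close>
  define V where "V w = (if simple_edges w \<subseteq> E then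
      2 ^ (m - card (simple_edges w)) * fact (m - card (simple_edges w)) * z ^ defects w else 0)" for w
  have V0: "0 \<le> V w" for w using z by (simp add: V_def)
  have fE: "finite E" using E finite_node_pairs by (blast intro: finite_subset)
  let ?P = "{1..n} \<times> {1..n}"
  have inner: "(\<Sum>p\<in>?P. V (p # w)) \<le> (1 + z * (n + 2 * m)) * V w" if w: "w \<in> pair_lists n k" for w k
  proof (cases "simple_edges w \<subseteq> E")
    case False
    then have "V (p # w) = 0" for p
      by (cases "defective p w") (auto simp: V_def simple_edges_Cons_defective)
    then show ?thesis using V0 z by simp
  next
    case True
    let ?g = "card (simple_edges w)"
    have g: "?g \<le> m" using True E fE by (auto intro: card_mono)
    let ?A = "{p \<in> ?P. defective p w}" and ?B = "{p \<in> ?P. \<not> defective p w \<and> {fst p, snd p} \<in> E}"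
    let ?b = "2 ^ (m - Suc ?g) * fact (m - Suc ?g) * z ^ defects w"
    have cA: "card ?A = n + 2 * ?g" by (rule card_defective[OF w])
    have cB: "card ?B = 2 * (m - ?g)" using card_extending_pairs[OF E(1) True] E by simp
    have "(\<Sum>p\<in>?P. V (p # w)) = (\<Sum>p\<in>?P. (if p \<in> ?A then z * V w else 0) + (if p \<in> ?B then ?b else 0))"
    proof (rule sum.cong)
      fix p assume "p \<in> ?P"
      then show "V (p # w) = (if p \<in> ?A then z * V w else 0) + (if p \<in> ?B then ?b else 0)"
        using True by (cases "defective p w") (auto simp: V_def simple_edges_Cons_defective defects_Cons card_insert_not_defective)
    qed simp
    also have "\<dots> = card ?A * (z * V w) + card ?B * ?b"
      by (simp add: sum.distrib sum.If_cases Int_def)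
    also have "card ?A * (z * V w) \<le> real (n + 2 * m) * (z * V w)"
      using g z V0[of w] unfolding cA by (intro mult_right_mono) auto
    also have "card ?B * ?b \<le> V w"
    \<comment> \<open>At \<open>?g = m\<close> the truncated subtraction in \<open>?b\<close> gives
      no meaningful weight, but then \<open>?B\<close> is empty. Otherwise the
      \<open>2 * (m - ?g)\<close> choices restore exactly the factor by which the weight
      drops.\<close>
    proof (cases "?g = m")
      case True then show ?thesis using V0[of w] unfolding cB by simp
    next
      case False
      with g obtain j where j: "m - ?g = Suc j" "m - Suc ?g = j"
        by (metis Suc_diff_Suc le_neq_implies_less)
      show ?thesis unfolding cB V_def j using True by (simp add: algebra_simps)
    qed
    finally show ?thesis by (simp add: algebra_simps)
  qed
  have "(\<Sum>w\<in>pair_lists n k. V w) \<le> (1 + z * (n + 2 * m)) ^ k * (2 ^ m * fact m)"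
  proof (induction k)
    case 0 then show ?case by (simp add: V_def defects_def)
  next
    case (Suc k)
    have "(\<Sum>w\<in>pair_lists n (Suc k). V w) \<le> (\<Sum>w\<in>pair_lists n k. (1 + z * (n + 2 * m)) * V w)"
      unfolding sum_pair_lists_Suc by (intro sum_mono inner)
    also have "\<dots> = (1 + z * (n + 2 * m)) * (\<Sum>w\<in>pair_lists n k. V w)"
      by (simp add: sum_distrib_left)
    also have "\<dots> \<le> (1 + z * (n + 2 * m)) * ((1 + z * (n + 2 * m)) ^ k * (2 ^ m * fact m))"
      using Suc z by (intro mult_left_mono) auto
    finally show ?case by simp
  qed
  moreover have "(\<Sum>w\<in>pair_lists n k. V w) = (\<Sum>w | w \<in> pair_lists n k \<and> simple_edges w \<subseteq> E.
      2 ^ (m - card (simple_edges w)) * fact (m - card (simple_edges w)) * z ^ defects w)"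
    unfolding V_def by (subst sum.inter_filter[symmetric]) auto
  ultimately show ?thesis by simp
qed

lemma card_simple_lists:
  assumes E: "E \<subseteq> node_pairs n" "card E = m"
  shows "card {w \<in> pair_lists n m. simple_edges w = E} = 2 ^ m * fact m"
proof -
  have fE: "finite E" using E finite_node_pairs by (blast intro: finite_subset)
  let ?P = "{1..n} \<times> {1..n}"
  let ?S = "\<lambda>k. {w \<in> pair_lists n k. defects w = 0 \<and> simple_edges w \<subseteq> E}"
  have "card (?S k) * (2 ^ (m - k) * fact (m - k)) = 2 ^ m * fact m" if "k \<le> m" for k
    using that
  proof (induction k)
    case 0 then show ?case by (simp add: defects_def cong: conj_cong)
  next
    case (Suc k)
    have "card (?S (Suc k)) = (\<Sum>w\<in>pair_lists n (Suc k). if defects w = 0 \<and> simple_edges w \<subseteq> E then 1 else 0)"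
      by (simp add: sum.If_cases Int_def)
    also have "\<dots> = (\<Sum>w\<in>pair_lists n k. \<Sum>p\<in>?P. if defects (p # w) = 0 \<and> simple_edges (p # w) \<subseteq> E then 1 else 0)"
      by (rule sum_pair_lists_Suc)
    also have "\<dots> = (\<Sum>w\<in>pair_lists n k. if defects w = 0 \<and> simple_edges w \<subseteq> E then 2 * (m - k) else 0)"
    proof (rule sum.cong)
      fix w assume w: "w \<in> pair_lists n k"
      then have lw: "length w = k" by (simp add: pair_lists_def)
      show "(\<Sum>p\<in>?P. if defects (p # w) = 0 \<and> simple_edges (p # w) \<subseteq> E then 1 else 0) =
          (if defects w = 0 \<and> simple_edges w \<subseteq> E then 2 * (m - k) else 0)"
      proof (cases "defects w = 0 \<and> simple_edges w \<subseteq> E")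
        case True
        then have ck: "card (simple_edges w) = k" using card_simple_edges_plus_defects[of w] lw by simp
        have eq: "(defects (p # w) = 0 \<and> simple_edges (p # w) \<subseteq> E) \<longleftrightarrow>
            (\<not> defective p w \<and> {fst p, snd p} \<in> E)" for p
          using True by (auto simp: defects_Cons simple_edges_Cons_defective)
        have "(\<Sum>p\<in>?P. if defects (p # w) = 0 \<and> simple_edges (p # w) \<subseteq> E then 1 else 0) =
            card {p \<in> ?P. \<not> defective p w \<and> {fst p, snd p} \<in> E}"
          unfolding eq by (simp add: sum.If_cases Int_def)
        then show ?thesis using card_extending_pairs[OF E(1), of w] True ck E by simp
      next
        case False
        then have "\<not> (defects (p # w) = 0 \<and> simple_edges (p # w) \<subseteq> E)" for p
          by (cases "defective p w") (auto simp: defects_Cons simple_edges_Cons_defective)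
        then have "(\<Sum>p\<in>?P. if defects (p # w) = 0 \<and> simple_edges (p # w) \<subseteq> E then 1 else 0) = (0::nat)"
          by (intro sum.neutral) meson
        with False show ?thesis by (simp only: if_False)
      qed
    qed simp
    also have "\<dots> = card (?S k) * (2 * (m - k))" by (simp add: sum.If_cases Int_def)
    finally have "card (?S (Suc k)) * (2 ^ (m - Suc k) * fact (m - Suc k)) =
        card (?S k) * (2 * (m - k) * (2 ^ (m - Suc k) * fact (m - Suc k)))" by simp
    also have "2 * (m - k) * (2 ^ (m - Suc k) * fact (m - Suc k)) = 2 ^ (m - k) * (fact (m - k) :: nat)"
    proof -
      obtain j where j: "m - k = Suc j" "m - Suc k = j"
        using Suc.prems by (metis Suc_diff_Suc Suc_le_lessD)
      show ?thesis unfolding j by (simp add: algebra_simps)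
    qed
    finally show ?case using Suc by simp
  qed
  from this[of m] have "card (?S m) = 2 ^ m * fact m" by simp
  \<comment> \<open>Without defects, \<open>m\<close> pairs yield \<open>m\<close> different edges
    and therefore exhaust \<open>E\<close>.\<close>
  also have "?S m = {w \<in> pair_lists n m. simple_edges w = E}"
  proof (intro Collect_cong conj_cong refl iffI conjI)
    fix w assume w: "w \<in> pair_lists n m"
    then have l: "length w = m" by (simp add: pair_lists_def)
    { assume "defects w = 0 \<and> simple_edges w \<subseteq> E"
      then show "simple_edges w = E"
        using card_simple_edges_plus_defects[of w] l E fE by (intro card_subset_eq) auto }
    { assume "simple_edges w = E"
      then show "defects w = 0" "simple_edges w \<subseteq> E"
        using l E by (auto simp: defects_def) }
  qed
  finally show ?thesis .
qed

section \<open>Degrees and occupancy numbers\<close>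

lemma sum_card_incident:
  assumes "E \<subseteq> node_pairs n"
  shows "(\<Sum>i=1..n. card {e \<in> E. i \<in> e}) = 2 * card E"
proof -
  have fE: "finite E" using assms finite_node_pairs by (rule finite_subset)
  have "(\<Sum>i=1..n. card {e \<in> E. i \<in> e}) = (\<Sum>i=1..n. \<Sum>e\<in>E. if i \<in> e then 1 else 0)"
    using fE by (simp add: sum.If_cases Int_def)
  also have "\<dots> = (\<Sum>e\<in>E. \<Sum>i=1..n. if i \<in> e then 1 else 0)" by (rule sum.swap)
  also have "\<dots> = (\<Sum>e\<in>E. 2)"
  proof (rule sum.cong)
    fix e assume "e \<in> E"
    then have "e \<subseteq> {1..n}" "card e = 2" using assms by (auto simp: node_pairs_def)
    moreover from this have "{i. i \<in> {1..n} \<and> i \<in> e} = e" by auto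
    ultimately show "(\<Sum>i=1..n. if i \<in> e then 1 else 0) = (2::nat)"
      by (simp add: sum.If_cases Int_def)
  qed simp
  finally show ?thesis by simp
qed

lemma sum_count_endpoints:
  assumes "w \<in> pair_lists n m"
  shows "(\<Sum>i=1..n. count_list (endpoints w) i) = 2 * m"
proof -
  have "set (endpoints w) \<subseteq> {1..n}" "length w = m"
    using assms by (auto simp: pair_lists_def set_endpoints_subset)
  then show ?thesis by (simp add: sum_count_set)
qed

lemma card_incident_simple_edges_le:
  "card {e \<in> simple_edges w. i \<in> e} \<le> count_list (endpoints w) i"
proof (induction w)
  case (Cons p w)
  obtain u v where p: "p = (u, v)" by force
  show ?case
  proof (cases "u = v")
    case True with Cons p show ?thesis by (auto simp: simple_edges_Cons)
  next
    case False
    have "{e \<in> simple_edges (p # w). i \<in> e} \<subseteq>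
        (if i = u \<or> i = v then {{u, v}} else {}) \<union> {e \<in> simple_edges w. i \<in> e}"
      using False by (auto simp: p simple_edges_Cons)
    then have "card {e \<in> simple_edges (p # w). i \<in> e} \<le>
        card ((if i = u \<or> i = v then {{u, v}} else {}) \<union> {e \<in> simple_edges w. i \<in> e})"
      by (intro card_mono) auto
    also have "\<dots> \<le> card (if i = u \<or> i = v then {{u, v}} else {}) + card {e \<in> simple_edges w. i \<in> e}"
      by (rule card_Un_le)
    also have "\<dots> \<le> count_list (endpoints (p # w)) i"
      using Cons False by (auto simp: p)
    finally show ?thesis .
  qed
qed simp

text \<open>Degrees in \<open>E\<close> and occupancy numbers both dominate the degrees in
  \<open>simple_edges w\<close>, each with total surplus \<open>2 * defects w\<close>. A node where
  they differ uses at least one unit of surplus.\<close>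

lemma card_degree_mismatch_le:
  assumes w: "w \<in> pair_lists n m" and E: "E \<subseteq> node_pairs n" "card E = m" "simple_edges w \<subseteq> E"
  shows "card {i \<in> {1..n}. card {e \<in> E. i \<in> e} \<noteq> count_list (endpoints w) i} \<le> 4 * defects w"
proof -
  let ?a = "\<lambda>i. card {e \<in> simple_edges w. i \<in> e}"
  let ?b = "\<lambda>i. card {e \<in> E. i \<in> e}" and ?c = "\<lambda>i. count_list (endpoints w) i"
  have fE: "finite E" using E finite_node_pairs by (blast intro: finite_subset)
  have ab: "?a i \<le> ?b i" for i using E fE by (intro card_mono) auto
  have ac: "?a i \<le> ?c i" for i by (rule card_incident_simple_edges_le)
  have sa: "(\<Sum>i=1..n. ?a i) = 2 * card (simple_edges w)"
    by (intro sum_card_incident simple_edges_subset_node_pairs[OF w])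
  have sb: "(\<Sum>i=1..n. ?b i) = 2 * m" using sum_card_incident[OF E(1)] E by simp
  have sc: "(\<Sum>i=1..n. ?c i) = 2 * m" by (rule sum_count_endpoints[OF w])
  have lw: "length w = m" using w by (simp add: pair_lists_def)
  have "card {i \<in> {1..n}. ?b i \<noteq> ?c i} = (\<Sum>i=1..n. if ?b i \<noteq> ?c i then 1 else 0)"
    by (simp add: sum.If_cases Int_def)
  also have "\<dots> \<le> (\<Sum>i=1..n. (?b i - ?a i) + (?c i - ?a i))"
  proof (rule sum_mono)
    fix i show "(if ?b i \<noteq> ?c i then 1 else 0) \<le> (?b i - ?a i) + (?c i - ?a i)"
      using ab[of i] ac[of i] by (auto split: if_splits)
  qed
  also have "\<dots> = ((\<Sum>i=1..n. ?b i) - (\<Sum>i=1..n. ?a i)) + ((\<Sum>i=1..n. ?c i) - (\<Sum>i=1..n. ?a i))"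
    unfolding sum.distrib using ab ac by (subst (1 2) sum_subtractf_nat) auto
  also have "\<dots> = 4 * defects w" unfolding sa sb sc using lw by (simp add: defects_def)
  finally show ?thesis .
qed

lemma degree_mset_simple:
  assumes w: "w \<in> pair_lists n m" and "simple_edges w = E" "card E = m"
  shows "degree_mset n E = occupancy_mset n (endpoints w)"
proof -
  have E: "E \<subseteq> node_pairs n" using simple_edges_subset_node_pairs[OF w] assms by simp
  have "defects w = 0" using w assms by (simp add: defects_def pair_lists_def)
  then have "card {i \<in> {1..n}. card {e \<in> E. i \<in> e} \<noteq> count_list (endpoints w) i} = 0"
    using card_degree_mismatch_le[OF w E] assms by simp
  then have "{i \<in> {1..n}. card {e \<in> E. i \<in> e} \<noteq> count_list (endpoints w) i} = {}" by simp
  then show ?thesis unfolding degree_mset_def occupancy_mset_def by (intro image_mset_cong) auto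
qed

text \<open>The fibres of \<open>simple_edges\<close> over these graphs are disjoint and consist of
  defect-free lists, whose occupancy numbers are the degrees; lists with defects are the slack in
  the inequality.\<close>

lemma card_graphs_le_card_lists:
  "card {E. E \<subseteq> node_pairs n \<and> card E = m \<and> degree_mset n E \<in> U} * (2 ^ m * fact m)
    \<le> card {w \<in> pair_lists n m. occupancy_mset n (endpoints w) \<in> U}"
proof -
  let ?G = "{E. E \<subseteq> node_pairs n \<and> card E = m \<and> degree_mset n E \<in> U}"
  have fG: "finite ?G" by (rule finite_subset[of _ "Pow (node_pairs n)"]) auto
  have "card ?G * (2 ^ m * fact m) = (\<Sum>E\<in>?G. card {w \<in> pair_lists n m. simple_edges w = E})"
    by (simp add: card_simple_lists)
  also have "\<dots> = card (\<Union>E\<in>?G. {w \<in> pair_lists n m. simple_edges w = E})"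
    using fG by (intro card_UN_disjoint[symmetric]) auto
  also have "\<dots> \<le> card {w \<in> pair_lists n m. occupancy_mset n (endpoints w) \<in> U}"
  proof (rule card_mono)
    show "(\<Union>E\<in>?G. {w \<in> pair_lists n m. simple_edges w = E}) \<subseteq> {w \<in> pair_lists n m. occupancy_mset n (endpoints w) \<in> U}"
      using degree_mset_simple by fastforce
  qed auto
  finally show ?thesis .
qed

lemma size_occupancy_mset [simp]: "size (occupancy_mset n xs) = n"
  by (simp add: occupancy_mset_def)

lemma size_degree_mset [simp]: "size (degree_mset n E) = n"
  by (simp add: degree_mset_def)

lemma sum_occupancy_mset:
  "w \<in> pair_lists n m \<Longrightarrow> sum_mset (occupancy_mset n (endpoints w)) = 2 * m"
  using sum_count_endpoints by (simp add: occupancy_mset_def sum_unfold_sum_mset)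

section \<open>Multinomial counts of words with prescribed occupancy numbers\<close>

lemma bij_betw_endpoints:
  "bij_betw endpoints (pair_lists n m) {xs. set xs \<subseteq> {1..n} \<and> length xs = 2 * m}"
proof -
  have inj: "endpoints w = endpoints w' \<Longrightarrow> length w = length w' \<Longrightarrow> w = w'" for w w'
    by (induction w w' rule: list_induct2') auto
  have surj: "\<exists>w. xs = endpoints w" if "length xs = 2 * m" for xs m
    using that
  proof (induction m arbitrary: xs)
    case 0 then show ?case by (intro exI[of _ "[]"]) auto
  next
    case (Suc m)
    then obtain a b ys where "xs = a # b # ys" "length ys = 2 * m"
      by (auto simp: length_Suc_conv)
    moreover from Suc.IH[OF this(2)] obtain w where "ys = endpoints w" by blast
    ultimately show ?case by (intro exI[of _ "(a, b) # w"]) auto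
  qed
  show ?thesis unfolding bij_betw_def
  proof (intro conjI inj_onI set_eqI iffI)
    fix w w' assume "w \<in> pair_lists n m" "w' \<in> pair_lists n m" "endpoints w = endpoints w'"
    then show "w = w'" by (intro inj) (auto simp: pair_lists_def)
  next
    fix xs assume "xs \<in> endpoints ` pair_lists n m"
    then show "xs \<in> {xs. set xs \<subseteq> {1..n} \<and> length xs = 2 * m}"
      by (auto simp: pair_lists_def simp flip: set_endpoints_subset)
  next
    fix xs assume xs: "xs \<in> {xs. set xs \<subseteq> {1..n} \<and> length xs = 2 * m}"
    then obtain w where w: "xs = endpoints w" using surj by blast
    with xs have "w \<in> pair_lists n m" by (auto simp: pair_lists_def simp flip: set_endpoints_subset)
    with w show "xs \<in> endpoints ` pair_lists n m" by blast
  qed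
qed

text \<open>A multinomial coefficient, in product form to stay within the natural numbers.\<close>

lemma card_lists_given_counts:
  fixes n :: nat
  assumes "(\<Sum>i=1..n. d i) = N"
  shows "card {xs. set xs \<subseteq> {1..n} \<and> length xs = N \<and> (\<forall>i\<in>{1..n}. count_list xs i = d i)} *
    (\<Prod>i=1..n. fact (d i)) = fact N"
proof -
  define A where "A = (\<Sum>i\<in>{1..n}. replicate_mset (d i) i)"
  have cA: "count A i = (if i \<in> {1..n} then d i else 0)" for i
  proof -
    have "count A i = (\<Sum>j\<in>{1..n}. if j = i then d j else 0)"
      unfolding A_def count_sum by (intro sum.cong) auto
    then show ?thesis by (subst (asm) sum.delta) auto
  qed
  have sA: "set_mset A \<subseteq> {1..n}" by (metis cA count_eq_zero_iff subsetI)
  have szA: "size A = N"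
    unfolding size_multiset_overloaded_eq using assms sA cA
    by (subst sum.mono_neutral_left[of "{1..n}"]) (auto simp: not_in_iff)
  have "{xs. set xs \<subseteq> {1..n} \<and> length xs = N \<and> (\<forall>i\<in>{1..n}. count_list xs i = d i)} =
      permutations_of_multiset A"
  proof (intro set_eqI iffI)
    fix xs assume xs: "xs \<in> {xs. set xs \<subseteq> {1..n} \<and> length xs = N \<and> (\<forall>i\<in>{1..n}. count_list xs i = d i)}"
    have "mset xs = A"
    proof (rule multiset_eqI)
      fix i show "count (mset xs) i = count A i"
        using xs by (cases "i \<in> {1..n}") (auto simp: cA count_mset count_list_0_iff)
    qed
    then show "xs \<in> permutations_of_multiset A" by (rule permutations_of_multisetI)
  next
    fix xs assume "xs \<in> permutations_of_multiset A"
    then have "mset xs = A" by (rule permutations_of_multisetD)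
    then have "set xs = set_mset A" "length xs = size A" "\<And>i. count_list xs i = count A i"
      by (auto simp flip: count_mset)
    then show "xs \<in> {xs. set xs \<subseteq> {1..n} \<and> length xs = N \<and> (\<forall>i\<in>{1..n}. count_list xs i = d i)}"
      using sA szA by (auto simp: cA)
  qed
  moreover have "(\<Prod>i\<in>set_mset A. fact (count A i)) = (\<Prod>i=1..n. fact (d i) :: nat)"
    using sA cA by (subst prod.mono_neutral_left[of "{1..n}"]) (auto simp: not_in_iff)
  ultimately show ?thesis using card_permutations_of_multiset_aux[of A] szA by simp
qed

text \<open>A word of type \<open>M\<close> amounts to an arrangement of \<open>M\<close> along the
  nodes together with a word having these counts. Both stages are multinomial, which explains the
  two products.\<close>

lemma card_lists_given_occupancy:
  assumes M: "size M = n" "sum_mset M = N"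
  shows "card {xs. set xs \<subseteq> {1..n} \<and> length xs = N \<and> occupancy_mset n xs = M} *
    ((\<Prod>r\<in>set_mset M. fact (count M r)) * prod_mset (image_mset fact M)) = fact n * fact N"
proof -
  let ?X = "{xs. set xs \<subseteq> {1..n} \<and> length xs = N \<and> occupancy_mset n xs = M}"
  let ?L = "\<lambda>xs. map (count_list xs) [1..<Suc n]"
  have mL: "mset (?L xs) = occupancy_mset n xs" for xs
    by (simp add: occupancy_mset_def del: upt_Suc flip: atLeastLessThanSuc_atLeastAtMost)
  \<comment> \<open>Nodes are numbered from 1 and list positions from 0, hence
    \<open>i - 1\<close>.\<close>
  let ?F = "\<lambda>ds. {xs. set xs \<subseteq> {1..n} \<and> length xs = N \<and> (\<forall>i\<in>{1..n}. count_list xs i = ds ! (i - 1))}"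
  have eqF: "(?L xs = ds) \<longleftrightarrow> (\<forall>i\<in>{1..n}. count_list xs i = ds ! (i - 1))" if "length ds = n" for xs ds
  proof
    assume *: "\<forall>i\<in>{1..n}. count_list xs i = ds ! (i - 1)"
    show "?L xs = ds"
      by (rule nth_equalityI) (use that * in \<open>auto simp del: upt_Suc\<close>)
  qed (auto simp del: upt_Suc)
  have X: "?X = (\<Union>ds\<in>permutations_of_multiset M. ?F ds)"
  proof (intro set_eqI iffI)
    fix xs assume xs: "xs \<in> ?X"
    then have "?L xs \<in> permutations_of_multiset M" using mL[of xs] by (intro permutations_of_multisetI) simp
    moreover have "length (?L xs) = n" by (simp del: upt_Suc)
    then have "\<forall>i\<in>{1..n}. count_list xs i = ?L xs ! (i - 1)" using eqF[of "?L xs" xs] by blast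
    then have "xs \<in> ?F (?L xs)" using xs by blast
    ultimately show "xs \<in> (\<Union>ds\<in>permutations_of_multiset M. ?F ds)" by blast
  next
    fix xs assume "xs \<in> (\<Union>ds\<in>permutations_of_multiset M. ?F ds)"
    then obtain ds where ds: "ds \<in> permutations_of_multiset M" "xs \<in> ?F ds" by blast
    then have "length ds = n" using M length_finite_permutations_of_multiset by metis
    with ds have "?L xs = ds" using eqF[of ds xs] by blast
    then have "occupancy_mset n xs = M" using mL[of xs] permutations_of_multisetD[OF ds(1)] by simp
    with ds show "xs \<in> ?X" by auto
  qed
  have F: "card (?F ds) * prod_mset (image_mset fact M) = fact N" if ds: "ds \<in> permutations_of_multiset M" for ds
  proof -
    have l: "length ds = n" using M length_finite_permutations_of_multiset ds by metis
    have mds: "mset ds = M" using ds by (rule permutations_of_multisetD)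
    have im: "image_mset (\<lambda>i. ds ! (i - 1)) (mset_set {1..n}) = M"
    proof -
      have "map (\<lambda>i. ds ! (i - 1)) [1..<Suc n] = ds"
        by (rule nth_equalityI) (use l in \<open>auto simp del: upt_Suc\<close>)
      then have "mset (map (\<lambda>i. ds ! (i - 1)) [1..<Suc n]) = M" using mds by simp
      then show ?thesis by (simp del: upt_Suc flip: atLeastLessThanSuc_atLeastAtMost)
    qed
    have "(\<Sum>i=1..n. ds ! (i - 1)) = N"
      using M(2) unfolding im[symmetric] by (simp add: sum_unfold_sum_mset)
    from card_lists_given_counts[OF this]
    have "card (?F ds) * (\<Prod>i=1..n. fact (ds ! (i - 1))) = fact N" .
    moreover have "prod_mset (image_mset fact M) = (\<Prod>i=1..n. fact (ds ! (i - 1)) :: nat)"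
      unfolding im[symmetric] by (simp add: prod_unfold_prod_mset image_mset.compositionality o_def)
    ultimately show ?thesis by simp
  qed
  have fin: "finite (?F ds)" for ds
    by (rule finite_subset[OF _ finite_lists_length_eq[of "{1..n}" N]]) auto
  have "card ?X = (\<Sum>ds\<in>permutations_of_multiset M. card (?F ds))"
    unfolding X
  proof (rule card_UN_disjoint)
    show "\<forall>i\<in>permutations_of_multiset M. \<forall>j\<in>permutations_of_multiset M. i \<noteq> j \<longrightarrow> ?F i \<inter> ?F j = {}"
    proof (intro ballI impI)
      fix i j assume "i \<in> permutations_of_multiset M" "j \<in> permutations_of_multiset M" "i \<noteq> j"
      then have "length i = n" "length j = n"
        using M length_finite_permutations_of_multiset by metis+
      show "?F i \<inter> ?F j = {}"
      proof (rule equals0I)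
        fix xs assume "xs \<in> ?F i \<inter> ?F j"
        then have "?L xs = i" "?L xs = j"
          using eqF[OF \<open>length i = n\<close>, of xs] eqF[OF \<open>length j = n\<close>, of xs] by blast+
        with \<open>i \<noteq> j\<close> show False by simp
      qed
    qed
  qed (use fin in auto)
  then have "card ?X * prod_mset (image_mset fact M) = card (permutations_of_multiset M) * fact N"
    using F by (simp add: sum_distrib_right)
  then have "card ?X * ((\<Prod>r\<in>set_mset M. fact (count M r)) * prod_mset (image_mset fact M)) =
      (card (permutations_of_multiset M) * (\<Prod>r\<in>set_mset M. fact (count M r))) * fact N"
    by (simp add: mult_ac)
  then show ?thesis using card_permutations_of_multiset_aux[of M] M by simp
qed

lemma card_pair_lists_given_occupancy:
  assumes M: "size M = n" "sum_mset M = 2 * m"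
  shows "card {w \<in> pair_lists n m. occupancy_mset n (endpoints w) = M} *
    ((\<Prod>r\<in>set_mset M. fact (count M r)) * prod_mset (image_mset fact M)) = fact n * fact (2 * m)"
proof -
  have "bij_betw endpoints {w \<in> pair_lists n m. occupancy_mset n (endpoints w) = M}
      {xs \<in> {xs. set xs \<subseteq> {1..n} \<and> length xs = 2 * m}. occupancy_mset n xs = M}"
    using bij_betw_endpoints[of n m] by (auto simp: bij_betw_def inj_on_def)
  then have "card {w \<in> pair_lists n m. occupancy_mset n (endpoints w) = M} =
      card {xs \<in> {xs. set xs \<subseteq> {1..n} \<and> length xs = 2 * m}. occupancy_mset n xs = M}"
    by (rule bij_betw_same_card)
  then show ?thesis using card_lists_given_occupancy[OF M] by (simp add: conj_assoc)
qed

section \<open>Entropy estimates for occupancy numbers\<close>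

lemma mult_ln_Suc_le: "real k * ln (real (Suc k)) \<le> real k * ln (real k) + 1"
proof (cases "k = 0")
  case False
  have "ln (real (Suc k) / real k) \<le> real (Suc k) / real k - 1"
    using False by (intro ln_le_minus_one) auto
  moreover have "ln (real (Suc k) / real k) = ln (real (Suc k)) - ln (real k)"
    using False by (simp add: ln_div)
  moreover have "real (Suc k) / real k - 1 = 1 / real k" using False by (simp add: field_simps)
  ultimately have "ln (real (Suc k)) - ln (real k) \<le> 1 / real k" by simp
  then have "real k * (ln (real (Suc k)) - ln (real k)) \<le> real k * (1 / real k)"
    by (intro mult_left_mono) auto
  also have "\<dots> = 1" using False by simp
  finally show ?thesis by (simp only: right_diff_distrib)
qed simp

lemma ln_fact_ge: "real k * ln (real k) - real k \<le> ln (fact k)"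
proof (induction k)
  case (Suc k)
  have "ln (fact (Suc k)) = ln (real (Suc k)) + ln (fact k)" by (simp add: ln_mult)
  moreover have "real (Suc k) * ln (real (Suc k)) = real k * ln (real (Suc k)) + ln (real (Suc k))"
    by (simp add: algebra_simps)
  ultimately show ?case using Suc mult_ln_Suc_le[of k] by linarith
qed simp

lemma ln_fact_le: "ln (fact k) \<le> real (Suc k) * ln (real (Suc k)) - real k"
proof (induction k)
  case (Suc k)
  have "ln (real (Suc k) / real (Suc (Suc k))) \<le> real (Suc k) / real (Suc (Suc k)) - 1"
    by (intro ln_le_minus_one) auto
  also have "\<dots> = - 1 / real (Suc (Suc k))" by (simp add: field_simps)
  finally have "ln (real (Suc k)) - ln (real (Suc (Suc k))) \<le> - 1 / real (Suc (Suc k))"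
    by (simp add: ln_div)
  then have "real (Suc (Suc k)) * (ln (real (Suc k)) - ln (real (Suc (Suc k)))) \<le> - 1"
    by (simp add: field_simps)
  then have *: "real (Suc (Suc k)) * ln (real (Suc k)) + 1 \<le> real (Suc (Suc k)) * ln (real (Suc (Suc k)))"
    by (simp only: right_diff_distrib)
  have "ln (fact (Suc k)) = ln (real (Suc k)) + ln (fact k)" by (simp add: ln_mult)
  also have "\<dots> \<le> ln (real (Suc k)) + (real (Suc k) * ln (real (Suc k)) - real k)" using Suc by simp
  also have "\<dots> = real (Suc (Suc k)) * ln (real (Suc k)) - real k" by (simp add: algebra_simps)
  also have "\<dots> \<le> real (Suc (Suc k)) * ln (real (Suc (Suc k))) - real (Suc k)" using * by simp
  finally show ?case .
qed simp

lemma ln_fact_le': "ln (fact k) \<le> real k * ln (real k) - real k + 1 + ln (real k + 1)"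
proof -
  have "real (Suc k) * ln (real (Suc k)) = real k * ln (real (Suc k)) + ln (real k + 1)"
    by (simp add: algebra_simps)
  then show ?thesis using ln_fact_le[of k] mult_ln_Suc_le[of k] by linarith
qed

text \<open>The relative entropy of the empirical distribution of \<open>M\<close> with respect to the Poisson
  distribution with the same mean.\<close>

definition empirical_entropy :: "nat multiset \<Rightarrow> real" where
  "empirical_entropy M = (\<Sum>r\<in>set_mset M. (real (count M r) / real (size M)) *
     ln ((real (count M r) / real (size M)) / pmf (poisson_pmf (real (sum_mset M) / real (size M))) r))"

lemma sum_mset_conv_sum_count:
  "sum_mset (image_mset f M) = (\<Sum>r\<in>set_mset M. of_nat (count M r) * f r)"
  for f :: "'a \<Rightarrow> 'b :: comm_semiring_1"
proof -
  \<comment> \<open>A fixed index set \<open>A\<close> for the induction, along which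
    \<open>set_mset M\<close> grows.\<close>
  have "sum_mset (image_mset f M) = (\<Sum>r\<in>A. of_nat (count M r) * f r)"
    if "finite A" "set_mset M \<subseteq> A" for A
    using that(2)
  proof (induction M)
    case (add x M)
    have "(\<Sum>r\<in>A. of_nat (count (add_mset x M) r) * f r) =
        (\<Sum>r\<in>A. (if r = x then f r else 0) + of_nat (count M r) * f r)"
      by (intro sum.cong) (auto simp: algebra_simps)
    then show ?case using add \<open>finite A\<close> by (simp add: sum.distrib)
  qed simp
  then show ?thesis by blast
qed

lemma prod_mset_conv_prod_count:
  "prod_mset (image_mset f M) = (\<Prod>r\<in>set_mset M. f r ^ count M r)"
  for f :: "'a \<Rightarrow> 'b :: comm_semiring_1"
proof -
  have "prod_mset (image_mset f M) = (\<Prod>r\<in>A. f r ^ count M r)"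
    if "finite A" "set_mset M \<subseteq> A" for A
    using that(2)
  proof (induction M)
    case (add x M)
    have "(\<Prod>r\<in>A. f r ^ count (add_mset x M) r) =
        (\<Prod>r\<in>A. (if r = x then f r else 1) * f r ^ count M r)"
      by (intro prod.cong) auto
    then show ?case using add \<open>finite A\<close> by (simp add: prod.distrib)
  qed simp
  then show ?thesis by blast
qed

lemma sum_mset_eq_sum_count: "real (sum_mset M) = (\<Sum>r\<in>set_mset M. real r * real (count M r))"
proof -
  have "sum_mset M = (\<Sum>r\<in>set_mset M. count M r * r)"
    using sum_mset_conv_sum_count[of "\<lambda>x. x" M] by simp
  then show ?thesis by (simp add: mult.commute del: sum_mset.neutral_const of_nat_sum_mset)
qed

text \<open>The logarithm of the Poisson mass is linear in \<open>r\<close> apart from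
  \<open>ln (fact r)\<close>, so the two constraints on \<open>M\<close> collapse those terms. What
  is left, up to sign and the summand \<open>N * ln n\<close>, is the leading Stirling expansion of
  \<open>ln_card_occupancy\<close>.\<close>

lemma empirical_entropy_altdef:
  assumes M: "size M = n" "sum_mset M = N" "0 < N"
  shows "real n * empirical_entropy M =
    (\<Sum>r\<in>set_mset M. real (count M r) * ln (real (count M r))) - n * ln n
    + (\<Sum>r\<in>set_mset M. real (count M r) * ln (fact r)) + N - N * (ln N - ln n)"
proof -
  have n: "n > 0" using M by (cases "n = 0") auto
  let ?f = "\<lambda>r. real (count M r)"
  have sf: "(\<Sum>r\<in>set_mset M. ?f r) = n"
    using M(1) by (simp add: size_multiset_overloaded_eq flip: of_nat_sum)
  have sr: "(\<Sum>r\<in>set_mset M. ?f r * real r) = N" using sum_mset_eq_sum_count[of M] M by (simp add: mult.commute)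
  have t: "real n * (?f r / n * ln ((?f r / n) / pmf (poisson_pmf (N / n)) r)) =
      ?f r * ln (?f r) - ?f r * ln n + ?f r * ln (fact r) + ?f r * (N / n) - (?f r * real r) * ln (N / n)"
    if "r \<in> set_mset M" for r
  proof -
    have f: "?f r > 0" using that by simp
    have Nn: "real N / n > 0" using n M by simp
    have ln_quot: "ln (a / b / (p / q * e)) = ln a - ln b - (ln p - ln q + ln e)"
      if "0 < a" "0 < b" "0 < p" "0 < q" "0 < e" for a b p q e :: real
      using that by (simp add: ln_mult ln_div)
    have "ln ((?f r / n) / pmf (poisson_pmf (N / n)) r) = ln (?f r / n / ((N / n) ^ r / fact r * exp (- (N / n))))"
      using Nn by simp
    also have "\<dots> = ln (?f r) - ln n - (ln ((N / n) ^ r) - ln (fact r) + ln (exp (- (N / n))))"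
      using f n zero_less_power[OF Nn] by (intro ln_quot) auto
    also have "\<dots> = ln (?f r) - ln n - (real r * ln (N / n) - ln (fact r) - N / n)"
      using Nn by (simp only: ln_realpow ln_exp)
    finally have e: "ln ((?f r / n) / pmf (poisson_pmf (N / n)) r) =
        ln (?f r) - ln n - (real r * ln (N / n) - ln (fact r) - N / n)" .
    show ?thesis unfolding e using n by (simp add: algebra_simps)
  qed
  have "real n * empirical_entropy M = (\<Sum>r\<in>set_mset M. ?f r * ln (?f r) - ?f r * ln n + ?f r * ln (fact r)
      + ?f r * (N / n) - (?f r * real r) * ln (N / n))"
    unfolding empirical_entropy_def sum_distrib_left using M t by (intro sum.cong) simp_all
  also have "\<dots> = (\<Sum>r\<in>set_mset M. ?f r * ln (?f r)) - (\<Sum>r\<in>set_mset M. ?f r) * ln n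
     + (\<Sum>r\<in>set_mset M. ?f r * ln (fact r)) + (\<Sum>r\<in>set_mset M. ?f r) * (N / n)
     - (\<Sum>r\<in>set_mset M. ?f r * real r) * ln (N / n)"
    by (simp add: sum.distrib sum_subtractf sum_distrib_right sum_divide_distrib)
  also have "\<dots> = (\<Sum>r\<in>set_mset M. ?f r * ln (?f r)) - n * ln n
    + (\<Sum>r\<in>set_mset M. ?f r * ln (fact r)) + N - N * (ln N - ln n)"
    unfolding sf sr using n M by (simp add: ln_div)
  finally show ?thesis .
qed

text \<open>The product formula also shows that every type with the right size and sum is realised
  by some list, so the logarithm is the genuine one.\<close>

lemma ln_card_occupancy:
  assumes M: "size M = n" "sum_mset M = 2 * m"
  defines "C \<equiv> card {w \<in> pair_lists n m. occupancy_mset n (endpoints w) = M}"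
  shows "0 < C"
    "ln C = ln (fact n) + ln (fact (2 * m)) - (\<Sum>r\<in>set_mset M. ln (fact (count M r)))
      - (\<Sum>r\<in>set_mset M. real (count M r) * ln (fact r))"
proof -
  let ?A = "\<Prod>r\<in>set_mset M. fact (count M r) :: nat" and ?B = "prod_mset (image_mset fact M) :: nat"
  have eq: "C * (?A * ?B) = fact n * fact (2 * m)"
    unfolding C_def by (rule card_pair_lists_given_occupancy[OF M])
  have "C * (?A * ?B) > 0" unfolding eq by simp
  then show C: "0 < C" by (cases "C = 0") auto
  have A: "?A > 0" and B: "?B > 0" using \<open>C * (?A * ?B) > 0\<close> by (auto intro: Nat.gr0I)
  have lA: "ln (real ?A) = (\<Sum>r\<in>set_mset M. ln (fact (count M r)))"
    by (simp add: ln_prod)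
  have "real ?B = (\<Prod>r\<in>set_mset M. fact r ^ count M r)"
    by (simp add: prod_mset_conv_prod_count)
  then have lB: "ln (real ?B) = (\<Sum>r\<in>set_mset M. real (count M r) * ln (fact r))"
    by (simp add: ln_prod ln_realpow)
  have "ln (real (C * (?A * ?B))) = ln (real (fact n * fact (2 * m)))" unfolding eq ..
  moreover have "ln (real (C * (?A * ?B))) = ln (real C) + (ln (real ?A) + ln (real ?B))"
    unfolding of_nat_mult using A B C
    by (simp only: ln_mult_pos mult_pos_pos of_nat_0_less_iff)
  moreover have "ln (real (fact n * fact (2 * m))) = ln (fact n) + ln (fact (2 * m))"
    by (simp add: ln_mult)
  ultimately have "ln (real C) + (ln (real ?A) + ln (real ?B)) = ln (fact n) + ln (fact (2 * m))" by simp
  then show "ln C = ln (fact n) + ln (fact (2 * m)) - (\<Sum>r\<in>set_mset M. ln (fact (count M r)))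
      - (\<Sum>r\<in>set_mset M. real (count M r) * ln (fact r))"
    unfolding lA lB by simp
qed

text \<open>The factor \<open>real n ^ (2 * m)\<close> is the number of all lists. The counts sit in
  the denominator, where the Stirling bound without error term applies; the error is therefore
  logarithmic however many distinct degrees there are.\<close>

lemma card_occupancy_le:
  assumes M: "size M = n" "sum_mset M = 2 * m" "0 < m"
  shows "card {w \<in> pair_lists n m. occupancy_mset n (endpoints w) = M} \<le>
    real n ^ (2 * m) * exp (- real n * empirical_entropy M + 2 + ln (real n + 1) + ln (2 * real m + 1))"
proof -
  let ?C = "card {w \<in> pair_lists n m. occupancy_mset n (endpoints w) = M}"
  have n: "n > 0" using M by (cases "n = 0") auto
  let ?f = "\<lambda>r. real (count M r)"
  have sf: "(\<Sum>r\<in>set_mset M. ?f r) = n"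
    using M(1) by (simp add: size_multiset_overloaded_eq flip: of_nat_sum)
  have a: "(\<Sum>r\<in>set_mset M. ?f r * ln (?f r) - ?f r) \<le> (\<Sum>r\<in>set_mset M. ln (fact (count M r)))"
    by (intro sum_mono ln_fact_ge)
  have "ln ?C \<le> 2 * m * ln n - n * empirical_entropy M + 2 + ln (real n + 1) + ln (2 * real m + 1)"
    using ln_fact_le'[of n] ln_fact_le'[of "2 * m"] a sf empirical_entropy_altdef[OF M(1,2)] M(3)
    unfolding ln_card_occupancy(2)[OF M(1,2)] sum_subtractf by (simp add: algebra_simps)
  also have "\<dots> = ln (real n ^ (2 * m) * exp (- real n * empirical_entropy M + 2 + ln (real n + 1) + ln (2 * real m + 1)))"
    using n by (simp add: ln_mult ln_realpow)
  finally show ?thesis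
    using ln_card_occupancy(1)[OF M(1,2)] n by (subst (asm) ln_le_cancel_iff) auto
qed

text \<open>With the Stirling bounds exchanged, each distinct degree costs a logarithm. The estimate
  is meant for types supported in a fixed finite set.\<close>

lemma card_occupancy_ge:
  assumes M: "size M = n" "sum_mset M = 2 * m" "0 < m"
  shows "real n ^ (2 * m) * exp (- real n * empirical_entropy M - card (set_mset M) * (1 + ln (real n + 1)))
    \<le> card {w \<in> pair_lists n m. occupancy_mset n (endpoints w) = M}"
proof -
  let ?C = "card {w \<in> pair_lists n m. occupancy_mset n (endpoints w) = M}"
  have n: "n > 0" using M by (cases "n = 0") auto
  let ?f = "\<lambda>r. real (count M r)"
  have sf: "(\<Sum>r\<in>set_mset M. ?f r) = n"
    using M(1) by (simp add: size_multiset_overloaded_eq flip: of_nat_sum)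
  have a: "(\<Sum>r\<in>set_mset M. ln (fact (count M r))) \<le>
      (\<Sum>r\<in>set_mset M. (?f r * ln (?f r) - ?f r) + (1 + ln (real n + 1)))"
  proof (rule sum_mono)
    fix r
    have "ln (?f r + 1) \<le> ln (real n + 1)" using count_le_size[of M r] M by simp
    then show "ln (fact (count M r)) \<le> (?f r * ln (?f r) - ?f r) + (1 + ln (real n + 1))"
      using ln_fact_le'[of "count M r"] by linarith
  qed
  have "ln (real n ^ (2 * m) * exp (- real n * empirical_entropy M - card (set_mset M) * (1 + ln (real n + 1)))) =
      2 * m * ln n - n * empirical_entropy M - card (set_mset M) * (1 + ln (real n + 1))"
    using n by (simp add: ln_mult ln_realpow)
  also have "\<dots> \<le> ln ?C"
    using ln_fact_ge[of n] ln_fact_ge[of "2 * m"] a sf empirical_entropy_altdef[OF M(1,2)] M(3)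
    unfolding ln_card_occupancy(2)[OF M(1,2)] sum_subtractf sum.distrib by (simp add: algebra_simps)
  finally show ?thesis
    using ln_card_occupancy(1)[OF M(1,2)] n by (subst (asm) ln_le_cancel_iff) auto
qed

text \<open>Extending the sum beyond the support of \<open>M\<close> only adds nonnegative terms.
  There the masses of the empirical distribution sum to 1 and those of the Poisson distribution to
  at most 1, so the corrections have the right sign.\<close>

lemma sum_entropy_term_le_empirical_entropy:
  assumes "M \<noteq> {#}" "0 < sum_mset M"
  shows "(\<Sum>r<K. entropy_term (pmf (pmf_of_multiset M) r)
      (pmf (poisson_pmf (real (sum_mset M) / real (size M))) r)) \<le> empirical_entropy M"
proof -
  define q where "q = poisson_pmf (real (sum_mset M) / real (size M))"
  let ?x = "\<lambda>r. pmf (pmf_of_multiset M) r"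
  have x: "?x r = count M r / size M" for r using assms by simp
  have "0 < real (sum_mset M) / real (size M)"
    using assms(2) iffD1[OF nonempty_has_size assms(1)]
    by (intro divide_pos_pos) (simp_all only: of_nat_0_less_iff)
  then have q: "0 < pmf q r" for r unfolding q_def by simp
  obtain K' where K': "set_mset M \<subseteq> {..<K'}" by (metis finite_nat_iff_bounded finite_set_mset)
  define L where "L = max K K'"
  have sx: "(\<Sum>r<L. ?x r) = 1"
  proof -
    have "(\<Sum>r<L. ?x r) = (\<Sum>r\<in>set_mset M. real (count M r) / size M)"
      unfolding x using K' by (intro sum.mono_neutral_right) (auto simp: L_def not_in_iff)
    also have "\<dots> = real (size M) / size M"
      unfolding sum_divide_distrib[symmetric] size_multiset_overloaded_eq by simp
    also have "\<dots> = 1" using assms(1) by simp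
    finally show ?thesis .
  qed
  have "(\<Sum>r<K. entropy_term (?x r) (pmf q r)) \<le> (\<Sum>r<L. entropy_term (?x r) (pmf q r))"
    by (intro sum_mono2) (auto simp: L_def intro!: entropy_term_nonneg q pmf_nonneg simp del: pmf_of_multiset)
  also have "\<dots> = (\<Sum>r<L. ?x r * ln (?x r / pmf q r)) - (\<Sum>r<L. ?x r) + (\<Sum>r<L. pmf q r)"
    unfolding entropy_term_def by (simp add: sum.distrib sum_subtractf)
  also have "(\<Sum>r<L. ?x r * ln (?x r / pmf q r)) = empirical_entropy M"
    unfolding empirical_entropy_def x q_def using K'
    by (intro sum.mono_neutral_right) (auto simp: L_def not_in_iff)
  finally show ?thesis unfolding sx using sum_pmf_lessThan_le_1[of q L] by (simp add: q_def)
qed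

text \<open>The generating function of partitions: as \<open>x\<close> may be taken close to \<open>1\<close>, the number of types
  is subexponential in \<open>N\<close>.\<close>

lemma card_types_le:
  fixes x :: real
  assumes x: "0 < x" "x < 1"
  shows "card {M. size M = n \<and> sum_mset M = N} * x ^ N \<le> exp (1 / (1 - x)\<^sup>2)"
    and "finite {M :: nat multiset. size M = n \<and> sum_mset M = N}"
proof -
  let ?T = "{M :: nat multiset. size M = n \<and> sum_mset M = N}"
  let ?P = "PiE {1..N} (\<lambda>_. {0..N})"
  \<comment> \<open>This determines \<open>M\<close>: values above \<open>N\<close> cannot occur,
    and the count at 0 is what the size \<open>n\<close> leaves over.\<close>
  let ?\<phi> = "\<lambda>M. restrict (count M) {1..N}"
  have le: "r * count M r \<le> N" if "M \<in> ?T" for M r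
  proof (cases "r \<in># M")
    case True
    have "count M r * r \<le> (\<Sum>r\<in>set_mset M. count M r * r)"
      using True by (intro member_le_sum) auto
    then show ?thesis using that sum_mset_conv_sum_count[of "\<lambda>x. x" M] by (simp add: mult.commute)
  qed (auto simp: not_in_iff)
  have big: "count M r = 0" if "M \<in> ?T" "r > N" for M r
    using le[OF that(1), of r] that(2) by (cases "count M r") auto
  have sN: "(\<Sum>r=1..N. r * count M r) = N" if "M \<in> ?T" for M
  proof -
    have "N = (\<Sum>r\<in>set_mset M. r * count M r)"
      using that sum_mset_conv_sum_count[of "\<lambda>x. x" M] by (simp add: mult.commute)
    also have "\<dots> = (\<Sum>r\<in>set_mset M \<union> {1..N}. r * count M r)"
      by (intro sum.mono_neutral_left) (auto simp: not_in_iff)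
    also have "\<dots> = (\<Sum>r=1..N. r * count M r)"
    proof (intro sum.mono_neutral_right ballI)
      fix r assume "r \<in> set_mset M \<union> {1..N} - {1..N}"
      then have "r = 0 \<or> r > N" by auto
      then show "r * count M r = 0" using big[OF that, of r] by auto
    qed auto
    finally show ?thesis by simp
  qed
  have szN: "count M 0 = n - (\<Sum>r=1..N. count M r)" if "M \<in> ?T" for M
  proof -
    have "n = (\<Sum>r\<in>set_mset M. count M r)" using that by (simp add: size_multiset_overloaded_eq)
    also have "\<dots> = (\<Sum>r\<in>set_mset M \<union> {0..N}. count M r)"
      by (intro sum.mono_neutral_left) (auto simp: not_in_iff)
    also have "\<dots> = (\<Sum>r=0..N. count M r)"
    proof (intro sum.mono_neutral_right ballI)
      fix r assume "r \<in> set_mset M \<union> {0..N} - {0..N}"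
      then have "r > N" by auto
      then show "count M r = 0" using big[OF that, of r] by auto
    qed auto
    also have "\<dots> = count M 0 + (\<Sum>r=1..N. count M r)" by (simp add: sum.atLeast_Suc_atMost)
    finally show ?thesis by simp
  qed
  have inj: "inj_on ?\<phi> ?T"
  proof (intro inj_onI multiset_eqI)
    fix M M' r assume M: "M \<in> ?T" "M' \<in> ?T" "?\<phi> M = ?\<phi> M'"
    have eq: "count M r = count M' r" if "r \<in> {1..N}" for r
      using M(3) that by (metis restrict_apply)
    then have "(\<Sum>r=1..N. count M r) = (\<Sum>r=1..N. count M' r)" by (intro sum.cong) auto
    then have "count M 0 = count M' 0" using szN M by simp
    then show "count M r = count M' r"
      using eq[of r] big[OF M(1), of r] big[OF M(2), of r] by (cases "r = 0"; cases "r > N") auto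
  qed
  have sub: "?\<phi> ` ?T \<subseteq> ?P"
  proof (intro image_subsetI PiE_I)
    fix M r assume "M \<in> ?T" "r \<in> {1..N}"
    then show "?\<phi> M r \<in> {0..N}" using le[of M r] by (auto intro: order_trans[of _ "r * count M r"])
  qed auto
  have finP: "finite ?P" by (intro finite_PiE) auto
  show fin: "finite ?T" using finite_imageD[OF finite_subset[OF sub finP] inj] .
  have "card ?T * x ^ N = (\<Sum>M\<in>?T. x ^ N)" by simp
  also have "\<dots> = (\<Sum>M\<in>?T. \<Prod>r=1..N. (x ^ r) ^ ?\<phi> M r)"
  proof (rule sum.cong)
    fix M assume "M \<in> ?T"
    then show "x ^ N = (\<Prod>r=1..N. (x ^ r) ^ ?\<phi> M r)"
      by (subst sN[symmetric]) (auto simp: power_sum power_mult)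
  qed simp
  also have "\<dots> = (\<Sum>g\<in>?\<phi> ` ?T. \<Prod>r=1..N. (x ^ r) ^ g r)"
    by (subst sum.reindex[OF inj]) simp
  also have "\<dots> \<le> (\<Sum>g\<in>?P. \<Prod>r=1..N. (x ^ r) ^ g r)"
    using finP sub x by (intro sum_mono2 prod_nonneg) auto
  \<comment> \<open>Euler's product for partitions, each geometric factor truncated at
    \<open>N\<close>.\<close>
  also have "\<dots> = (\<Prod>r=1..N. \<Sum>j=0..N. (x ^ r) ^ j)"
    by (rule prod_sum_PiE[symmetric]) auto
  also have "\<dots> \<le> (\<Prod>r=1..N. exp (x ^ r / (1 - x)))"
  proof (rule prod_mono, intro conjI)
    fix r assume r: "r \<in> {1..N}"
    let ?y = "x ^ r"
    have y: "0 < ?y" "?y \<le> x" using x r power_decreasing[of 1 r x] by auto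
    then have y1: "?y < 1" using x by simp
    show "0 \<le> (\<Sum>j=0..N. ?y ^ j)" using x by (intro sum_nonneg) auto
    have "(\<Sum>j=0..N. ?y ^ j) \<le> 1 / (1 - ?y)"
      using y y1 by (simp add: atLeast0AtMost sum_gp0 divide_right_mono)
    also have "\<dots> = 1 + ?y / (1 - ?y)" using y1 by (simp add: field_simps)
    also have "\<dots> \<le> 1 + ?y / (1 - x)" using y y1 x by (intro add_left_mono divide_left_mono) auto
    also have "\<dots> \<le> exp (?y / (1 - x))" by (rule exp_ge_add_one_self)
    finally show "(\<Sum>j=0..N. ?y ^ j) \<le> exp (?y / (1 - x))" .
  qed
  also have "\<dots> = exp ((\<Sum>r=1..N. x ^ r) / (1 - x))" by (simp add: exp_sum sum_divide_distrib)
  also have "\<dots> \<le> exp (1 / (1 - x)\<^sup>2)"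
  proof -
    have "(\<Sum>r=1..N. x ^ r) \<le> (\<Sum>r\<le>N. x ^ r)" using x by (intro sum_mono2) auto
    also have "\<dots> \<le> 1 / (1 - x)" using x by (simp add: sum_gp0 divide_right_mono)
    finally have "(\<Sum>r=1..N. x ^ r) / (1 - x) \<le> 1 / (1 - x) / (1 - x)"
      using x by (intro divide_right_mono) auto
    then show ?thesis by (simp add: power2_eq_square)
  qed
  finally show "card ?T * x ^ N \<le> exp (1 / (1 - x)\<^sup>2)" .
qed

section \<open>Probabilities of degree sets\<close>

definition graphs :: "nat \<Rightarrow> nat \<Rightarrow> nat set set set" where
  "graphs n m = {E. E \<subseteq> node_pairs n \<and> card E = m}"

lemma finite_graphs [simp]: "finite (graphs n m)"
  by (rule finite_subset[of _ "Pow (node_pairs n)"]) (auto simp: graphs_def)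

lemma card_graphs: "card (graphs n m) = (n choose 2) choose m"
  unfolding graphs_def using n_subsets[OF finite_node_pairs] by (simp add: card_node_pairs)

lemma real_choose_two: "2 * real (n choose 2) = real n ^ 2 - real n"
  by (cases n) (auto simp: choose_two power2_eq_square field_simps real_of_nat_div algebra_simps)

lemma card_graphs_le: "real (card (graphs n m)) * (2 ^ m * fact m) \<le> real n ^ (2 * m)"
proof -
  let ?N = "n choose 2"
  have "real ((?N choose m) * fact m) \<le> real (?N ^ m)"
    by (simp only: of_nat_le_iff binomial_fact_pow)
  then have "real (?N choose m) * (2 ^ m * fact m) \<le> 2 ^ m * real ?N ^ m"
    by (simp add: mult_ac)
  also have "\<dots> = (2 * real ?N) ^ m" by (simp only: power_mult_distrib)
  also have "\<dots> \<le> (real n ^ 2) ^ m"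
  proof (rule power_mono)
    show "2 * real ?N \<le> real n ^ 2" unfolding real_choose_two by simp
  qed simp
  finally show ?thesis by (simp add: card_graphs power_mult)
qed

text \<open>In every step at least \<open>n ^ 2 - (n + 2 * m)\<close> ordered pairs avoid loops and
  earlier edges. Divided by \<open>n ^ (2 * k)\<close>, this bounds from below the chance that a
  random list of length \<open>k\<close> has no defect.\<close>

lemma card_graphs_ge:
  assumes "n + 2 * m \<le> n ^ 2" "k \<le> m"
  shows "(real n ^ 2 - real (n + 2 * m)) ^ k \<le> real (card (graphs n k)) * (2 ^ k * fact k)"
  using assms(2)
proof (induction k)
  case 0 then show ?case by (simp add: card_graphs)
next
  case (Suc k)
  let ?N = "n choose 2"
  have pos: "0 \<le> real n ^ 2 - real (n + 2 * m)"
    using assms(1) by (metis diff_ge_0_iff_ge of_nat_le_iff of_nat_power)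
  have kN: "k \<le> ?N"
  proof -
    have "2 * real k \<le> 2 * real m" using Suc.prems by simp
    also have "\<dots> \<le> 2 * real ?N" unfolding real_choose_two using pos by simp
    finally show ?thesis by simp
  qed
  have "(?N choose Suc k) * Suc k = (?N - k) * (?N choose k)"
    using binomial_absorption[of k ?N] binomial_absorb_comp[of ?N k] by (simp add: mult.commute)
  then have "real (?N choose Suc k) * real (Suc k) = (real ?N - real k) * real (?N choose k)"
    using kN by (metis of_nat_diff of_nat_mult)
  then have "real (?N choose Suc k) * (2 ^ Suc k * fact (Suc k)) =
      ((real ?N - real k) * real (?N choose k)) * (2 * 2 ^ k * fact k)"
    by (simp add: mult_ac)
  also have "\<dots> = (2 * real ?N - 2 * real k) * (real (?N choose k) * (2 ^ k * fact k))"
    by (simp add: algebra_simps)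
  also have "\<dots> \<ge> (real n ^ 2 - real (n + 2 * m)) * (real n ^ 2 - real (n + 2 * m)) ^ k"
  proof (rule mult_mono)
    show "real n ^ 2 - real (n + 2 * m) \<le> 2 * real ?N - 2 * real k"
      unfolding real_choose_two using Suc.prems by simp
    then show "0 \<le> 2 * real ?N - 2 * real k" using pos by linarith
  qed (use Suc pos in \<open>auto simp: card_graphs simp del: of_nat_add\<close>)
  finally show ?case by (simp add: card_graphs)
qed

lemma exp_le_one_minus:
  fixes y :: real
  assumes "0 \<le> y" "y \<le> 1 / 2"
  shows "exp (- 2 * y) \<le> 1 - y"
proof -
  have "2 * y\<^sup>2 \<le> y" using assms using mult_left_mono[of "2 * y" 1 y] by (simp add: power2_eq_square mult.left_commute)
  then have "- 2 * y \<le> ln (1 - y)" using ln_one_minus_pos_lower_bound[OF assms] by linarith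
  then show ?thesis using assms by (subst (asm) ln_ge_iff) auto
qed

text \<open>The chance of the event for lists, divided by the chance of a defect-free list; the
  latter is at least \<open>exp (- 2 * m * (n + 2 * m) / n ^ 2)\<close>. The parameter
  \<open>s\<close> comes from \<open>card_types_le\<close> at \<open>x = exp (- s)\<close>, and the
  remaining terms are Stirling errors.\<close>

lemma graph_probability_le:
  fixes n m :: nat and a s :: real
  assumes n: "0 < n" "0 < m" "2 * (n + 2 * m) \<le> n ^ 2"
    and U: "\<And>M. M \<in> U \<Longrightarrow> size M = n \<Longrightarrow> sum_mset M = 2 * m \<Longrightarrow> a \<le> empirical_entropy M"
    and s: "0 < s"
  shows "card {E \<in> graphs n m. degree_mset n E \<in> U} / card (graphs n m) \<le>
    exp (1 / (1 - exp (- s))\<^sup>2 + 2 * m * s - n * a + 2 + ln (real n + 1) + ln (2 * real m + 1)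
      + 2 * m * (n + 2 * m) / real n ^ 2)"
proof -
  let ?T = "{M :: nat multiset. size M = n \<and> sum_mset M = 2 * m}"
  let ?W = "\<lambda>M. {w \<in> pair_lists n m. occupancy_mset n (endpoints w) = M}"
  let ?c = "2 + ln (real n + 1) + ln (2 * real m + 1)"
  define y where "y = real (n + 2 * m) / real n ^ 2"
  have x: "0 < exp (- s)" "exp (- s) < 1" using s by auto
  note fT = card_types_le(2)[OF x, of n "2 * m"]
  have y: "0 \<le> y" "y \<le> 1 / 2"
  proof -
    have "real (2 * (n + 2 * m)) \<le> real (n ^ 2)" using n by (simp only: of_nat_le_iff)
    then show "y \<le> 1 / 2" using n by (simp add: y_def field_simps)
  qed (simp add: y_def)
  have T: "real (card ?T) \<le> exp (1 / (1 - exp (- s))\<^sup>2 + 2 * m * s)"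
  proof -
    have "exp (- s) ^ (2 * m) * exp (2 * m * s) = 1"
      by (simp add: exp_of_nat_mult[symmetric] exp_add[symmetric] algebra_simps)
    then have "real (card ?T) = real (card ?T) * exp (- s) ^ (2 * m) * exp (2 * m * s)" by simp
    also have "\<dots> \<le> exp (1 / (1 - exp (- s))\<^sup>2) * exp (2 * m * s)"
      by (intro mult_right_mono card_types_le(1) x) auto
    finally show ?thesis by (simp add: exp_add)
  qed
  have W: "real (card {w \<in> pair_lists n m. occupancy_mset n (endpoints w) \<in> U}) \<le>
      real (card ?T) * (real n ^ (2 * m) * exp (- real n * a + ?c))"
  proof -
    have "{w \<in> pair_lists n m. occupancy_mset n (endpoints w) \<in> U} \<subseteq> (\<Union>M\<in>?T \<inter> U. ?W M)"
      using sum_occupancy_mset by auto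
    then have "card {w \<in> pair_lists n m. occupancy_mset n (endpoints w) \<in> U} \<le> card (\<Union>M\<in>?T \<inter> U. ?W M)"
      using fT by (intro card_mono) auto
    also have "\<dots> \<le> (\<Sum>M\<in>?T \<inter> U. card (?W M))" using fT by (intro card_UN_le) auto
    finally have "real (card {w \<in> pair_lists n m. occupancy_mset n (endpoints w) \<in> U}) \<le>
        (\<Sum>M\<in>?T \<inter> U. real (card (?W M)))" by (simp only: of_nat_le_iff flip: of_nat_sum)
    also have "\<dots> \<le> (\<Sum>M\<in>?T \<inter> U. real n ^ (2 * m) * exp (- real n * a + ?c))"
    proof (rule sum_mono)
      fix M assume M: "M \<in> ?T \<inter> U"
      then have "real (card (?W M)) \<le> real n ^ (2 * m) * exp (- real n * empirical_entropy M + ?c)"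
        using card_occupancy_le[of M n m] n by (simp add: algebra_simps)
      also have "\<dots> \<le> real n ^ (2 * m) * exp (- real n * a + ?c)"
      proof -
        have "real n * a \<le> real n * empirical_entropy M" using M by (intro mult_left_mono U) auto
        then show ?thesis by (intro mult_left_mono) auto
      qed
      finally show "real (card (?W M)) \<le> real n ^ (2 * m) * exp (- real n * a + ?c)" .
    qed
    also have "\<dots> = card (?T \<inter> U) * (real n ^ (2 * m) * exp (- real n * a + ?c))" by simp
    also have "\<dots> \<le> card ?T * (real n ^ (2 * m) * exp (- real n * a + ?c))"
      using fT by (intro mult_right_mono) (auto intro: card_mono)
    finally show ?thesis .
  qed
  have G: "real n ^ (2 * m) * exp (- 2 * y * m) \<le> real (card (graphs n m)) * (2 ^ m * fact m)"
  proof -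
    have "real n ^ (2 * m) * exp (- 2 * y * m) = (real n ^ 2 * exp (- 2 * y)) ^ m"
      unfolding power_mult power_mult_distrib by (simp only: exp_of_nat2_mult)
    also have "\<dots> \<le> (real n ^ 2 * (1 - y)) ^ m"
      by (intro power_mono mult_left_mono exp_le_one_minus y) auto
    also have "real n ^ 2 * (1 - y) = real n ^ 2 - real (n + 2 * m)"
      using n by (simp add: y_def field_simps)
    also have "\<dots> ^ m \<le> real (card (graphs n m)) * (2 ^ m * fact m)"
      using n by (intro card_graphs_ge) auto
    finally show ?thesis .
  qed
  have Gpos: "0 < real (card (graphs n m)) * (2 ^ m * fact m)"
    using n by (intro less_le_trans[OF _ G]) auto
  have "real (card {E \<in> graphs n m. degree_mset n E \<in> U}) * (2 ^ m * fact m) \<le>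
      real (card {w \<in> pair_lists n m. occupancy_mset n (endpoints w) \<in> U})"
  proof -
    have "real (card {E \<in> graphs n m. degree_mset n E \<in> U} * (2 ^ m * fact m)) \<le>
      real (card {w \<in> pair_lists n m. occupancy_mset n (endpoints w) \<in> U})"
      using card_graphs_le_card_lists[of n m U] unfolding graphs_def of_nat_le_iff by simp
    then show ?thesis by simp
  qed
  also note W
  also have "real (card ?T) * (real n ^ (2 * m) * exp (- real n * a + ?c)) \<le>
      exp (1 / (1 - exp (- s))\<^sup>2 + 2 * m * s) * (real n ^ (2 * m) * exp (- real n * a + ?c))"
    by (intro mult_right_mono T) auto
  also have "\<dots> = (real n ^ (2 * m) * exp (- 2 * y * m)) *
      exp (1 / (1 - exp (- s))\<^sup>2 + 2 * m * s + (- real n * a + ?c) + 2 * y * m)"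
  proof -
    have eq: "exp A * (N * exp B) = (N * exp (- Y)) * exp (A + B + Y)" for A B N Y :: real
      by (simp add: exp_add exp_minus field_simps)
    have neg: "- 2 * y * m = - (2 * y * m)" by simp
    show ?thesis unfolding neg by (rule eq)
  qed
  also have "\<dots> \<le> (real (card (graphs n m)) * (2 ^ m * fact m)) *
      exp (1 / (1 - exp (- s))\<^sup>2 + 2 * m * s + (- real n * a + ?c) + 2 * y * m)"
    by (intro mult_right_mono G) auto
  finally have "real (card {E \<in> graphs n m. degree_mset n E \<in> U}) \<le> real (card (graphs n m)) *
      exp (1 / (1 - exp (- s))\<^sup>2 + 2 * m * s + (- real n * a + ?c) + 2 * y * m)"
    by (simp add: mult_ac)
  then have "real (card {E \<in> graphs n m. degree_mset n E \<in> U}) / real (card (graphs n m)) \<le>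
      exp (1 / (1 - exp (- s))\<^sup>2 + 2 * m * s + (- real n * a + ?c) + 2 * y * m)"
    using Gpos by (simp add: divide_le_eq mult.commute zero_less_mult_iff)
  also have "1 / (1 - exp (- s))\<^sup>2 + 2 * m * s + (- real n * a + ?c) + 2 * y * m =
    1 / (1 - exp (- s))\<^sup>2 + 2 * m * s - n * a + 2 + ln (real n + 1) + ln (2 * real m + 1)
      + 2 * m * (n + 2 * m) / real n ^ 2"
    by (simp add: y_def)
  finally show ?thesis by simp
qed

lemma graph_probability_upper:
  fixes l :: "nat \<Rightarrow> nat" and a b c :: real
  assumes c: "0 < c" and l: "\<forall>\<^sub>F n in sequentially. 0 < l n \<and> real (l n) \<le> c * n"
    and U: "\<forall>\<^sub>F n in sequentially. \<forall>M\<in>U n. size M = n \<longrightarrow> sum_mset M = 2 * l n \<longrightarrow> a \<le> empirical_entropy M"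
    and b: "- a < b"
  shows "\<forall>\<^sub>F n in sequentially.
    card {E \<in> graphs n (l n). degree_mset n E \<in> U n} / card (graphs n (l n)) \<le> exp (n * b)"
proof -
  \<comment> \<open>With \<open>m \<le> c * n\<close> the type count then costs at most
    \<open>n * (a + b) / 2\<close>, half of the slack; the other half absorbs everything that is
    \<open>o(n)\<close>.\<close>
  define s where "s = (a + b) / (4 * c)"
  have s: "0 < s" using b c by (simp add: s_def)
  define K where "K = 1 / (1 - exp (- s))\<^sup>2 + 2 + 2 * c * (1 + 2 * c)"
  have "((\<lambda>n. (K + ln (real n + 1) + ln (2 * c * real n + 1)) / real n) \<longlongrightarrow> 0) sequentially"
    using c by real_asymp
  then have e1: "\<forall>\<^sub>F n in sequentially. (K + ln (real n + 1) + ln (2 * c * real n + 1)) / real n < (a + b) / 2"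
    using b by (intro order_tendstoD) auto
  have e2: "\<forall>\<^sub>F n in sequentially. 2 * (1 + 2 * c) * real n \<le> real n ^ 2"
    using c by real_asymp
  show ?thesis using l U e1 e2 eventually_gt_at_top[of 0]
  proof eventually_elim
    case (elim n)
    let ?m = "l n"
    have n: "0 < n" "0 < ?m" and m: "real ?m \<le> c * n" using elim by auto
    have "real (2 * (n + 2 * ?m)) \<le> 2 * (1 + 2 * c) * real n" using m by (simp add: algebra_simps)
    also have "\<dots> \<le> real (n ^ 2)" using elim by simp
    finally have sq: "2 * (n + 2 * ?m) \<le> n ^ 2" by (simp only: of_nat_le_iff)
    have t1: "2 * ?m * s \<le> n * ((a + b) / 2)"
    proof -
      have "2 * ?m * s \<le> 2 * (c * n) * s" using m s by (intro mult_right_mono) auto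
      also have "\<dots> = n * ((a + b) / 2)" using c by (simp add: s_def field_simps)
      finally show ?thesis .
    qed
    have t2: "ln (2 * real ?m + 1) \<le> ln (2 * c * real n + 1)" using m c by simp
    have t3: "2 * real ?m * (n + 2 * ?m) / real n ^ 2 \<le> 2 * c * (1 + 2 * c)"
    proof -
      have "2 * real ?m * (n + 2 * ?m) \<le> 2 * (c * n) * ((1 + 2 * c) * n)"
        using m c by (intro mult_mono) (auto simp: algebra_simps)
      then show ?thesis using n by (simp add: divide_le_eq power2_eq_square mult_ac)
    qed
    have t4: "K + ln (real n + 1) + ln (2 * c * real n + 1) < n * ((a + b) / 2)"
      using elim n by (simp add: divide_less_eq mult.commute)
    have "card {E \<in> graphs n ?m. degree_mset n E \<in> U n} / card (graphs n ?m) \<le>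
      exp (1 / (1 - exp (- s))\<^sup>2 + 2 * ?m * s - n * a + 2 + ln (real n + 1) + ln (2 * real ?m + 1)
      + 2 * ?m * (n + 2 * ?m) / real n ^ 2)"
      using graph_probability_le[OF n sq _ s, of "U n" a] elim by simp
    also have "\<dots> \<le> exp (n * b)"
    proof -
      have "1 / (1 - exp (- s))\<^sup>2 + 2 * ?m * s - n * a + 2 + ln (real n + 1) + ln (2 * real ?m + 1)
        + 2 * ?m * (n + 2 * ?m) / real n ^ 2 \<le> n * ((a + b) / 2) + n * ((a + b) / 2) - n * a"
        using t1 t2 t3 t4 unfolding K_def by simp
      also have "\<dots> = n * b" by (simp add: field_simps)
      finally show ?thesis by simp
    qed
    finally show ?case .
  qed
qed

section \<open>Lower bound for probabilities of degree sets\<close>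

lemma card_many_defects_le:
  fixes n m :: nat and u b :: real
  assumes n: "0 < n" and u: "0 \<le> u"
  shows "card {w \<in> pair_lists n m. \<not> real (defects w) \<le> b} \<le>
    real n ^ (2 * m) * exp (exp u * m * (n + 2 * m) / real n ^ 2 - u * b)"
proof -
  let ?B = "{w \<in> pair_lists n m. \<not> real (defects w) \<le> b}"
  define X where "X = exp u * (n + 2 * m) / real n ^ 2"
  \<comment> \<open>Exponential Markov inequality: a list with more than \<open>b\<close> defects
    has \<open>exp u ^ defects w\<close> at least \<open>exp (u * b)\<close>.\<close>
  have "card ?B * exp (u * b) = (\<Sum>w\<in>?B. exp (u * b))" by simp
  also have "\<dots> \<le> (\<Sum>w\<in>?B. exp u ^ defects w)"
    using u by (intro sum_mono) (auto simp: exp_of_nat2_mult[symmetric] intro!: mult_left_mono)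
  also have "\<dots> \<le> (\<Sum>w\<in>pair_lists n m. exp u ^ defects w)" by (intro sum_mono2) auto
  also have "\<dots> \<le> (real n ^ 2 + exp u * (n + 2 * m)) ^ m" by (intro sum_defects_power_le) auto
  also have "\<dots> \<le> (real n ^ 2 * exp X) ^ m"
  proof (rule power_mono)
    have "real n ^ 2 * X = exp u * (n + 2 * m)" using n by (simp add: X_def)
    then have "real n ^ 2 + exp u * (n + 2 * m) = real n ^ 2 * (1 + X)"
      by (simp only: distrib_left mult_1_right)
    also have "\<dots> \<le> real n ^ 2 * exp X" by (intro mult_left_mono exp_ge_add_one_self) auto
    finally show "real n ^ 2 + exp u * (n + 2 * m) \<le> real n ^ 2 * exp X" .
  qed auto
  also have "\<dots> = real n ^ (2 * m) * exp (X * m)"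
    unfolding power_mult power_mult_distrib exp_of_nat2_mult ..
  finally have "card ?B * exp (u * b) \<le> real n ^ (2 * m) * exp (X * m)" .
  then have "card ?B \<le> real n ^ (2 * m) * exp (X * m) / exp (u * b)"
    by (simp add: le_divide_eq)
  also have "\<dots> = real n ^ (2 * m) * exp (X * m - u * b)" by (simp add: exp_diff)
  also have "X * m = exp u * m * (n + 2 * m) / real n ^ 2" by (simp add: X_def)
  finally show ?thesis .
qed

text \<open>The left side of \<open>sum_defects_power_within_le\<close>, at
  \<open>z = s / n\<close>, gives a full list inside \<open>E\<close> with \<open>d\<close> defects
  the weight on the right. With \<open>y = d / n\<close>, Stirling's bound leaves
  \<open>y * ln y - y + y * ln s\<close> in the exponent; a tangent inequality replaces
  \<open>y * ln y\<close>, and \<open>y \<le> s\<close> together with \<open>ln s \<le> 0\<close>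
  removes \<open>y\<close>.\<close>

lemma power_fact_ge:
  fixes n d :: nat and s :: real
  assumes s: "0 < s" "s \<le> 1" and n: "0 < n" and d: "real d \<le> s * n"
  shows "exp (- real n * (2 * s - 2 * s * ln s)) \<le> 2 ^ d * fact d * (s / n) ^ d"
proof (cases "d = 0")
  case True
  have "0 \<le> n * (2 * s - 2 * s * ln s)"
  proof (rule mult_nonneg_nonneg)
    have "s * ln s \<le> 0" using s by (intro mult_nonneg_nonpos) auto
    then show "0 \<le> 2 * s - 2 * s * ln s" using s by linarith
  qed simp
  then show ?thesis using True by simp
next
  case False
  define y where "y = d / n"
  have y: "0 < y" "y \<le> s" using False n d by (auto simp: y_def field_simps)
  have "ln (s / y) \<le> s / y - 1" using y s by (intro ln_le_minus_one) auto
  then have "y * ln (s / y) \<le> y * (s / y - 1)" using y by (intro mult_left_mono) auto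
  also have "\<dots> = s - y" using y by (simp add: field_simps)
  finally have a: "y * ln s - y * ln y \<le> s - y"
    using y s by (simp add: ln_div right_diff_distrib)
  have ls: "ln s \<le> 0" using s by simp
  have b: "s * ln s \<le> y * ln s" using mult_right_mono_neg[OF y(2) ls] .
  have "- real n * (2 * s - 2 * s * ln s) \<le> n * (y * ln y - y + y * ln s)"
  proof -
    have "- (2 * s - 2 * s * ln s) \<le> y * ln y - y + y * ln s" using a b y by linarith
    then have "n * - (2 * s - 2 * s * ln s) \<le> n * (y * ln y - y + y * ln s)"
      by (intro mult_left_mono) auto
    then show ?thesis by (simp only: mult_minus_left mult_minus_right)
  qed
  also have "\<dots> = (d * ln d - d) + d * (ln s - ln n)"
    using n False by (simp add: y_def ln_div algebra_simps)
  also have "\<dots> \<le> ln (fact d) + d * (ln s - ln n)" using ln_fact_ge[of d] by simp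
  also have "\<dots> \<le> d * ln 2 + ln (fact d) + d * (ln s - ln n)" by simp
  also have "\<dots> = ln (2 ^ d) + ln (fact d) + ln ((s / n) ^ d)"
    using s n by (simp add: ln_realpow ln_div)
  also have "\<dots> = ln (2 ^ d * fact d * (s / n) ^ d)"
    using s n by (simp add: ln_mult)
  finally show ?thesis using s n by (subst (asm) ln_ge_iff) auto
qed

text \<open>This bounds how many lists a repair can send to the same graph. The choice
  \<open>z = s / n\<close> is large enough for \<open>power_fact_ge\<close> and small enough for
  \<open>(1 + z * (n + 2 * m)) ^ m\<close> to be \<open>exp (O(s * n))\<close> when
  \<open>m = O(n)\<close>.\<close>

lemma card_few_defects_within_le:
  fixes n m :: nat and s :: real
  assumes E: "E \<subseteq> node_pairs n" "card E = m" and s: "0 < s" "s \<le> 1" and n: "0 < n"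
  shows "card {w \<in> pair_lists n m. simple_edges w \<subseteq> E \<and> real (defects w) \<le> s * n} \<le>
    exp (n * (2 * s - 2 * s * ln s) + s * m * (n + 2 * m) / n) * (2 ^ m * fact m)"
proof -
  let ?S = "{w \<in> pair_lists n m. simple_edges w \<subseteq> E \<and> real (defects w) \<le> s * n}"
  have "card ?S * exp (- real n * (2 * s - 2 * s * ln s)) = (\<Sum>w\<in>?S. exp (- real n * (2 * s - 2 * s * ln s)))"
    by simp
  also have "\<dots> \<le> (\<Sum>w\<in>?S. 2 ^ (m - card (simple_edges w)) * fact (m - card (simple_edges w)) * (s / n) ^ defects w)"
  proof (rule sum_mono)
    fix w assume w: "w \<in> ?S"
    then have "m - card (simple_edges w) = defects w" by (auto simp: defects_def pair_lists_def)
    then show "exp (- real n * (2 * s - 2 * s * ln s)) \<le>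
        2 ^ (m - card (simple_edges w)) * fact (m - card (simple_edges w)) * (s / n) ^ defects w"
      using power_fact_ge[OF s n, of "defects w"] w by simp
  qed
  also have "\<dots> \<le> (\<Sum>w | w \<in> pair_lists n m \<and> simple_edges w \<subseteq> E.
      2 ^ (m - card (simple_edges w)) * fact (m - card (simple_edges w)) * (s / n) ^ defects w)"
    using s by (intro sum_mono2) auto
  also have "\<dots> \<le> (1 + s / n * (n + 2 * m)) ^ m * (2 ^ m * fact m)"
    using s by (intro sum_defects_power_within_le[OF E]) auto
  also have "\<dots> \<le> exp (s / n * (n + 2 * m)) ^ m * (2 ^ m * fact m)"
    using s by (intro mult_right_mono power_mono exp_ge_add_one_self) auto
  also have "exp (s / n * (n + 2 * m)) ^ m = exp (s * m * (n + 2 * m) / n)"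
    by (simp add: exp_of_nat_mult[symmetric] mult_ac)
  finally show ?thesis by (simp add: exp_minus exp_add exp_diff field_simps)
qed

text \<open>From the lists of type \<open>M\<close> those with more than \<open>s * n\<close>
  defects are discarded. The simple edges of each remaining list extend to a graph with
  \<open>m\<close> edges that differs from the list in at most \<open>4 * s * n\<close> degrees, so
  it lies in the event; the last factor accounts for the multiplicity.\<close>

lemma graph_probability_ge:
  fixes n m :: nat and s u :: real
  assumes n: "0 < n" "0 < m" "2 * (n + 2 * m) \<le> n ^ 2" and s: "0 < s" "s \<le> 1" and u: "0 \<le> u"
    and M: "size M = n" "sum_mset M = 2 * m"
    and U: "\<And>E w. E \<in> graphs n m \<Longrightarrow> w \<in> pair_lists n m \<Longrightarrow> occupancy_mset n (endpoints w) = M \<Longrightarrow>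
      real (card {i \<in> {1..n}. card {e \<in> E. i \<in> e} \<noteq> count_list (endpoints w) i}) \<le> 4 * (s * n) \<Longrightarrow>
      degree_mset n E \<in> U"
  shows "(exp (- real n * empirical_entropy M - card (set_mset M) * (1 + ln (real n + 1)))
      - exp (exp u * m * (n + 2 * m) / real n ^ 2 - u * (s * n)))
      * exp (- (n * (2 * s - 2 * s * ln s) + s * m * (n + 2 * m) / n))
    \<le> card {E \<in> graphs n m. degree_mset n E \<in> U} / card (graphs n m)"
proof -
  let ?W = "{w \<in> pair_lists n m. occupancy_mset n (endpoints w) = M}"
  let ?B = "{w \<in> pair_lists n m. \<not> real (defects w) \<le> s * n}"
  let ?G = "{E \<in> graphs n m. degree_mset n E \<in> U}"
  let ?S = "\<lambda>E. {w \<in> pair_lists n m. simple_edges w \<subseteq> E \<and> real (defects w) \<le> s * n}"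
  define A where "A = exp (- real n * empirical_entropy M - card (set_mset M) * (1 + ln (real n + 1)))"
  define T where "T = exp (exp u * m * (n + 2 * m) / real n ^ 2 - u * (s * n))"
  define X where "X = n * (2 * s - 2 * s * ln s) + s * m * (n + 2 * m) / n"
  have mN: "m \<le> card (node_pairs n)"
  proof -
    have "real (2 * (n + 2 * m)) \<le> real (n ^ 2)" using n by (simp only: of_nat_le_iff)
    then have "2 * real m \<le> 2 * real (n choose 2)" unfolding real_choose_two by simp
    then show ?thesis by (simp add: card_node_pairs)
  qed
  have Gpos: "0 < real (card (graphs n m))" using mN by (simp add: card_graphs card_node_pairs)
  have sub: "?W - ?B \<subseteq> (\<Union>E\<in>?G. ?S E)"
  proof
    fix w assume w: "w \<in> ?W - ?B"
    have "card (simple_edges w) \<le> m" using w card_simple_edges_le[of w] by (simp add: pair_lists_def)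
    moreover have "simple_edges w \<subseteq> node_pairs n" using w simple_edges_subset_node_pairs by blast
    ultimately obtain E where E: "simple_edges w \<subseteq> E" "E \<subseteq> node_pairs n" "card E = m"
      using exists_subset_between[of "simple_edges w" m "node_pairs n"] mN by auto
    have "real (card {i \<in> {1..n}. card {e \<in> E. i \<in> e} \<noteq> count_list (endpoints w) i}) \<le> real (4 * defects w)"
      unfolding of_nat_le_iff using w E by (intro card_degree_mismatch_le[of w n m]) auto
    also have "\<dots> \<le> 4 * (s * n)" using w by auto
    finally have "degree_mset n E \<in> U" using w E by (intro U[of E w]) (auto simp: graphs_def)
    then show "w \<in> (\<Union>E\<in>?G. ?S E)" using w E by (auto simp: graphs_def)
  qed
  have "real (card ?W) - real (card ?B) \<le> real (card (?W - ?B))"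
    using diff_card_le_card_Diff[of ?B ?W] by simp
  also have "card (?W - ?B) \<le> card (\<Union>E\<in>?G. ?S E)"
    by (intro card_mono sub finite_UN_I) auto
  also have "\<dots> \<le> (\<Sum>E\<in>?G. card (?S E))" by (intro card_UN_le) auto
  also have "real \<dots> = (\<Sum>E\<in>?G. real (card (?S E)))" by simp
  also have "\<dots> \<le> (\<Sum>E\<in>?G. exp X * (2 ^ m * fact m))"
  proof (rule sum_mono)
    fix E assume "E \<in> ?G"
    then show "real (card (?S E)) \<le> exp X * (2 ^ m * fact m)"
      using card_few_defects_within_le[of E n m s] n s by (simp add: graphs_def X_def)
  qed
  also have "\<dots> = card ?G * (exp X * (2 ^ m * fact m))" by simp
  finally have up: "real (card ?W) - real (card ?B) \<le> card ?G * (exp X * (2 ^ m * fact m))" by simp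
  have "real n ^ (2 * m) * (A - T) \<le> real (card ?W) - real (card ?B)"
    using card_occupancy_ge[OF M n(2)] card_many_defects_le[OF n(1) u, where m = m and b = "s * n"]
    unfolding A_def T_def right_diff_distrib by linarith
  then have low: "real n ^ (2 * m) * (A - T) \<le> card ?G * (exp X * (2 ^ m * fact m))" using up by linarith
  show ?thesis unfolding A_def[symmetric] T_def[symmetric] X_def[symmetric]
  \<comment> \<open>Multiplying \<open>card_graphs_le\<close> by \<open>A - T\<close> requires a
    nonnegative factor; otherwise the bound is trivial.\<close>
  proof (cases "A - T \<le> 0")
    case True
    then have "(A - T) * exp (- X) \<le> 0" by (intro mult_nonpos_nonneg) auto
    also have "0 \<le> real (card ?G) / real (card (graphs n m))" by simp
    finally show "(A - T) * exp (- X) \<le> real (card ?G) / real (card (graphs n m))" .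
  next
    case False
    have "(real (card (graphs n m)) * (2 ^ m * fact m)) * (A - T) \<le> real n ^ (2 * m) * (A - T)"
      using False by (intro mult_right_mono card_graphs_le) auto
    also note low
    finally have "(real (card (graphs n m)) * (A - T)) * (2 ^ m * fact m) \<le>
        (card ?G * exp X) * (2 ^ m * fact m)" by (simp only: mult_ac)
    then have "real (card (graphs n m)) * (A - T) \<le> card ?G * exp X"
      by (rule mult_right_le_imp_le) auto
    then show "(A - T) * exp (- X) \<le> real (card ?G) / real (card (graphs n m))"
      using Gpos by (simp add: exp_minus field_simps)
  qed
qed

lemma graph_probability_lower:
  fixes l :: "nat \<Rightarrow> nat" and c \<kappa> h b :: real
  assumes c: "0 < c" and l: "\<forall>\<^sub>F n in sequentially. 0 < l n \<and> real (l n) \<le> c * n"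
    and \<kappa>: "0 < \<kappa>"
    and M: "\<forall>\<^sub>F n in sequentially. size (M n) = n \<and> sum_mset (M n) = 2 * l n \<and>
      card (set_mset (M n)) \<le> L \<and> empirical_entropy (M n) \<le> h"
    and U: "\<forall>\<^sub>F n in sequentially. \<forall>E w. E \<in> graphs n (l n) \<longrightarrow> w \<in> pair_lists n (l n) \<longrightarrow>
      occupancy_mset n (endpoints w) = M n \<longrightarrow>
      real (card {i \<in> {1..n}. card {e \<in> E. i \<in> e} \<noteq> count_list (endpoints w) i}) \<le> \<kappa> * n \<longrightarrow>
      degree_mset n E \<in> U n"
    and b: "b < - h"
  shows "\<forall>\<^sub>F n in sequentially.
    exp (n * b) \<le> card {E \<in> graphs n (l n). degree_mset n E \<in> U n} / card (graphs n (l n))"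
proof -
  \<comment> \<open>Half of the gap: one \<open>\<epsilon>\<close> pays for the error of the type
    count and for the factor 2 lost to discarded lists, the other for the multiplicity.\<close>
  define \<epsilon> where "\<epsilon> = (- h - b) / 2"
  have \<epsilon>: "0 < \<epsilon>" using b by (simp add: \<epsilon>_def)
  have "((\<lambda>s. (2 * s - 2 * s * ln s) + s * (c * (1 + 2 * c))) \<longlongrightarrow> 0) (at_right 0)"
    by real_asymp
  then have "\<forall>\<^sub>F s in at_right 0. (2 * s - 2 * s * ln s) + s * (c * (1 + 2 * c)) < \<epsilon>"
    using \<epsilon> by (intro order_tendstoD) auto
  moreover have "\<forall>\<^sub>F s in at_right 0. s \<in> {0<..<min 1 (\<kappa> / 4)}"
    using \<kappa> by (intro eventually_at_right_real) auto
  ultimately have "\<forall>\<^sub>F s in at_right 0. (2 * s - 2 * s * ln s) + s * (c * (1 + 2 * c)) < \<epsilon> \<and> s \<in> {0<..<min 1 (\<kappa> / 4)}"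
    by (rule eventually_conj)
  then obtain s where s\<epsilon>: "(2 * s - 2 * s * ln s) + s * (c * (1 + 2 * c)) < \<epsilon>"
    and s: "0 < s" "s \<le> 1" "4 * s \<le> \<kappa>"
    using eventually_happens'[OF trivial_limit_at_right_real] by fastforce
  \<comment> \<open>Then \<open>u * (s * n) = (\<bar>h\<bar> + 1) * n\<close>, so the discarded
    lists are rarer than \<open>exp (- (n * h))\<close> by a factor
    \<open>exp (K - n)\<close>.\<close>
  define u where "u = (\<bar>h\<bar> + 1) / s"
  have u: "0 \<le> u" using s by (simp add: u_def)
  define K where "K = exp u * (c * (1 + 2 * c))"
  have e1: "\<forall>\<^sub>F n in sequentially. exp (K - real n) \<le> exp (- (real L * (1 + ln (real n + 1)))) / 2"
    by real_asymp
  have e2: "\<forall>\<^sub>F n in sequentially. 2 * (1 + 2 * c) * real n \<le> real n ^ 2"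
    using c by real_asymp
  have e3: "\<forall>\<^sub>F n in sequentially. exp (- (real n * \<epsilon>)) \<le> exp (- (real L * (1 + ln (real n + 1)))) / 2"
    using \<epsilon> by real_asymp
  show ?thesis using l M U e1 e2 e3 eventually_gt_at_top[of 0]
  proof eventually_elim
    case (elim n)
    let ?m = "l n"
    have n: "0 < n" "0 < ?m" and m: "real ?m \<le> c * n" using elim by auto
    have "real (2 * (n + 2 * ?m)) \<le> 2 * (1 + 2 * c) * real n" using m by (simp add: algebra_simps)
    also have "\<dots> \<le> real (n ^ 2)" using elim by simp
    finally have sq: "2 * (n + 2 * ?m) \<le> n ^ 2" by (simp only: of_nat_le_iff)
    have mm: "real ?m * (n + 2 * ?m) \<le> (c * (1 + 2 * c)) * real n ^ 2"
    proof -
      have "real ?m * (n + 2 * ?m) \<le> (c * n) * ((1 + 2 * c) * n)"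
        using m c by (intro mult_mono) (auto simp: algebra_simps)
      then show ?thesis by (simp add: power2_eq_square mult_ac)
    qed
    have t1: "exp u * ?m * (n + 2 * ?m) / real n ^ 2 \<le> K"
    proof -
      have "exp u * (real ?m * (n + 2 * ?m)) \<le> exp u * ((c * (1 + 2 * c)) * real n ^ 2)"
        using mm by (intro mult_left_mono) auto
      then show ?thesis using n by (simp add: divide_le_eq K_def mult_ac)
    qed
    have us: "u * (s * n) = (\<bar>h\<bar> + 1) * n" using s by (simp add: u_def)
    have t2: "s * ?m * (n + 2 * ?m) / n \<le> n * (s * (c * (1 + 2 * c)))"
    proof -
      have "s * (real ?m * (n + 2 * ?m)) \<le> s * ((c * (1 + 2 * c)) * real n ^ 2)"
        using mm s by (intro mult_left_mono) auto
      then show ?thesis using n by (simp add: divide_le_eq power2_eq_square mult_ac)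
    qed
    let ?LL = "exp (- (real L * (1 + ln (real n + 1))))"
    have nh: "real n * empirical_entropy (M n) \<le> n * h" using elim by (intro mult_left_mono) auto
    have setL: "real (card (set_mset (M n))) * (1 + ln (real n + 1)) \<le> real L * (1 + ln (real n + 1))"
      using elim by (intro mult_right_mono) auto
    have A: "exp (- (n * h)) * ?LL \<le> exp (- real n * empirical_entropy (M n) - card (set_mset (M n)) * (1 + ln (real n + 1)))"
      unfolding exp_add[symmetric] exp_le_cancel_iff using nh setL by linarith
    have T: "exp (exp u * ?m * (n + 2 * ?m) / real n ^ 2 - u * (s * n)) \<le> exp (- (n * h)) * (?LL / 2)"
    proof -
      have "h * n \<le> \<bar>h\<bar> * n" by (intro mult_right_mono) auto
      then have "exp (exp u * ?m * (n + 2 * ?m) / real n ^ 2 - u * (s * n)) \<le> exp (- (n * h) + (K - n))"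
        unfolding us exp_le_cancel_iff using t1 by (simp add: algebra_simps)
      also have "\<dots> = exp (- (n * h)) * exp (K - n)" by (rule exp_add)
      also have "\<dots> \<le> exp (- (n * h)) * (?LL / 2)" using elim by (intro mult_left_mono) auto
      finally show ?thesis .
    qed
    have AT: "exp (- (n * h)) * (?LL / 2) \<le> exp (- real n * empirical_entropy (M n) - card (set_mset (M n)) * (1 + ln (real n + 1)))
      - exp (exp u * ?m * (n + 2 * ?m) / real n ^ 2 - u * (s * n))" using A T by linarith
    have X: "n * (2 * s - 2 * s * ln s) + s * ?m * (n + 2 * ?m) / n \<le> n * \<epsilon>"
    proof -
      have "n * ((2 * s - 2 * s * ln s) + s * (c * (1 + 2 * c))) \<le> n * \<epsilon>"
        using s\<epsilon> by (intro mult_left_mono) auto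
      then show ?thesis using t2 by (simp only: distrib_left)
    qed
    have "n * b = - (n * h) - n * \<epsilon> - n * \<epsilon>" by (simp add: \<epsilon>_def field_simps)
    then have "exp (n * b) = exp (- (n * h)) * exp (- (n * \<epsilon>)) * exp (- (n * \<epsilon>))"
      by (simp add: exp_add[symmetric])
    also have "\<dots> \<le> exp (- (n * h)) * (?LL / 2) * exp (- (n * (2 * s - 2 * s * ln s) + s * ?m * (n + 2 * ?m) / n))"
      using elim X by (intro mult_mono) auto
    also have "\<dots> \<le> (exp (- real n * empirical_entropy (M n) - card (set_mset (M n)) * (1 + ln (real n + 1)))
      - exp (exp u * ?m * (n + 2 * ?m) / real n ^ 2 - u * (s * n)))
      * exp (- (n * (2 * s - 2 * s * ln s) + s * ?m * (n + 2 * ?m) / n))"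
      by (intro mult_right_mono AT) auto
    also have "\<dots> \<le> card {E \<in> graphs n ?m. degree_mset n E \<in> U n} / card (graphs n ?m)"
    proof (rule graph_probability_ge)
      fix E w assume *: "E \<in> graphs n ?m" "w \<in> pair_lists n ?m" "occupancy_mset n (endpoints w) = M n"
        "real (card {i \<in> {1..n}. card {e \<in> E. i \<in> e} \<noteq> count_list (endpoints w) i}) \<le> 4 * (s * n)"
      have "4 * (s * n) \<le> \<kappa> * n" using s by (simp add: mult_right_mono flip: mult.assoc)
      then show "degree_mset n E \<in> U n"
        using elim(3)[rule_format, OF *(1,2,3) order_trans[OF *(4)]] by blast
    qed (use n sq s u elim in auto)
    finally show ?case .
  qed
qed

section \<open>Approximation by empirical distributions\<close>

text \<open>Convexity in the first argument: tangents at the mixture are evaluated at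
  \<open>x\<close> and at \<open>q\<close>, where the term vanishes.\<close>

lemma entropy_term_mixture_le:
  assumes x: "0 \<le> x" and q: "0 < q" and t: "0 < t" "t \<le> 1"
  shows "entropy_term ((1 - t) * x + t * q) q \<le> (1 - t) * entropy_term x q"
proof -
  define u where "u = (1 - t) * x + t * q"
  have u: "0 < u" unfolding u_def using assms by (intro add_nonneg_pos mult_nonneg_nonneg mult_pos_pos) auto
  have tangent: "entropy_term u q + (y - u) * ln (u / q) \<le> entropy_term y q" if "0 \<le> y" for y
  proof (cases "y = 0")
    case True
    then show ?thesis using u q by (simp add: entropy_term_def algebra_simps)
  next
    case False
    with that have "y > 0" by simp
    have "0 \<le> entropy_term y u" using u that by (intro entropy_term_nonneg) auto
    then show ?thesis using u q \<open>y > 0\<close> by (simp add: entropy_term_def ln_div algebra_simps)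
  qed
  have "(1 - t) * (entropy_term u q + (x - u) * ln (u / q)) \<le> (1 - t) * entropy_term x q"
    using t by (intro mult_left_mono tangent x) auto
  moreover have "t * (entropy_term u q + (q - u) * ln (u / q)) \<le> t * entropy_term q q"
    using t q by (intro mult_left_mono tangent) auto
  moreover have "entropy_term q q = 0" using q by (simp add: entropy_term_def)
  moreover have "(1 - t) * (entropy_term u q + (x - u) * ln (u / q)) + t * (entropy_term u q + (q - u) * ln (u / q))
      = entropy_term u q + ((1 - t) * x + t * q - u) * ln (u / q)"
    by (simp add: algebra_simps)
  ultimately show ?thesis by (simp add: u_def)
qed

lemma poisson_mean_sums:
  assumes "0 < c"
  shows "(\<lambda>r. real r * pmf (poisson_pmf c) r) sums c"
proof -
  have "(\<lambda>r. c ^ r / fact r) sums exp c"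
    using exp_converges[of c] by (simp add: field_simps)
  then have "(\<lambda>r. c * exp (- c) * (c ^ r / fact r)) sums (c * exp (- c) * exp c)"
    by (rule sums_mult)
  moreover have "c * exp (- c) * (c ^ r / fact r) = real (Suc r) * pmf (poisson_pmf c) (Suc r)" for r
  proof -
    have "real (Suc r) * (c ^ Suc r / fact (Suc r) * exp (- c)) = c ^ Suc r / fact r * exp (- c)"
      by (simp add: fact_Suc del: of_nat_Suc)
    then show ?thesis using assms by simp
  qed
  ultimately have "(\<lambda>r. real (Suc r) * pmf (poisson_pmf c) (Suc r)) sums (c * exp (- c) * exp c)"
    by (simp only:)
  moreover have "c * exp (- c) * exp c = c" by (simp add: exp_minus)
  ultimately have "(\<lambda>r. real (Suc r) * pmf (poisson_pmf c) (Suc r)) sums c" by (simp only:)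
  then show ?thesis by (subst (asm) sums_Suc_iff) simp
qed

lemma tendsto_nat_floor_div:
  fixes x :: real
  assumes "0 \<le> x"
  shows "(\<lambda>n. real (nat \<lfloor>real n * x\<rfloor>) / real n) \<longlonglongrightarrow> x"
proof (rule tendsto_sandwich)
  show "\<forall>\<^sub>F n in sequentially. x - 1 / real n \<le> real (nat \<lfloor>real n * x\<rfloor>) / real n"
    using eventually_gt_at_top[of 0]
  proof eventually_elim
    case (elim n)
    have "real n * x - 1 \<le> real (nat \<lfloor>real n * x\<rfloor>)" using assms by linarith
    then have "(real n * x - 1) / n \<le> real (nat \<lfloor>real n * x\<rfloor>) / n" by (intro divide_right_mono) auto
    then show ?case using elim by (simp add: diff_divide_distrib)
  qed
  show "\<forall>\<^sub>F n in sequentially. real (nat \<lfloor>real n * x\<rfloor>) / real n \<le> x"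
    using eventually_gt_at_top[of 0]
  proof eventually_elim
    case (elim n)
    have "real (nat \<lfloor>real n * x\<rfloor>) \<le> real n * x" using assms by simp
    then show ?case using elim by (simp add: divide_le_eq mult.commute)
  qed
  show "(\<lambda>n. x - 1 / real n) \<longlonglongrightarrow> x" by real_asymp
qed simp

lemma atMost_split_0_1:
  fixes f :: "nat \<Rightarrow> 'a :: comm_monoid_add"
  assumes "1 \<le> L"
  shows "(\<Sum>r\<le>L. f r) = f 0 + f 1 + (\<Sum>r=2..L. f r)"
proof -
  have "{..L} = insert 0 (insert 1 {2..L})" using assms by auto
  then show ?thesis by (simp add: add.assoc)
qed

text \<open>Rounding \<open>n * p r\<close> down for \<open>r \<ge> 2\<close> and then solving the two linear constraints for the
  counts at \<open>1\<close> and \<open>0\<close> gives degree counts with the exact number of nodes and the exact degree sum.\<close>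

lemma rounded_counts:
  fixes p :: "nat \<Rightarrow> real" and N :: "nat \<Rightarrow> nat"
  assumes p: "\<And>r. 0 \<le> p r" "0 < p 0" "0 < p 1" and L: "1 \<le> L"
    and p1: "(\<Sum>r\<le>L. p r) = 1" and pc: "(\<Sum>r\<le>L. real r * p r) = c"
    and N: "(\<lambda>n. real (N n) / real n) \<longlonglongrightarrow> c"
  obtains f :: "nat \<Rightarrow> nat \<Rightarrow> nat" where
    "\<And>r. r \<le> L \<Longrightarrow> (\<lambda>n. real (f n r) / real n) \<longlonglongrightarrow> p r"
    "\<forall>\<^sub>F n in sequentially. (\<Sum>r\<le>L. f n r) = n \<and> (\<Sum>r\<le>L. r * f n r) = N n"
proof -
  define g where "g n r = nat \<lfloor>real n * p r\<rfloor>" for n r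
  have g: "(\<lambda>n. real (g n r) / real n) \<longlonglongrightarrow> p r" for r
    unfolding g_def by (rule tendsto_nat_floor_div) (rule p)
  define S where "S n = (\<Sum>r=2..L. r * g n r)" for n
  define T where "T n = (\<Sum>r=2..L. g n r)" for n
  have S: "(\<lambda>n. real (S n) / real n) \<longlonglongrightarrow> (\<Sum>r=2..L. real r * p r)"
  proof -
    have "(\<lambda>n. \<Sum>r=2..L. real r * (real (g n r) / real n)) \<longlonglongrightarrow> (\<Sum>r=2..L. real r * p r)"
      by (intro tendsto_intros g)
    then show ?thesis by (simp add: S_def sum_divide_distrib)
  qed
  have T: "(\<lambda>n. real (T n) / real n) \<longlonglongrightarrow> (\<Sum>r=2..L. p r)"
  proof -
    have "(\<lambda>n. \<Sum>r=2..L. real (g n r) / real n) \<longlonglongrightarrow> (\<Sum>r=2..L. p r)" by (intro tendsto_intros g)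
    then show ?thesis by (simp add: T_def sum_divide_distrib)
  qed
  have q1: "c - (\<Sum>r=2..L. real r * p r) = p 1" using atMost_split_0_1[OF L, of "\<lambda>r. real r * p r"] pc by simp
  have q0: "1 - (p 1 + (\<Sum>r=2..L. p r)) = p 0" using atMost_split_0_1[OF L, of p] p1 by simp
  have lim1: "(\<lambda>n. real (N n) / n - real (S n) / n) \<longlonglongrightarrow> p 1"
    unfolding q1[symmetric] by (intro tendsto_intros N S)
  \<comment> \<open>Since \<open>p 1\<close> and \<open>p 0\<close> are positive, the natural
    subtractions defining the counts at 1 and 0 are eventually not truncated.\<close>
  have ev1: "\<forall>\<^sub>F n in sequentially. S n \<le> N n"
    using order_tendstoD(1)[OF lim1 p(3)] eventually_gt_at_top[of 0]
    by eventually_elim (simp add: divide_less_cancel)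
  have lim1': "(\<lambda>n. real (N n - S n) / n) \<longlonglongrightarrow> p 1"
    by (rule Lim_transform_eventually[OF lim1]) (use ev1 in eventually_elim, simp add: of_nat_diff diff_divide_distrib)
  have lim0: "(\<lambda>n. 1 - (real (N n - S n) / n + real (T n) / n)) \<longlonglongrightarrow> p 0"
    unfolding q0[symmetric] by (intro tendsto_intros lim1' T)
  have ev0: "\<forall>\<^sub>F n in sequentially. N n - S n + T n \<le> n"
    using order_tendstoD(1)[OF lim0 p(2)] eventually_gt_at_top[of 0]
  proof eventually_elim
    case (elim n)
    then have "real (N n - S n + T n) / n < 1" by (simp add: add_divide_distrib)
    then have "real (N n - S n + T n) < real n" using elim by (simp add: divide_less_eq)
    then show ?case by linarith
  qed
  have lim0': "(\<lambda>n. real (n - (N n - S n + T n)) / n) \<longlonglongrightarrow> p 0"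
  proof (rule Lim_transform_eventually[OF lim0])
    show "\<forall>\<^sub>F n in sequentially. 1 - (real (N n - S n) / n + real (T n) / n) = real (n - (N n - S n + T n)) / n"
      using ev0 eventually_gt_at_top[of 0]
    proof eventually_elim
      case (elim n)
      have "real (n - (N n - S n + T n)) = real n - (real (N n - S n) + real (T n))"
        using elim by (simp only: of_nat_diff of_nat_add)
      then show ?case using elim by (simp add: diff_divide_distrib add_divide_distrib)
    qed
  qed
  define f where "f n r = (if r = 0 then n - (N n - S n + T n) else if r = 1 then N n - S n else g n r)" for n r
  show ?thesis
  proof
    fix r assume "r \<le> L"
    show "(\<lambda>n. real (f n r) / real n) \<longlonglongrightarrow> p r"
      using lim0' lim1' g[of r] by (cases "r = 0"; cases "r = 1") (simp_all add: f_def)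
  next
    show "\<forall>\<^sub>F n in sequentially. (\<Sum>r\<le>L. f n r) = n \<and> (\<Sum>r\<le>L. r * f n r) = N n"
      using ev0 ev1
    proof eventually_elim
      case (elim n)
      have "(\<Sum>r=2..L. f n r) = T n" "(\<Sum>r=2..L. r * f n r) = S n"
        unfolding T_def S_def by (auto intro!: sum.cong simp: f_def)
      then show ?case using elim unfolding atMost_split_0_1[OF L] by (simp add: f_def)
    qed
  qed
qed

lemma multiset_of_counts:
  fixes f :: "nat \<Rightarrow> nat"
  obtains M where "\<And>r. count M r = (if r \<le> L then f r else 0)" "size M = (\<Sum>r\<le>L. f r)"
    "sum_mset M = (\<Sum>r\<le>L. r * f r)" "set_mset M \<subseteq> {..L}"
proof -
  define M where "M = (\<Sum>r\<in>{..L}. replicate_mset (f r) r)"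
  have cM: "count M r = (if r \<le> L then f r else 0)" for r
  proof -
    have "count M r = (\<Sum>j\<in>{..L}. if j = r then f j else 0)"
      unfolding M_def count_sum by (intro sum.cong) auto
    then show ?thesis by (subst (asm) sum.delta) auto
  qed
  show ?thesis
  proof
    show "count M r = (if r \<le> L then f r else 0)" for r by (rule cM)
    show sub: "set_mset M \<subseteq> {..L}"
    proof
      fix r assume "r \<in># M"
      then have "count M r \<noteq> 0" by simp
      then show "r \<in> {..L}" unfolding cM by (auto split: if_splits)
    qed
    have "size M = (\<Sum>r\<in>set_mset M. count M r)" by (simp add: size_multiset_overloaded_eq)
    also have "\<dots> = (\<Sum>r\<le>L. count M r)"
      using sub by (intro sum.mono_neutral_left) (auto simp: not_in_iff)
    finally show "size M = (\<Sum>r\<le>L. f r)" by (simp add: cM)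
    have "sum_mset M = (\<Sum>r\<in>set_mset M. count M r * r)"
      using sum_mset_conv_sum_count[of "\<lambda>x. x" M] by simp
    also have "\<dots> = (\<Sum>r\<le>L. count M r * r)"
      using sub by (intro sum.mono_neutral_left) (auto simp: not_in_iff)
    finally show "sum_mset M = (\<Sum>r\<le>L. r * f r)" by (simp add: cM mult.commute)
  qed
qed

text \<open>Mixing with the Poisson distribution keeps the mean and makes the masses at \<open>0\<close> and \<open>1\<close>
  positive, so that these two can absorb the mass and the mean cut off by truncation.\<close>

lemma truncated_approximation:
  fixes \<delta> :: "nat pmf"
  assumes c: "0 < c" and mean: "(\<lambda>r. real r * pmf \<delta> r) sums c"
    and bound: "\<And>K. (\<Sum>r<K. entropy_term (pmf \<delta> r) (pmf (poisson_pmf c) r)) \<le> a"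
    and e: "0 < e"
  obtains p :: "nat \<Rightarrow> real" and L where "1 \<le> L" "\<And>r. 0 \<le> p r" "0 < p 0" "0 < p 1"
    "(\<Sum>r\<le>L. p r) = 1" "(\<Sum>r\<le>L. real r * p r) = c"
    "(\<Sum>r\<le>L. p r * ln (p r / pmf (poisson_pmf c) r)) < a + e"
    "2 * (\<Sum>r\<le>L. \<bar>pmf \<delta> r - p r\<bar>) + 2 - 2 * (\<Sum>r\<le>L. pmf \<delta> r) < e"
proof -
  define q where "q = pmf (poisson_pmf c)"
  let ?h = "\<lambda>x r. entropy_term x (q r)"
  note bound = bound[folded q_def]
  have q: "0 < q r" for r unfolding q_def using c by simp
  have q_sums: "q sums 1" unfolding q_def by (rule sums_pmf_nat)
  have q_sum_le: "(\<Sum>r<K. q r) \<le> 1" for K unfolding q_def by (rule sum_pmf_lessThan_le_1)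
  have q_mean: "(\<lambda>r. real r * q r) sums c" unfolding q_def by (rule poisson_mean_sums[OF c])
  have a: "0 \<le> a" using bound[of 0] by simp
  \<comment> \<open>Mixing moves at most \<open>2 * t \<le> e / 8\<close> in l1 distance.\<close>
  define t where "t = min 1 (e / 16)"
  have t: "0 < t" "t \<le> 1" "t \<le> e / 16" using e by (auto simp: t_def)
  define u where "u r = (1 - t) * pmf \<delta> r + t * q r" for r
  have u: "0 < u r" for r
    unfolding u_def using t q by (intro add_nonneg_pos mult_nonneg_nonneg mult_pos_pos) auto
  have u_sums: "u sums 1"
    unfolding u_def using sums_add[OF sums_mult[OF sums_pmf_nat[of \<delta>], of "1 - t"] sums_mult[OF q_sums, of t]]
    by simp
  have u_mean: "(\<lambda>r. real r * u r) sums c"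
    unfolding u_def using sums_add[OF sums_mult[OF mean, of "1 - t"] sums_mult[OF q_mean, of t]]
    by (simp add: algebra_simps)
  have u_bound: "(\<Sum>r<K. ?h (u r) r) \<le> a" for K
  proof -
    have "(\<Sum>r<K. ?h (u r) r) \<le> (\<Sum>r<K. (1 - t) * ?h (pmf \<delta> r) r)"
      unfolding u_def using t by (intro sum_mono entropy_term_mixture_le q) auto
    also have "\<dots> = (1 - t) * (\<Sum>r<K. ?h (pmf \<delta> r) r)" by (simp add: sum_distrib_left)
    also have "\<dots> \<le> (1 - t) * a" using t by (intro mult_left_mono bound) auto
    also have "\<dots> \<le> a" using t a by (simp add: mult_left_le_one_le)
    finally show ?thesis .
  qed
  have u_dist: "(\<Sum>r\<le>L. \<bar>pmf \<delta> r - u r\<bar>) \<le> 2 * t" for L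
  proof -
    have "(\<Sum>r\<le>L. \<bar>pmf \<delta> r - u r\<bar>) \<le> (\<Sum>r\<le>L. t * (pmf \<delta> r + q r))"
    proof (rule sum_mono)
      fix r
      have "pmf \<delta> r - u r = t * (pmf \<delta> r - q r)" by (simp add: u_def algebra_simps)
      then have "\<bar>pmf \<delta> r - u r\<bar> = t * \<bar>pmf \<delta> r - q r\<bar>" using t by (simp add: abs_mult)
      also have "\<dots> \<le> t * (pmf \<delta> r + q r)"
        using t q[of r] pmf_nonneg[of \<delta> r] by (intro mult_left_mono) (auto simp: abs_le_iff intro: add_increasing add_increasing2)
      finally show "\<bar>pmf \<delta> r - u r\<bar> \<le> t * (pmf \<delta> r + q r)" .
    qed
    also have "\<dots> = t * ((\<Sum>r\<le>L. pmf \<delta> r) + (\<Sum>r\<le>L. q r))"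
      by (simp only: sum_distrib_left[symmetric] sum.distrib)
    also have "\<dots> \<le> t * (1 + 1)"
      using t sum_pmf_lessThan_le_1[of \<delta> "Suc L"] q_sum_le[of "Suc L"]
      by (intro mult_left_mono add_mono) (auto simp: lessThan_Suc_atMost)
    finally show ?thesis by simp
  qed
  \<comment> \<open>\<open>P1\<close> restores the mean of the sequence cut off after
    \<open>L\<close>, and \<open>P0\<close> then restores its total mass.\<close>
  define P1 where "P1 L = c - (\<Sum>r=2..L. real r * u r)" for L
  define P0 where "P0 L = 1 - P1 L - (\<Sum>r=2..L. u r)" for L
  have pl: "(\<lambda>L. \<Sum>r\<le>L. f r) \<longlonglongrightarrow> x" if "f sums x" for f :: "nat \<Rightarrow> real" and x
    using that by (simp add: sums_def_le)
  have P1: "P1 \<longlonglongrightarrow> u 1"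
  proof (rule Lim_transform_eventually)
    have "(\<lambda>L. c - ((\<Sum>r\<le>L. real r * u r) - u 1)) \<longlonglongrightarrow> c - (c - u 1)"
      by (intro tendsto_diff tendsto_const pl[OF u_mean])
    then show "(\<lambda>L. c - ((\<Sum>r\<le>L. real r * u r) - u 1)) \<longlonglongrightarrow> u 1" by simp
    show "\<forall>\<^sub>F L in sequentially. c - ((\<Sum>r\<le>L. real r * u r) - u 1) = P1 L"
      using eventually_ge_at_top[of 1] by eventually_elim (simp add: P1_def atMost_split_0_1)
  qed
  have P0: "P0 \<longlonglongrightarrow> u 0"
  proof (rule Lim_transform_eventually)
    have "(\<lambda>L. 1 - P1 L - ((\<Sum>r\<le>L. u r) - u 0 - u 1)) \<longlonglongrightarrow> 1 - u 1 - (1 - u 0 - u 1)"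
      by (intro tendsto_diff tendsto_const pl[OF u_sums] P1)
    then show "(\<lambda>L. 1 - P1 L - ((\<Sum>r\<le>L. u r) - u 0 - u 1)) \<longlonglongrightarrow> u 0" by simp
    show "\<forall>\<^sub>F L in sequentially. 1 - P1 L - ((\<Sum>r\<le>L. u r) - u 0 - u 1) = P0 L"
      using eventually_ge_at_top[of 1] by eventually_elim (simp add: P0_def atMost_split_0_1)
  qed
  \<comment> \<open>\<open>P L\<close> is only eventually positive, whereas
    \<open>tendsto_entropy_term\<close> asks for nonnegativity throughout; \<open>max 0\<close>
    bridges this.\<close>
  have et: "((\<lambda>L. ?h (max 0 (P L)) r) \<longlonglongrightarrow> ?h (u r) r)" if "P \<longlonglongrightarrow> u r" for P :: "nat \<Rightarrow> real" and r
  proof (rule tendsto_entropy_term)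
    show "(\<lambda>L. max 0 (P L)) \<longlonglongrightarrow> u r"
      using tendsto_max[OF tendsto_const[of 0] that] u[of r] by simp
  qed (use u[of r] q in auto)
  have "\<forall>\<^sub>F L in sequentially. 1 \<le> L \<and> 0 < P0 L \<and> 0 < P1 L
      \<and> ?h (max 0 (P0 L)) 0 < ?h (u 0) 0 + e / 4 \<and> ?h (max 0 (P1 L)) 1 < ?h (u 1) 1 + e / 4
      \<and> 1 - e / 4 < (\<Sum>r\<le>L. q r) \<and> 1 - e / 8 < (\<Sum>r\<le>L. pmf \<delta> r)
      \<and> dist (P0 L) (u 0) < e / 16 \<and> dist (P1 L) (u 1) < e / 16"
  proof (intro eventually_conj)
    show "\<forall>\<^sub>F L in sequentially. 0 < P0 L" "\<forall>\<^sub>F L in sequentially. 0 < P1 L"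
      using order_tendstoD(1)[OF P0 u] order_tendstoD(1)[OF P1 u] .
    show "\<forall>\<^sub>F L in sequentially. ?h (max 0 (P0 L)) 0 < ?h (u 0) 0 + e / 4"
      using e by (intro order_tendstoD(2)[OF et[OF P0]]) simp
    show "\<forall>\<^sub>F L in sequentially. ?h (max 0 (P1 L)) 1 < ?h (u 1) 1 + e / 4"
      using e by (intro order_tendstoD(2)[OF et[OF P1]]) simp
    show "\<forall>\<^sub>F L in sequentially. 1 - e / 4 < (\<Sum>r\<le>L. q r)"
      using e by (intro order_tendstoD(1)[OF pl[OF q_sums]]) simp
    show "\<forall>\<^sub>F L in sequentially. 1 - e / 8 < (\<Sum>r\<le>L. pmf \<delta> r)"
      using e by (intro order_tendstoD(1)[OF pl[OF sums_pmf_nat]]) simp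
    show "\<forall>\<^sub>F L in sequentially. dist (P0 L) (u 0) < e / 16" "\<forall>\<^sub>F L in sequentially. dist (P1 L) (u 1) < e / 16"
      using e tendstoD[OF P0, of "e / 16"] tendstoD[OF P1, of "e / 16"] by auto
  qed (rule eventually_ge_at_top)
  then obtain L where L: "1 \<le> L" and P: "0 < P0 L" "0 < P1 L"
    and h: "?h (P0 L) 0 < ?h (u 0) 0 + e / 4" "?h (P1 L) 1 < ?h (u 1) 1 + e / 4"
    and tails: "1 - e / 4 < (\<Sum>r\<le>L. q r)" "1 - e / 8 < (\<Sum>r\<le>L. pmf \<delta> r)"
    and d: "\<bar>P0 L - u 0\<bar> < e / 16" "\<bar>P1 L - u 1\<bar> < e / 16"
    by (auto simp: eventually_sequentially dist_real_def max_def split: if_splits)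
  define p where "p r = (if r = 0 then P0 L else if r = 1 then P1 L else u r)" for r
  have p2: "(\<Sum>r=2..L. g r (p r)) = (\<Sum>r=2..L. g r (u r))" for g :: "nat \<Rightarrow> real \<Rightarrow> real"
    by (intro sum.cong) (auto simp: p_def)
  have p01: "p 0 = P0 L" "p 1 = P1 L" by (auto simp: p_def)
  have p_nn: "0 \<le> p r" for r using P u[of r] by (auto simp: p_def less_imp_le)
  have p_sum: "(\<Sum>r\<le>L. p r) = 1"
    unfolding atMost_split_0_1[OF L] p01 p2[of "\<lambda>_ x. x"] by (simp add: P0_def)
  show ?thesis
  proof (rule that[OF L p_nn])
    show "0 < p 0" "0 < p 1" using P by (simp_all only: p01)
    show "(\<Sum>r\<le>L. p r) = 1" by (rule p_sum)
    show "(\<Sum>r\<le>L. real r * p r) = c"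
      unfolding atMost_split_0_1[OF L] p01 p2[of "\<lambda>r x. real r * x"] by (simp add: P1_def)
    have "(\<Sum>r\<le>L. p r * ln (p r / q r)) = (\<Sum>r\<le>L. ?h (p r) r) + (\<Sum>r\<le>L. p r) - (\<Sum>r\<le>L. q r)"
      unfolding entropy_term_def by (simp add: sum.distrib sum_subtractf)
    also have "(\<Sum>r\<le>L. ?h (p r) r) \<le> (\<Sum>r\<le>L. ?h (u r) r) + e / 2"
      unfolding atMost_split_0_1[OF L] p01 p2[of "\<lambda>r x. ?h x r"] using h by simp
    also have "(\<Sum>r\<le>L. ?h (u r) r) \<le> a" using u_bound[of "Suc L"] by (simp only: lessThan_Suc_atMost)
    finally show "(\<Sum>r\<le>L. p r * ln (p r / pmf (poisson_pmf c) r)) < a + e"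
      unfolding q_def[symmetric] using p_sum tails(1) e by linarith
    have "(\<Sum>r\<le>L. \<bar>pmf \<delta> r - p r\<bar>) \<le> (\<Sum>r\<le>L. \<bar>pmf \<delta> r - u r\<bar> + \<bar>u r - p r\<bar>)"
    proof (rule sum_mono)
      fix r show "\<bar>pmf \<delta> r - p r\<bar> \<le> \<bar>pmf \<delta> r - u r\<bar> + \<bar>u r - p r\<bar>"
        using abs_triangle_ineq[of "pmf \<delta> r - u r" "u r - p r"] by simp
    qed
    also have "\<dots> = (\<Sum>r\<le>L. \<bar>pmf \<delta> r - u r\<bar>) + (\<Sum>r\<le>L. \<bar>u r - p r\<bar>)" by (rule sum.distrib)
    also have "(\<Sum>r\<le>L. \<bar>u r - p r\<bar>) = \<bar>u 0 - P0 L\<bar> + \<bar>u 1 - P1 L\<bar>"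
      unfolding atMost_split_0_1[OF L] p01 p2[of "\<lambda>r x. \<bar>u r - x\<bar>"] by simp
    finally have "(\<Sum>r\<le>L. \<bar>pmf \<delta> r - p r\<bar>) < 2 * t + e / 16 + e / 16"
      using u_dist[of L] d by linarith
    then show "2 * (\<Sum>r\<le>L. \<bar>pmf \<delta> r - p r\<bar>) + 2 - 2 * (\<Sum>r\<le>L. pmf \<delta> r) < e"
      using tails t by simp
  qed
qed

text \<open>The approximating types for the lower bound. Their support lies in a fixed finite set,
  so the empirical entropies, taken relative to the moving Poisson distributions, converge as finite
  sums.\<close>

lemma approximating_types:
  fixes \<delta> :: "nat pmf" and l :: "nat \<Rightarrow> nat"
  assumes c: "0 < c" and l: "(\<lambda>n. real (l n) / real n) \<longlonglongrightarrow> c / 2"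
    and mean: "(\<lambda>r. real r * pmf \<delta> r) sums c"
    and bound: "\<And>K. (\<Sum>r<K. entropy_term (pmf \<delta> r) (pmf (poisson_pmf c) r)) \<le> a"
    and e: "0 < e"
  obtains M L where "\<forall>\<^sub>F n in sequentially. size (M n) = n \<and> sum_mset (M n) = 2 * l n \<and>
      card (set_mset (M n)) \<le> L \<and> empirical_entropy (M n) \<le> a + e"
    "\<forall>\<^sub>F n in sequentially. pmf_dist \<delta> (pmf_of_multiset (M n)) < e"
proof -
  obtain p L where L: "1 \<le> L" and p: "\<And>r. 0 \<le> p r" "0 < p 0" "0 < p 1"
    "(\<Sum>r\<le>L. p r) = 1" "(\<Sum>r\<le>L. real r * p r) = c"
    and pe: "(\<Sum>r\<le>L. p r * ln (p r / pmf (poisson_pmf c) r)) < a + e"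
    and pd: "2 * (\<Sum>r\<le>L. \<bar>pmf \<delta> r - p r\<bar>) + 2 - 2 * (\<Sum>r\<le>L. pmf \<delta> r) < e"
    by (rule truncated_approximation[OF c mean bound e]) (rule that)
  have l2: "(\<lambda>n. real (2 * l n) / real n) \<longlonglongrightarrow> c"
    using tendsto_mult_left[OF l, of 2] by simp
  obtain f where f: "\<And>r. r \<le> L \<Longrightarrow> (\<lambda>n. real (f n r) / real n) \<longlonglongrightarrow> p r"
    and ev: "\<forall>\<^sub>F n in sequentially. (\<Sum>r\<le>L. f n r) = n \<and> (\<Sum>r\<le>L. r * f n r) = 2 * l n"
    by (rule rounded_counts[OF p(1,2,3) L p(4,5) l2]) (rule that)
  have "\<forall>n. \<exists>M. (\<forall>r. count M r = (if r \<le> L then f n r else 0)) \<and> size M = (\<Sum>r\<le>L. f n r) \<and>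
      sum_mset M = (\<Sum>r\<le>L. r * f n r) \<and> set_mset M \<subseteq> {..L}"
  proof
    fix n
    obtain M where "\<And>r. count M r = (if r \<le> L then f n r else 0)" "size M = (\<Sum>r\<le>L. f n r)"
      "sum_mset M = (\<Sum>r\<le>L. r * f n r)" "set_mset M \<subseteq> {..L}"
      by (rule multiset_of_counts[where f = "f n" and L = L]) (rule that)
    then show "\<exists>M. (\<forall>r. count M r = (if r \<le> L then f n r else 0)) \<and> size M = (\<Sum>r\<le>L. f n r) \<and>
      sum_mset M = (\<Sum>r\<le>L. r * f n r) \<and> set_mset M \<subseteq> {..L}" by blast
  qed
  from choice[OF this] obtain M where
    M: "\<And>n r. count (M n) r = (if r \<le> L then f n r else 0)"
    "\<And>n. size (M n) = (\<Sum>r\<le>L. f n r)" "\<And>n. sum_mset (M n) = (\<Sum>r\<le>L. r * f n r)"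
    "\<And>n. set_mset (M n) \<subseteq> {..L}" by blast
  have lpos: "\<forall>\<^sub>F n in sequentially. 0 < l n"
    using order_tendstoD(1)[OF l2 c] by eventually_elim (auto simp: zero_less_divide_iff)
  \<comment> \<open>The default 1 keeps \<open>q n r\<close> positive for all \<open>n\<close>, also
    where the Poisson mean would be 0.\<close>
  define q where "q n r = (if 0 < l n \<and> 0 < n then pmf (poisson_pmf (real (2 * l n) / real n)) r else 1)" for n r
  have qpos: "0 < q n r" for n r by (simp add: q_def)
  have q: "(\<lambda>n. q n r) \<longlonglongrightarrow> pmf (poisson_pmf c) r" for r
  proof (rule Lim_transform_eventually)
    have "(\<lambda>n. (real (2 * l n) / real n) ^ r / fact r * exp (- (real (2 * l n) / real n))) \<longlonglongrightarrow> c ^ r / fact r * exp (- c)"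
      by (intro tendsto_intros l2) auto
    then show "(\<lambda>n. (real (2 * l n) / real n) ^ r / fact r * exp (- (real (2 * l n) / real n))) \<longlonglongrightarrow> pmf (poisson_pmf c) r"
      using c by simp
    show "\<forall>\<^sub>F n in sequentially. (real (2 * l n) / real n) ^ r / fact r * exp (- (real (2 * l n) / real n)) = q n r"
      using lpos eventually_gt_at_top[of 0] by eventually_elim (simp add: q_def)
  qed
  have lim: "(\<lambda>n. \<Sum>r\<le>L. real (f n r) / n * ln (real (f n r) / n / q n r)) \<longlonglongrightarrow>
      (\<Sum>r\<le>L. p r * ln (p r / pmf (poisson_pmf c) r))"
  proof (rule tendsto_sum)
    fix r assume r: "r \<in> {..L}"
    have "(\<lambda>n. entropy_term (real (f n r) / n) (q n r) + real (f n r) / n - q n r) \<longlonglongrightarrow>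
        entropy_term (p r) (pmf (poisson_pmf c) r) + p r - pmf (poisson_pmf c) r"
      using r c by (intro tendsto_diff tendsto_add tendsto_entropy_term f q p qpos) auto
    then show "(\<lambda>n. real (f n r) / n * ln (real (f n r) / n / q n r)) \<longlonglongrightarrow> p r * ln (p r / pmf (poisson_pmf c) r)"
      by (simp add: entropy_term_def)
  qed
  have "\<forall>\<^sub>F n in sequentially. (\<Sum>r\<le>L. real (f n r) / n * ln (real (f n r) / n / q n r)) < a + e"
    using pe by (rule order_tendstoD(2)[OF lim])
  then have 1: "\<forall>\<^sub>F n in sequentially. size (M n) = n \<and> sum_mset (M n) = 2 * l n \<and>
      card (set_mset (M n)) \<le> Suc L \<and> empirical_entropy (M n) \<le> a + e"
    using ev lpos eventually_gt_at_top[of 0]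
  proof eventually_elim
    case (elim n)
    have sz: "size (M n) = n" "sum_mset (M n) = 2 * l n" using elim M by auto
    have "empirical_entropy (M n) = (\<Sum>r\<in>set_mset (M n). real (count (M n) r) / n *
        ln (real (count (M n) r) / n / q n r))"
      unfolding empirical_entropy_def sz using elim by (simp add: q_def)
    also have "\<dots> = (\<Sum>r\<le>L. real (count (M n) r) / n * ln (real (count (M n) r) / n / q n r))"
      using M(4)[of n] by (intro sum.mono_neutral_left) (auto simp: not_in_iff)
    also have "\<dots> = (\<Sum>r\<le>L. real (f n r) / n * ln (real (f n r) / n / q n r))"
      by (intro sum.cong) (auto simp: M(1))
    finally have "empirical_entropy (M n) \<le> a + e" using elim by simp
    moreover have "card (set_mset (M n)) \<le> Suc L" using card_mono[OF _ M(4)[of n]] by simp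
    ultimately show ?case using sz by simp
  qed
  have "(\<lambda>n. 2 * (\<Sum>r\<le>L. \<bar>pmf \<delta> r - real (f n r) / n\<bar>) + 2 - 2 * (\<Sum>r\<le>L. pmf \<delta> r)) \<longlonglongrightarrow>
      2 * (\<Sum>r\<le>L. \<bar>pmf \<delta> r - p r\<bar>) + 2 - 2 * (\<Sum>r\<le>L. pmf \<delta> r)"
    by (intro tendsto_intros f) auto
  then have "\<forall>\<^sub>F n in sequentially. 2 * (\<Sum>r\<le>L. \<bar>pmf \<delta> r - real (f n r) / n\<bar>) + 2 - 2 * (\<Sum>r\<le>L. pmf \<delta> r) < e"
    using pd by (rule order_tendstoD(2))
  then have 2: "\<forall>\<^sub>F n in sequentially. pmf_dist \<delta> (pmf_of_multiset (M n)) < e"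
    using ev eventually_gt_at_top[of 0]
  proof eventually_elim
    case (elim n)
    have "M n \<noteq> {#}" using elim M(2)[of n] by auto
    then have "pmf (pmf_of_multiset (M n)) r = real (f n r) / n" if "r \<le> L" for r
      using that elim M by simp
    then have "(\<Sum>r<Suc L. \<bar>pmf \<delta> r - pmf (pmf_of_multiset (M n)) r\<bar>) = (\<Sum>r\<le>L. \<bar>pmf \<delta> r - real (f n r) / n\<bar>)"
      unfolding lessThan_Suc_atMost by (intro sum.cong) auto
    then show ?case
      using pmf_dist_le[of \<delta> "pmf_of_multiset (M n)" "Suc L"] elim unfolding lessThan_Suc_atMost by linarith
  qed
  show ?thesis using 1 2 by (rule that)
qed

section \<open>The large deviation principle\<close>

lemma degree_distribution_eq:
  assumes "0 < n"
  shows "degree_distribution n G = pmf_of_multiset (degree_mset n (snd G))"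
  using assms unfolding degree_distribution_def degree_mset_def node_degree_def
  by (subst map_pmf_of_set) auto

lemma graphs_nonempty:
  assumes "m \<le> n choose 2"
  shows "graphs n m \<noteq> {}"
  using assms card_graphs[of n m] by (metis binomial_eq_0_iff card.empty linorder_not_le)

text \<open>The event is a rectangle whose position side is the whole space, of mass 1.\<close>

lemma measure_random_geometric_graph:
  fixes M :: "'d::finite geometric_graph measure"
  assumes m: "m \<le> n choose 2"
  defines "M \<equiv> random_geometric_graph n m"
  shows "measure M {G \<in> space M. P (snd G)} = card {E \<in> graphs n m. P E} / card (graphs n m)"
proof -
  let ?A = "\<Pi>\<^sub>M i\<in>{1..n}. uniform_measure lborel (cbox (0 :: real ^ 'd) 1)"
  let ?B = "uniform_count_measure (graphs n m)"
  have inner_Basis: "(1 :: real ^ 'd) \<bullet> b = 1" if "b \<in> Basis" for b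
    using that by (auto simp: Basis_vec_def inner_axis)
  have vol: "emeasure lborel (cbox (0 :: real ^ 'd) 1) = 1"
    by (subst emeasure_lborel_cbox_eq) (simp add: inner_Basis)
  interpret U: prob_space "uniform_measure lborel (cbox (0 :: real ^ 'd) 1)"
    by (rule prob_space_uniform_measure) (use vol in auto)
  interpret A: prob_space ?A
    by (rule prob_space_PiM) (rule U.prob_space_axioms)
  interpret B: prob_space ?B
    using graphs_nonempty[OF m] by (intro prob_space_uniform_count_measure) auto
  have M: "M = ?A \<Otimes>\<^sub>M ?B" by (simp add: M_def random_geometric_graph_def graphs_def)
  have spB: "space ?B = graphs n m" "sets ?B = Pow (graphs n m)"
    by (simp_all add: space_uniform_count_measure sets_uniform_count_measure)
  have "{G \<in> space M. P (snd G)} = space ?A \<times> {E \<in> graphs n m. P E}"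
    unfolding M space_pair_measure spB by auto
  then have "emeasure M {G \<in> space M. P (snd G)} = emeasure ?A (space ?A) * emeasure ?B {E \<in> graphs n m. P E}"
    unfolding M using spB by (simp add: B.emeasure_pair_measure_Times)
  also have "\<dots> = emeasure ?B {E \<in> graphs n m. P E}" by (simp only: A.emeasure_space_1 mult_1)
  finally have "measure M {G \<in> space M. P (snd G)} = measure ?B {E \<in> graphs n m. P E}"
    by (simp add: measure_def)
  also have "\<dots> = card {E \<in> graphs n m. P E} / card (graphs n m)"
    by (intro measure_uniform_count_measure) auto
  finally show ?thesis .
qed

text \<open>The degrees factor through the edge set, and every set of edge sets is
  measurable.\<close>

lemma measurable_degree_distribution:
  "degree_distribution n \<in> (random_geometric_graph n m :: 'd::finite geometric_graph measure)
    \<rightarrow>\<^sub>M borel_of_topology weak_topology"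
proof -
  have "degree_distribution n = (\<lambda>E. map_pmf (\<lambda>i. card {e \<in> E. i \<in> e}) (pmf_of_set {1..n})) \<circ>
      (snd :: 'd geometric_graph \<Rightarrow> _)"
    by (auto simp: degree_distribution_def node_degree_def fun_eq_iff intro!: map_pmf_cong)
  moreover have "(\<lambda>E. map_pmf (\<lambda>i. card {e \<in> E. i \<in> e}) (pmf_of_set {1..n})) \<in>
      uniform_count_measure {E. E \<subseteq> node_pairs n \<and> card E = m} \<rightarrow>\<^sub>M borel_of_topology weak_topology"
    by (auto simp: measurable_def borel_of_topology_def sets_uniform_count_measure space_uniform_count_measure)
  ultimately show ?thesis unfolding random_geometric_graph_def
    by (simp only: measurable_comp[OF measurable_snd])
qed

text \<open>Each index with different values moves mass \<open>1 / card A\<close> from one point to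
  another, which costs twice that much in l1 distance.\<close>

lemma pmf_dist_empirical_le:
  fixes a b :: "'i \<Rightarrow> nat"
  assumes A: "finite A" "A \<noteq> {}"
  shows "pmf_dist (pmf_of_multiset (image_mset a (mset_set A))) (pmf_of_multiset (image_mset b (mset_set A)))
    \<le> 2 * card {i \<in> A. a i \<noteq> b i} / card A"
proof -
  let ?n = "real (card A)"
  have n: "?n > 0" using A by (simp add: card_gt_0_iff)
  obtain K where K: "a ` A \<union> b ` A \<subseteq> {..<K}"
    using A by (metis finite_UnI finite_imageI finite_nat_iff_bounded)
  have pmf: "pmf (pmf_of_multiset (image_mset f (mset_set A))) r = (\<Sum>i\<in>A. if f i = r then 1 else 0) / ?n"
    for f :: "'i \<Rightarrow> nat" and r
  proof -
    have "count (image_mset f (mset_set A)) r = card {i \<in> A. f i = r}"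
      using A by (simp add: count_image_mset Int_def conj_commute)
    moreover have "image_mset f (mset_set A) \<noteq> {#}" using A by (simp add: mset_set_empty_iff)
    moreover have "real (card {i \<in> A. f i = r}) = (\<Sum>i\<in>A. if f i = r then 1 else 0)"
      using A by (simp add: sum.If_cases Int_def)
    ultimately show ?thesis by simp
  qed
  have zero: "(\<Sum>i\<in>A. if f i = r then 1 else 0) = (0::real)" if "f ` A \<subseteq> {..<K}" "r \<notin> {..<K}" for f r
    using that by (intro sum.neutral) auto
  have "pmf_dist (pmf_of_multiset (image_mset a (mset_set A))) (pmf_of_multiset (image_mset b (mset_set A))) =
      (\<Sum>r<K. \<bar>(\<Sum>i\<in>A. if a i = r then 1 else 0) / ?n - (\<Sum>i\<in>A. if b i = r then 1 else 0) / ?n\<bar>)"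
    unfolding pmf_dist_def pmf using zero[of a] zero[of b] K by (intro suminf_finite) auto
  also have "\<dots> = (\<Sum>r<K. \<bar>\<Sum>i\<in>A. (if a i = r then 1 else 0) - (if b i = r then 1 else 0)\<bar>) / ?n"
  proof -
    have "\<bar>x / ?n - y / ?n\<bar> = \<bar>x - y\<bar> / ?n" for x y :: real
      using n by (simp flip: diff_divide_distrib)
    then show ?thesis by (simp only: sum_subtractf sum_divide_distrib[symmetric])
  qed
  also have "\<dots> \<le> (\<Sum>r<K. \<Sum>i\<in>A. \<bar>(if a i = r then 1 else 0) - (if b i = r then 1 else 0)\<bar>) / ?n"
    using n by (intro divide_right_mono sum_mono sum_abs) auto
  also have "\<dots> = (\<Sum>i\<in>A. \<Sum>r<K. \<bar>(if a i = r then 1 else 0) - (if b i = r then 1 else 0)\<bar>) / ?n"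
    by (subst sum.swap) (rule refl)
  also have "\<dots> \<le> (\<Sum>i\<in>A. if a i \<noteq> b i then 2 else 0) / ?n"
  proof (intro divide_right_mono sum_mono)
    fix i assume i: "i \<in> A"
    show "(\<Sum>r<K. \<bar>(if a i = r then 1 else 0) - (if b i = r then 1 else 0)\<bar>) \<le> (if a i \<noteq> b i then 2 else (0::real))"
    proof (cases "a i = b i")
      case False
      have "(\<Sum>r<K. \<bar>(if a i = r then 1 else 0) - (if b i = r then 1 else 0::real)\<bar>) \<le>
          (\<Sum>r<K. (if a i = r then 1 else 0) + (if b i = r then 1 else 0))"
        by (intro sum_mono) auto
      also have "\<dots> = 2" using K i by (simp add: sum.distrib image_subset_iff)
      finally show ?thesis using False by simp
    qed simp
  qed (use n in auto)
  also have "\<dots> = 2 * card {i \<in> A. a i \<noteq> b i} / ?n" using A by (simp add: sum.If_cases Int_def)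
  finally show ?thesis .
qed

section \<open>The rate function and its level sets\<close>

lemma rho_pos: "0 < rho d"
  by (simp add: rho_def Gamma_real_pos)

lemma pmf_mean_eq_iff:
  assumes "0 \<le> c"
  shows "pmf_mean \<delta> = ennreal c \<longleftrightarrow> (\<lambda>r. real r * pmf \<delta> r) sums c"
proof
  assume "(\<lambda>r. real r * pmf \<delta> r) sums c"
  then show "pmf_mean \<delta> = ennreal c"
    unfolding pmf_mean_def by (intro suminf_ennreal_eq) auto
next
  assume eq: "pmf_mean \<delta> = ennreal c"
  then have "(\<Sum>r. ennreal (real r * pmf \<delta> r)) \<noteq> top" by (simp add: pmf_mean_def)
  then have s: "summable (\<lambda>r. real r * pmf \<delta> r)" by (intro summable_suminf_not_top) auto
  then have "ennreal (\<Sum>r. real r * pmf \<delta> r) = ennreal c"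
    using eq by (simp add: pmf_mean_def suminf_ennreal2)
  then have "(\<Sum>r. real r * pmf \<delta> r) = c" using assms s by (subst (asm) ennreal_inj) (auto intro!: suminf_nonneg)
  with s show "(\<lambda>r. real r * pmf \<delta> r) sums c" by (simp add: sums_iff)
qed

text \<open>Brings the level sets into the form required by \<open>entropy_compactness\<close> and
  \<open>approximating_types\<close>.\<close>

lemma eta_le_iff:
  fixes d :: nat and t :: real
  assumes t: "0 < t"
  defines "c \<equiv> rho d * t"
  shows "eta d t \<delta> \<le> ereal a \<longleftrightarrow> (\<lambda>r. real r * pmf \<delta> r) sums c \<and>
    (\<forall>K. (\<Sum>r<K. entropy_term (pmf \<delta> r) (pmf (poisson_pmf c) r)) \<le> a)"
proof -
  have c: "0 < c" using t rho_pos by (simp add: c_def)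
  have q: "0 < pmf (poisson_pmf c) r" for r using c by simp
  show ?thesis
  proof (cases "pmf_mean \<delta> = ennreal c")
    case True
    then have "eta d t \<delta> = relative_entropy (measure_pmf \<delta>) (measure_pmf (poisson_pmf c))"
      using c by (simp add: eta_def c_def[symmetric])
    then show ?thesis using relative_entropy_le_iff[OF q] True pmf_mean_eq_iff[of c \<delta>] c by simp
  next
    case False
    then show ?thesis using pmf_mean_eq_iff[of c \<delta>] c by (simp add: eta_def c_def[symmetric])
  qed
qed

text \<open>The empty partial sum in \<open>eta_le_iff\<close> rules out negative upper
  bounds.\<close>

lemma eta_nonneg:
  assumes "0 < t"
  shows "0 \<le> eta d t \<delta>"
proof (rule ccontr)
  assume "\<not> 0 \<le> eta d t \<delta>"
  then obtain a where a: "eta d t \<delta> < ereal a" "ereal a < 0" using ereal_dense2 by (metis not_le)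
  then have "(\<Sum>r<0. entropy_term (pmf \<delta> r) (pmf (poisson_pmf (rho d * t)) r)) \<le> a"
    using eta_le_iff[OF assms] less_imp_le by blast
  then show False using a by simp
qed

text \<open>Sequential compactness comes from \<open>entropy_compactness\<close> with a constant
  mean; closedness follows because the space is Hausdorff.\<close>

lemma good_rate_function_eta:
  assumes t: "0 < t"
  shows "good_rate_function weak_topology (eta d t)"
proof -
  define c where "c = rho d * t"
  have c: "0 < c" using t rho_pos by (simp add: c_def)
  have comp: "compactin weak_topology {\<delta> \<in> topspace weak_topology. eta d t \<delta> \<le> ereal a}" for a
    unfolding weak_topology_eq_mtopology pmf_l1.compactin_sequentially
  proof (intro conjI allI impI)
    fix \<sigma> :: "nat \<Rightarrow> nat pmf"
    assume "range \<sigma> \<subseteq> {\<delta> \<in> topspace pmf_l1.mtopology. eta d t \<delta> \<le> ereal a}"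
    then have "eta d t (\<sigma> n) \<le> ereal a" for n by auto
    then have \<sigma>: "(\<lambda>r. real r * pmf (\<sigma> n) r) sums c"
      "(\<Sum>r<K. entropy_term (pmf (\<sigma> n) r) (pmf (poisson_pmf c) r)) \<le> a" for n K
      using eta_le_iff[OF t] unfolding c_def by blast+
    obtain s \<delta> where s: "strict_mono (s :: nat \<Rightarrow> nat)" and lim: "(\<lambda>n. pmf_dist \<delta> (\<sigma> (s n))) \<longlonglongrightarrow> 0"
      and \<delta>: "(\<lambda>r. real r * pmf \<delta> r) sums c"
      "\<And>K. (\<Sum>r<K. entropy_term (pmf \<delta> r) (pmf (poisson_pmf c) r)) \<le> a"
      by (rule entropy_compactness[of "\<lambda>_. c" c \<sigma> a]) (use c \<sigma> in auto)
    have "eta d t \<delta> \<le> ereal a" using eta_le_iff[OF t] \<delta> unfolding c_def by blast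
    moreover have "limitin pmf_l1.mtopology (\<sigma> \<circ> s) \<delta> sequentially"
      using order_tendstoD(2)[OF lim] by (simp add: pmf_l1.limitin_metric pmf_l1.commute)
    ultimately show "\<exists>l r. l \<in> {\<delta> \<in> topspace pmf_l1.mtopology. eta d t \<delta> \<le> ereal a} \<and>
        strict_mono r \<and> limitin pmf_l1.mtopology (\<sigma> \<circ> r) l sequentially"
      using s by auto
  qed auto
  have "Hausdorff_space weak_topology"
    unfolding weak_topology_eq_mtopology by (rule pmf_l1.Hausdorff_space_mtopology)
  then have "closedin weak_topology {\<delta> \<in> topspace weak_topology. eta d t \<delta> \<le> ereal a}" for a
    using comp by (rule compactin_imp_closedin)
  then show ?thesis using comp eta_nonneg[OF t] by (simp add: good_rate_function_def rate_function_def)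
qed

lemma log_prob_div_le:
  fixes n :: nat and b p :: real
  assumes "0 < n" "0 \<le> p" "p \<le> exp (n * b)"
  shows "log_prob p / ereal n \<le> ereal b"
proof (cases "p = 0")
  case False
  then have "ln p \<le> n * b" using assms ln_le_cancel_iff[of p "exp (n * b)"] by simp
  then have "ln p / n \<le> b" using assms by (simp add: divide_le_eq mult.commute)
  then show ?thesis using False assms by (simp add: log_prob_def)
qed (use assms in \<open>simp add: log_prob_def\<close>)

lemma log_prob_div_ge:
  fixes n :: nat and b p :: real
  assumes "0 < n" "exp (n * b) \<le> p"
  shows "ereal b \<le> log_prob p / ereal n"
proof -
  have p: "0 < p" using assms(2) exp_gt_zero by (rule less_le_trans[rotated])
  then have "n * b \<le> ln p" using assms by (simp add: ln_ge_iff)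
  then have "b \<le> ln p / n" using assms by (simp add: le_divide_eq mult.commute)
  then show ?thesis using p assms by (simp add: log_prob_def)
qed

lemma sums_mean_pmf_of_multiset:
  assumes "M \<noteq> {#}"
  shows "(\<lambda>r. real r * pmf (pmf_of_multiset M) r) sums (real (sum_mset M) / real (size M))"
proof -
  have "(\<lambda>r. real r * pmf (pmf_of_multiset M) r) sums (\<Sum>r\<in>set_mset M. real r * pmf (pmf_of_multiset M) r)"
    using assms by (intro sums_finite) (auto simp: not_in_iff)
  also have "(\<Sum>r\<in>set_mset M. real r * pmf (pmf_of_multiset M) r) = real (sum_mset M) / real (size M)"
    unfolding sum_mset_eq_sum_count using assms by (simp add: sum_divide_distrib)
  finally show ?thesis .
qed

text \<open>This carries the infimum over \<open>F\<close> from limits back to finite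
  \<open>n\<close>. If types in \<open>F\<close> had entropy below \<open>a\<close> for infinitely
  many \<open>n\<close>, \<open>entropy_compactness\<close> would produce a limit point in the
  closed set \<open>F\<close> with rate at most \<open>a\<close>.\<close>

lemma empirical_entropy_liminf:
  fixes l :: "nat \<Rightarrow> nat"
  assumes t: "0 < t" and l: "(\<lambda>n. real (l n) / real n) \<longlonglongrightarrow> rho d * t / 2"
    and F: "closedin weak_topology F" and a: "ereal a < (INF \<delta>\<in>F. eta d t \<delta>)"
  shows "\<forall>\<^sub>F n in sequentially. \<forall>M. pmf_of_multiset M \<in> F \<longrightarrow> size M = n \<longrightarrow> sum_mset M = 2 * l n \<longrightarrow>
    a \<le> empirical_entropy M"
proof (rule ccontr)
  define c where "c = rho d * t"
  have c: "0 < c" using t rho_pos by (simp add: c_def)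
  have l2: "(\<lambda>n. real (2 * l n) / real n) \<longlonglongrightarrow> c"
    using tendsto_mult_left[OF l, of 2] by (simp add: c_def)
  let ?bad = "\<lambda>n M. pmf_of_multiset M \<in> F \<and> size M = n \<and> sum_mset M = 2 * l n \<and> empirical_entropy M < a"
  assume "\<not> ?thesis"
  then have "\<exists>\<^sub>F n in sequentially. \<exists>M. ?bad n M"
    unfolding not_eventually by (rule frequently_elim1) (auto simp: not_le)
  \<comment> \<open>Only \<open>n\<close> with a positive degree sum are enumerated, so that every
    chosen type is nonempty and every Poisson mean positive.\<close>
  moreover have "\<forall>\<^sub>F n in sequentially. 0 < real (2 * l n) / real n" by (rule order_tendstoD(1)[OF l2 c])
  ultimately have "\<exists>\<^sub>F n in sequentially. (\<exists>M. ?bad n M) \<and> 0 < real (2 * l n) / real n"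
    by (rule frequently_eventually_frequently)
  then have "infinite {n. (\<exists>M. ?bad n M) \<and> 0 < real (2 * l n) / real n}"
    by (simp add: frequently_cofinite cofinite_eq_sequentially[symmetric])
  then obtain k where k: "strict_mono (k :: nat \<Rightarrow> nat)"
    "\<And>i. (\<exists>M. ?bad (k i) M) \<and> 0 < real (2 * l (k i)) / real (k i)"
    using infinite_enumerate by blast
  then have "\<forall>i. \<exists>M. ?bad (k i) M" by blast
  from choice[OF this] obtain M where M: "\<And>i. ?bad (k i) (M i)" by blast
  define D where "D i = pmf_of_multiset (M i)" for i
  define cs where "cs i = real (2 * l (k i)) / real (k i)" for i
  have cs: "0 < cs i" for i using k(2) by (simp add: cs_def)
  have cs_lim: "cs \<longlonglongrightarrow> c" unfolding cs_def using LIMSEQ_subseq_LIMSEQ[OF l2 k(1)] by (simp add: o_def)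
  have ne: "M i \<noteq> {#}" for i using cs[of i] M[of i] by (auto simp: cs_def)
  have pos: "0 < sum_mset (M i)" for i using cs[of i] M[of i] by (auto simp: cs_def zero_less_divide_iff)
  have mean: "(\<lambda>r. real r * pmf (D i) r) sums cs i" for i
    using sums_mean_pmf_of_multiset[OF ne[of i]] M[of i] by (simp add: D_def cs_def)
  have bound: "(\<Sum>r<K. entropy_term (pmf (D i) r) (pmf (poisson_pmf (cs i)) r)) \<le> a" for i K
    using sum_entropy_term_le_empirical_entropy[OF ne pos, of i K] M[of i] by (simp add: D_def cs_def)
  obtain s \<delta> where s: "strict_mono (s :: nat \<Rightarrow> nat)" and lim: "(\<lambda>n. pmf_dist \<delta> (D (s n))) \<longlonglongrightarrow> 0"
    and \<delta>: "(\<lambda>r. real r * pmf \<delta> r) sums c"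
      "\<And>K. (\<Sum>r<K. entropy_term (pmf \<delta> r) (pmf (poisson_pmf c) r)) \<le> a"
    by (rule entropy_compactness[OF cs cs_lim c mean bound]) blast
  have "\<delta> \<in> F"
  proof (rule ccontr)
    assume "\<delta> \<notin> F"
    moreover have "openin weak_topology (UNIV - F)" using F by (simp add: closedin_def)
    ultimately obtain e where e: "e > 0" "\<And>\<nu>. pmf_dist \<delta> \<nu> < e \<Longrightarrow> \<nu> \<notin> F"
      using openin_weak_topology_imp_l1[of "UNIV - F" \<delta>] by auto
    have "\<forall>\<^sub>F n in sequentially. pmf_dist \<delta> (D (s n)) < e" by (rule order_tendstoD(2)[OF lim e(1)])
    then obtain n where "pmf_dist \<delta> (D (s n)) < e" by (auto simp: eventually_sequentially)
    with e(2) M show False by (auto simp: D_def)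
  qed
  then have "(INF \<delta>\<in>F. eta d t \<delta>) \<le> eta d t \<delta>" by (rule INF_lower)
  also have "\<dots> \<le> ereal a" using eta_le_iff[OF t] \<delta> unfolding c_def by blast
  finally show False using a by simp
qed

theorem theorem2p2:
  fixes t :: real and l :: "nat \<Rightarrow> nat"
  assumes "0 < t"
    and "(\<lambda>n. real (l n) / real n) \<longlonglongrightarrow> rho CARD('d::finite) * t / 2"
  shows "good_rate_function weak_topology (eta CARD('d) t) \<and>
    large_deviation_principle weak_topology
      (\<lambda>n. random_geometric_graph n (l n) :: 'd geometric_graph measure)
      degree_distribution real (eta CARD('d) t)"
proof -
  define c where "c = rho CARD('d) * t"
  have c: "0 < c" using assms(1) rho_pos by (simp add: c_def)
  let ?I = "eta CARD('d) t"
  let ?M = "\<lambda>n. random_geometric_graph n (l n) :: 'd geometric_graph measure"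
  let ?p = "\<lambda>n U. measure (?M n) {\<omega> \<in> space (?M n). degree_distribution n \<omega> \<in> U}"
  \<comment> \<open>The event expressed through the degree multiset, to which the counting estimates
    apply.\<close>
  let ?U = "\<lambda>S n. {M. pmf_of_multiset M \<in> S}"
  note l = assms(2)[folded c_def]
  have good: "good_rate_function weak_topology ?I" by (rule good_rate_function_eta[OF assms(1)])
  \<comment> \<open>The limit is \<open>c / 2\<close>, so \<open>c\<close> itself is an eventual
    upper bound.\<close>
  have lc: "\<forall>\<^sub>F n in sequentially. 0 < l n \<and> real (l n) \<le> c * real n"
  proof -
    have "\<forall>\<^sub>F n in sequentially. 0 < real (l n) / real n" "\<forall>\<^sub>F n in sequentially. real (l n) / real n < c"
      using c by (auto intro: order_tendstoD[OF l])
    then show ?thesis using eventually_gt_at_top[of 0]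
      by eventually_elim (auto simp: zero_less_divide_iff divide_less_eq)
  qed
  have "\<forall>\<^sub>F n in sequentially. 2 * c * real n \<le> real n ^ 2 - real n" using c by real_asymp
  with lc have choose: "\<forall>\<^sub>F n in sequentially. l n \<le> n choose 2"
  proof eventually_elim
    case (elim n)
    then have "2 * real (l n) \<le> 2 * real (n choose 2)" unfolding real_choose_two by linarith
    then show ?case by simp
  qed
  have prob: "\<forall>\<^sub>F n in sequentially. ?p n S = card {E \<in> graphs n (l n). degree_mset n E \<in> ?U S n} / card (graphs n (l n))" for S
    using choose eventually_gt_at_top[of 0]
  proof eventually_elim
    case (elim n)
    then show ?case
      using measure_random_geometric_graph[where 'd = 'd, OF elim(1), of "\<lambda>E. pmf_of_multiset (degree_mset n E) \<in> S"]
      by (simp add: degree_distribution_eq)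
  qed
  have upper: "limsup (\<lambda>n. log_prob (?p n F) / ereal (real n)) \<le> - (INF \<delta>\<in>F. ?I \<delta>)"
    if F: "closedin weak_topology F" for F
  proof (rule dense_ge)
    fix x assume x: "- (INF \<delta>\<in>F. ?I \<delta>) < x"
    show "limsup (\<lambda>n. log_prob (?p n F) / ereal (real n)) \<le> x"
    proof (cases x)
      case (real b)
      then have "ereal (- b) < (INF \<delta>\<in>F. ?I \<delta>)" using x by (metis ereal_uminus_less_reorder uminus_ereal.simps(1))
      \<comment> \<open>The gap between \<open>- b\<close> and \<open>a\<close> is what
        \<open>graph_probability_upper\<close> spends on subexponential factors.\<close>
      then obtain a where a: "ereal (- b) < ereal a" "ereal a < (INF \<delta>\<in>F. ?I \<delta>)" using ereal_dense2 by blast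
      have "\<forall>\<^sub>F n in sequentially. \<forall>M\<in>?U F n. size M = n \<longrightarrow> sum_mset M = 2 * l n \<longrightarrow> a \<le> empirical_entropy M"
        using empirical_entropy_liminf[OF assms F a(2)] by eventually_elim blast
      then have "\<forall>\<^sub>F n in sequentially. card {E \<in> graphs n (l n). degree_mset n E \<in> ?U F n} / card (graphs n (l n)) \<le> exp (n * b)"
        by (rule graph_probability_upper[OF c lc]) (use a(1) in simp)
      then have "\<forall>\<^sub>F n in sequentially. log_prob (?p n F) / ereal (real n) \<le> x"
        using prob[of F] eventually_gt_at_top[of 0]
      proof eventually_elim
        case (elim n)
        show ?case unfolding real by (rule log_prob_div_le) (use elim in auto)
      qed
      then show ?thesis by (rule Limsup_bounded)
    qed (use x in auto)
  qed
  have lower: "- (INF \<delta>\<in>G. ?I \<delta>) \<le> liminf (\<lambda>n. log_prob (?p n G) / ereal (real n))"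
    if G: "openin weak_topology G" for G
  proof (rule dense_le)
    fix x assume x: "x < - (INF \<delta>\<in>G. ?I \<delta>)"
    show "x \<le> liminf (\<lambda>n. log_prob (?p n G) / ereal (real n))"
    proof (cases x)
      case (real b)
      then have "(INF \<delta>\<in>G. ?I \<delta>) < ereal (- b)" using x by (metis ereal_less_uminus_reorder uminus_ereal.simps(1))
      then obtain \<delta> where \<delta>: "\<delta> \<in> G" "?I \<delta> < ereal (- b)" by (auto simp: INF_less_iff)
      then obtain a where a: "?I \<delta> < ereal a" "ereal a < ereal (- b)" using ereal_dense2 by blast
      obtain r where r: "0 < r" "\<And>\<nu>. pmf_dist \<delta> \<nu> < r \<Longrightarrow> \<nu> \<in> G"
        using openin_weak_topology_imp_l1[OF G \<delta>(1)] by blast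
      \<comment> \<open>Half of the gap in the rate keeps \<open>a + e\<close> below
        \<open>- b\<close>. Half of the radius suffices because the distance \<open>r\<close> is
        split between approximating \<open>\<delta>\<close> by types and repairing lists;
        \<open>e / 2 * n\<close> changed degrees cost at most \<open>e\<close>.\<close>
      define e where "e = min ((- b - a) / 2) (r / 2)"
      have e: "0 < e" "a + e < - b" "2 * e \<le> r" using a r by (auto simp: e_def min_def field_simps)
      have mean: "(\<lambda>r. real r * pmf \<delta> r) sums c"
        and bound: "\<And>K. (\<Sum>r<K. entropy_term (pmf \<delta> r) (pmf (poisson_pmf c) r)) \<le> a"
        using eta_le_iff[OF assms(1)] less_imp_le[OF a(1)] unfolding c_def by blast+
      obtain M L where M: "\<forall>\<^sub>F n in sequentially. size (M n) = n \<and> sum_mset (M n) = 2 * l n \<and>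
          card (set_mset (M n)) \<le> L \<and> empirical_entropy (M n) \<le> a + e"
        and close: "\<forall>\<^sub>F n in sequentially. pmf_dist \<delta> (pmf_of_multiset (M n)) < e"
        by (rule approximating_types[OF c l mean bound e(1)]) blast
      have "\<forall>\<^sub>F n in sequentially. \<forall>E w. E \<in> graphs n (l n) \<longrightarrow> w \<in> pair_lists n (l n) \<longrightarrow>
          occupancy_mset n (endpoints w) = M n \<longrightarrow>
          real (card {i \<in> {1..n}. card {e \<in> E. i \<in> e} \<noteq> count_list (endpoints w) i}) \<le> e / 2 * n \<longrightarrow>
          degree_mset n E \<in> ?U G n"
        using close eventually_gt_at_top[of 0]
      proof eventually_elim
        case (elim n)
        show ?case
        proof (intro allI impI)
          fix E w
          assume w: "occupancy_mset n (endpoints w) = M n"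
            and mis: "real (card {i \<in> {1..n}. card {e \<in> E. i \<in> e} \<noteq> count_list (endpoints w) i}) \<le> e / 2 * n"
          let ?\<nu> = "pmf_of_multiset (degree_mset n E)"
          have "pmf_dist ?\<nu> (pmf_of_multiset (M n)) \<le>
              2 * card {i \<in> {1..n}. card {e \<in> E. i \<in> e} \<noteq> count_list (endpoints w) i} / card {1..n}"
            unfolding w[symmetric] degree_mset_def occupancy_mset_def
            using elim(2) by (intro pmf_dist_empirical_le) auto
          also have "\<dots> \<le> e" using mis elim(2) by (simp add: divide_le_eq)
          finally have "pmf_dist (pmf_of_multiset (M n)) ?\<nu> \<le> e" by (simp add: pmf_l1.commute)
          moreover have "pmf_dist \<delta> ?\<nu> \<le> pmf_dist \<delta> (pmf_of_multiset (M n)) + pmf_dist (pmf_of_multiset (M n)) ?\<nu>"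
            by (rule pmf_l1.triangle) auto
          ultimately have "pmf_dist \<delta> ?\<nu> < r" using elim(1) e by linarith
          then show "degree_mset n E \<in> ?U G n" using r(2) by simp
        qed
      qed
      then have "\<forall>\<^sub>F n in sequentially. exp (n * b) \<le> card {E \<in> graphs n (l n). degree_mset n E \<in> ?U G n} / card (graphs n (l n))"
        by (rule graph_probability_lower[OF c lc _ M, rotated]) (use e in auto)
      then have "\<forall>\<^sub>F n in sequentially. x \<le> log_prob (?p n G) / ereal (real n)"
        using prob[of G] eventually_gt_at_top[of 0]
      proof eventually_elim
        case (elim n)
        show ?case unfolding real by (rule log_prob_div_ge) (use elim in auto)
      qed
      then show ?thesis by (rule Liminf_bounded)
    qed (use x in auto)
  qed
  have "\<forall>\<^sub>F n in sequentially. prob_space (?M n) \<and> degree_distribution n \<in> ?M n \<rightarrow>\<^sub>M borel_of_topology weak_topology"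
    using choose by eventually_elim (auto intro: prob_space_random_geometric_graph measurable_degree_distribution)
  then show ?thesis
    using good upper lower filterlim_real_sequentially
    unfolding large_deviation_principle_def good_rate_function_def by blast
qed

end
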